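(* Let $\phi$ be a holomorphic nondegenerate Lagrangian immersion of a complex manifold $(M,J)$, $\dim_{\mathbb{C}}M=n$, into $V=T^*\mathbb{C}^n$, inducing the Kähler metric $g$ on $M$. The immersion $\phi$ is totally complex and hence also induces the data $(\nabla,\omega)$ (connection and symplectic form) on $M$. Moreover: (i) $(M,J,\nabla,\omega)$ is a special Kähler manifold. (ii) $\omega$ coincides with the Kähler form of $g$, i.e. $\omega=g(\cdot,J\cdot)$. (iii) The pull back via $\phi$ of the canonical coordinates $(z^1,\dots,z^n,w_1,\dots,w_n)$ of $V$ defines a conjugate pair of special coordinates around each point of $M$.
   Context: Kähler metrics are allowed to be indefinite. A special complex manifold $(M,J,\nabla)$ is a complex manifold $(M,J)$ together with a flat torsionfree connection $\nabla$ on its real tangent bundle such that $d^\nabla J=0$, i.e. $(\nabla_XJ)Y=(\nabla_YJ)X$ for all $X,Y$. A special symplectic manifold $(M,J,\nabla,\omega)$ is a special complex manifold together with a $\nabla$-parallel symplectic form $\omega$; it is a special Kähler manifold if $\omega$ is $J$-invariant. On a special symplectic manifold, a real special coordinate system is a local coordinate system $(x^1,\dots,x^n,y_1,\dots,y_n)$ of $\nabla$-affine functions (functions $f$ with $\nabla df=0$) with $\omega=2\sum dx^i\wedge dy_i$. A conjugate pair of special coordinates is a pair of holomorphic local coordinate systems $(z^1,\dots,z^n)$ and $(w_1,\dots,w_n)$ such that $(\mathrm{Re}\,z^1,\dots,\mathrm{Re}\,z^n,\mathrm{Re}\,w_1,\dots,\mathrm{Re}\,w_n)$ is a real special coordinate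 system. $V=T^*\mathbb{C}^n=\mathbb{C}^{2n}$ has canonical coordinates $(z^1,\dots,z^n,w_1,\dots,w_n)$, standard complex symplectic form $\Omega=\sum dz^i\wedge dw_i$, standard real structure $\tau$ (complex conjugation) with fixed point set $V^\tau=T^*\mathbb{R}^n=\mathbb{R}^{2n}$, and Hermitian form $\gamma=\sqrt{-1}\,\Omega(\cdot,\tau\cdot)$. Put $x^i=\mathrm{Re}\,z^i$, $y_i=\mathrm{Re}\,w_i$. A holomorphic immersion $\phi:M\to V$ of a connected complex $n$-fold is nondegenerate if $\phi^*\gamma$ is nondegenerate; Lagrangian if $\phi^*\Omega=0$; totally complex if $V^\tau\cap d\phi(T_pM)=0$ for all $p\in M$. A nondegenerate $\phi$ induces the Kähler metric $g=\mathrm{Re}\,\phi^*\gamma$. If $\phi$ is totally complex, the functions $x^i\circ\phi,\ y_j\circ\phi$ are local coordinates around each point of $M$; the induced connection $\nabla$ is the flat torsionfree connection for which these functions are affine, and the induced symplectic form is $\omega=2\phi^*(\sum dx^i\wedge dy_i)$.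
   Formalization: (iii) fails for indefinite g, e.g. φ(s,t)=((s,is),(t,it)). Proved instead: Re z, Re w are always real special coordinates; z, w are a conjugate pair near p iff both differentials at p are injective (true if g is definite at p), and always after a real symplectic change of coordinates. *)

theory Defs
  imports "HOL-Analysis.Analysis"
begin

section \<open>Smooth and holomorphic maps on open subsets of vector spaces\<close>

primrec times_differentiable_on ::
  "nat \<Rightarrow> ('e::real_normed_vector \<Rightarrow> 'f::real_normed_vector) \<Rightarrow> 'e set \<Rightarrow> bool" where
  "times_differentiable_on 0 f S \<longleftrightarrow> continuous_on S f"
| "times_differentiable_on (Suc k) f S \<longleftrightarrow>
     (\<forall>x\<in>S. f differentiable (at x)) \<and>
     (\<forall>v. times_differentiable_on k (\<lambda>x. frechet_derivative f (at x) v) S)"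

text \<open>Only meant for open \<open>S\<close> (and finite-dimensional domains).\<close>

definition smooth_on :: "('e::real_normed_vector \<Rightarrow> 'f::real_normed_vector) \<Rightarrow> 'e set \<Rightarrow> bool" where
  "smooth_on f S \<longleftrightarrow> (\<forall>k. times_differentiable_on k f S)"

definition complex_linear :: "(complex^'n \<Rightarrow> complex^'m) \<Rightarrow> bool" where
  "complex_linear L \<longleftrightarrow> (\<forall>u v. L (u + v) = L u + L v) \<and> (\<forall>a v. L (a *s v) = a *s L v)"

text \<open>Holomorphy in several variables, on an open set \<open>S\<close>: complex differentiability at every point.\<close>

definition holo_on :: "(complex^'n \<Rightarrow> complex^'m) \<Rightarrow> (complex^'n) set \<Rightarrow> bool" where
  "holo_on f S \<longleftrightarrow> (\<forall>x\<in>S. \<exists>L. (f has_derivative L) (at x) \<and> complex_linear L)"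

section \<open>Complex manifolds\<close>

text \<open>A complex manifold of complex dimension \<open>CARD('n)\<close> is given by a topology (whose
  \<open>topspace\<close> is the set of points) and a holomorphic atlas, not necessarily maximal.
  A chart is a pair of a domain and a coordinate map on it.\<close>

record ('a, 'n::finite) cmanifold =
  mtop :: "'a topology"
  atlas :: "('a set \<times> ('a \<Rightarrow> complex^'n)) set"

definition coordinate_map :: "('a, 'n::finite) cmanifold \<Rightarrow> 'a set \<Rightarrow> ('a \<Rightarrow> 'e::euclidean_space) \<Rightarrow> bool" where
  "coordinate_map M U c \<longleftrightarrow> openin (mtop M) U \<and> open (c ` U) \<and>
     homeomorphic_map (subtopology (mtop M) U) (top_of_set (c ` U)) c"

definition complex_manifold :: "('a, 'n::finite) cmanifold \<Rightarrow> bool" where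
  "complex_manifold M \<longleftrightarrow>
     Hausdorff_space (mtop M) \<and> second_countable (mtop M) \<and>
     (\<forall>(U, c)\<in>atlas M. coordinate_map M U c) \<and>
     \<Union> (fst ` atlas M) = topspace (mtop M) \<and>
     (\<forall>(U, c)\<in>atlas M. \<forall>(V, d)\<in>atlas M. holo_on (d \<circ> the_inv_into U c) (c ` (U \<inter> V)))"

definition msmooth_on :: "('a, 'n::finite) cmanifold \<Rightarrow> 'a set \<Rightarrow> ('a \<Rightarrow> 'e::real_normed_vector) \<Rightarrow> bool" where
  "msmooth_on M U f \<longleftrightarrow> (\<forall>(V, c)\<in>atlas M. smooth_on (f \<circ> the_inv_into V c) (c ` (U \<inter> V)))"

definition mholomorphic_on :: "('a, 'n::finite) cmanifold \<Rightarrow> 'a set \<Rightarrow> ('a \<Rightarrow> complex^'m) \<Rightarrow> bool" where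
  "mholomorphic_on M U f \<longleftrightarrow> (\<forall>(V, c)\<in>atlas M. holo_on (f \<circ> the_inv_into V c) (c ` (U \<inter> V)))"

subsection \<open>Tangent spaces and vector fields\<close>

text \<open>One chart of the atlas is selected at every point \<open>p\<close>, and the tangent space \<open>T\<^sub>pM\<close> is
  identified with \<open>complex^'n\<close> by means of it. A vector field is accordingly a function
  \<open>X :: 'a \<Rightarrow> complex^'n\<close>. As the selected charts vary discontinuously with \<open>p\<close>, smoothness of \<open>X\<close>
  is tested on its components \<open>p \<mapsto> dc\<^sub>p (X p)\<close> in the charts \<open>c\<close> of the atlas.\<close>

definition chart_at :: "('a, 'n::finite) cmanifold \<Rightarrow> 'a \<Rightarrow> 'a set \<times> ('a \<Rightarrow> complex^'n)" where
  "chart_at M p = (SOME C. C \<in> atlas M \<and> p \<in> fst C)"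

definition mderiv :: "('a, 'n::finite) cmanifold \<Rightarrow> ('a \<Rightarrow> 'e::real_normed_vector) \<Rightarrow> 'a \<Rightarrow> complex^'n \<Rightarrow> 'e" where
  "mderiv M f p = (case chart_at M p of (U, c) \<Rightarrow> frechet_derivative (f \<circ> the_inv_into U c) (at (c p)))"

definition smooth_field :: "('a, 'n::finite) cmanifold \<Rightarrow> 'a set \<Rightarrow> ('a \<Rightarrow> complex^'n) \<Rightarrow> bool" where
  "smooth_field M U X \<longleftrightarrow> openin (mtop M) U \<and>
     (\<forall>(V, c)\<in>atlas M. msmooth_on M (U \<inter> V) (\<lambda>p. mderiv M c p (X p)))"

text \<open>The charts being holomorphic, the complex structure of every tangent space is
  multiplication by the imaginary unit.\<close>

definition J :: "complex^'n \<Rightarrow> complex^'n" where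
  "J v = \<i> *s v"

text \<open>The bracket at \<open>p\<close> is computed in the chart selected at \<open>p\<close>: \<open>[X,Y] = dY(X) - dX(Y)\<close> for
  the component functions of \<open>X\<close> and \<open>Y\<close> in this chart.\<close>

definition lie_bracket :: "('a, 'n::finite) cmanifold \<Rightarrow> ('a \<Rightarrow> complex^'n) \<Rightarrow> ('a \<Rightarrow> complex^'n) \<Rightarrow> 'a \<Rightarrow> complex^'n" where
  "lie_bracket M X Y p = (let c = snd (chart_at M p) in
     mderiv M (\<lambda>q. mderiv M c q (Y q)) p (X p) - mderiv M (\<lambda>q. mderiv M c q (X q)) p (Y p))"

section \<open>Covariant 2-tensors\<close>

type_synonym ('a, 'n) tensor2 = "'a \<Rightarrow> complex^'n \<Rightarrow> complex^'n \<Rightarrow> real"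

definition smooth_tensor2 :: "('a, 'n::finite) cmanifold \<Rightarrow> ('a, 'n) tensor2 \<Rightarrow> bool" where
  "smooth_tensor2 M b \<longleftrightarrow> (\<forall>p\<in>topspace (mtop M). bilinear (b p)) \<and>
     (\<forall>U X Y. smooth_field M U X \<and> smooth_field M U Y \<longrightarrow> msmooth_on M U (\<lambda>p. b p (X p) (Y p)))"

text \<open>Triviality of the left kernel; used for symmetric, skew and Hermitian forms only.\<close>

definition nondegenerate :: "('v::zero \<Rightarrow> 'v \<Rightarrow> 'k::zero) \<Rightarrow> bool" where
  "nondegenerate b \<longleftrightarrow> (\<forall>u. (\<forall>v. b u v = 0) \<longrightarrow> u = 0)"

definition closed_form2 :: "('a, 'n::finite) cmanifold \<Rightarrow> ('a, 'n) tensor2 \<Rightarrow> bool" where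
  "closed_form2 M b \<longleftrightarrow>
     (\<forall>U X Y Z. smooth_field M U X \<and> smooth_field M U Y \<and> smooth_field M U Z \<longrightarrow>
       (\<forall>p\<in>U. mderiv M (\<lambda>q. b q (Y q) (Z q)) p (X p)
             - mderiv M (\<lambda>q. b q (X q) (Z q)) p (Y p)
             + mderiv M (\<lambda>q. b q (X q) (Y q)) p (Z p)
             - b p (lie_bracket M X Y p) (Z p)
             + b p (lie_bracket M X Z p) (Y p)
             - b p (lie_bracket M Y Z p) (X p) = 0))"

definition symplectic_form :: "('a, 'n::finite) cmanifold \<Rightarrow> ('a, 'n) tensor2 \<Rightarrow> bool" where
  "symplectic_form M \<omega> \<longleftrightarrow> smooth_tensor2 M \<omega> \<and>
     (\<forall>p\<in>topspace (mtop M). (\<forall>u v. \<omega> p u v = - \<omega> p v u) \<and> nondegenerate (\<omega> p)) \<and>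
     closed_form2 M \<omega>"

definition kahler_form :: "('a, 'n::finite) tensor2 \<Rightarrow> ('a, 'n) tensor2" where
  "kahler_form g p u v = g p u (J v)"

text \<open>Possibly indefinite Kaehler metrics.\<close>

definition kahler_metric :: "('a, 'n::finite) cmanifold \<Rightarrow> ('a, 'n) tensor2 \<Rightarrow> bool" where
  "kahler_metric M g \<longleftrightarrow> smooth_tensor2 M g \<and>
     (\<forall>p\<in>topspace (mtop M). (\<forall>u v. g p u v = g p v u) \<and> nondegenerate (g p) \<and>
                            (\<forall>u v. g p (J u) (J v) = g p u v)) \<and>
     closed_form2 M (kahler_form g)"

definition definite :: "('v::zero \<Rightarrow> 'v \<Rightarrow> real) \<Rightarrow> bool" where
  "definite b \<longleftrightarrow> (\<forall>u. u \<noteq> 0 \<longrightarrow> b u u > 0) \<or> (\<forall>u. u \<noteq> 0 \<longrightarrow> b u u < 0)"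

section \<open>Connections on the real tangent bundle\<close>

text \<open>\<open>D p v Y\<close> is the covariant derivative at \<open>p\<close> of a vector field \<open>Y\<close>, smooth near \<open>p\<close>, in the
  direction \<open>v\<close>. Its values are irrelevant for other arguments.\<close>

type_synonym ('a, 'n) connection = "'a \<Rightarrow> complex^'n \<Rightarrow> ('a \<Rightarrow> complex^'n) \<Rightarrow> complex^'n"

definition nabla :: "('a, 'n::finite) connection \<Rightarrow> ('a \<Rightarrow> complex^'n) \<Rightarrow> ('a \<Rightarrow> complex^'n) \<Rightarrow> 'a \<Rightarrow> complex^'n" where
  "nabla D X Y p = D p (X p) Y"

definition affine_connection :: "('a, 'n::finite) cmanifold \<Rightarrow> ('a, 'n) connection \<Rightarrow> bool" where
  "affine_connection M D \<longleftrightarrow>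
     (\<forall>U Y. smooth_field M U Y \<longrightarrow> (\<forall>p\<in>U. linear (\<lambda>v. D p v Y))) \<and>
     (\<forall>U Y Z. smooth_field M U Y \<and> smooth_field M U Z \<longrightarrow>
        (\<forall>p\<in>U. \<forall>v. D p v (\<lambda>q. Y q + Z q) = D p v Y + D p v Z)) \<and>
     (\<forall>U Y f. smooth_field M U Y \<and> msmooth_on M U f \<longrightarrow>
        (\<forall>p\<in>U. \<forall>v. D p v (\<lambda>q. f q *\<^sub>R Y q) = mderiv M f p v *\<^sub>R Y p + f p *\<^sub>R D p v Y)) \<and>
     (\<forall>U Y Z. smooth_field M U Y \<and> smooth_field M U Z \<and> (\<forall>q\<in>U. Y q = Z q) \<longrightarrow>
        (\<forall>p\<in>U. \<forall>v. D p v Y = D p v Z)) \<and>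
     (\<forall>U X Y. smooth_field M U X \<and> smooth_field M U Y \<longrightarrow> smooth_field M U (nabla D X Y))"

definition same_connection :: "('a, 'n::finite) cmanifold \<Rightarrow> ('a, 'n) connection \<Rightarrow> ('a, 'n) connection \<Rightarrow> bool" where
  "same_connection M D D' \<longleftrightarrow> (\<forall>U Y. smooth_field M U Y \<longrightarrow> (\<forall>p\<in>U. \<forall>v. D p v Y = D' p v Y))"

definition torsion_free :: "('a, 'n::finite) cmanifold \<Rightarrow> ('a, 'n) connection \<Rightarrow> bool" where
  "torsion_free M D \<longleftrightarrow> (\<forall>U X Y. smooth_field M U X \<and> smooth_field M U Y \<longrightarrow>
     (\<forall>p\<in>U. nabla D X Y p - nabla D Y X p = lie_bracket M X Y p))"

definition flat :: "('a, 'n::finite) cmanifold \<Rightarrow> ('a, 'n) connection \<Rightarrow> bool" where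
  "flat M D \<longleftrightarrow> (\<forall>U X Y Z. smooth_field M U X \<and> smooth_field M U Y \<and> smooth_field M U Z \<longrightarrow>
     (\<forall>p\<in>U. nabla D X (nabla D Y Z) p - nabla D Y (nabla D X Z) p
             - nabla D (lie_bracket M X Y) Z p = 0))"

text \<open>\<open>(\<nabla>\<^sub>XJ)Y = (\<nabla>\<^sub>YJ)X\<close>.\<close>

definition dJ_zero :: "('a, 'n::finite) cmanifold \<Rightarrow> ('a, 'n) connection \<Rightarrow> bool" where
  "dJ_zero M D \<longleftrightarrow> (\<forall>U X Y. smooth_field M U X \<and> smooth_field M U Y \<longrightarrow>
     (\<forall>p\<in>U. nabla D X (\<lambda>q. J (Y q)) p - J (nabla D X Y p)
           = nabla D Y (\<lambda>q. J (X q)) p - J (nabla D Y X p)))"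

definition parallel_tensor2 :: "('a, 'n::finite) cmanifold \<Rightarrow> ('a, 'n) connection \<Rightarrow> ('a, 'n) tensor2 \<Rightarrow> bool" where
  "parallel_tensor2 M D b \<longleftrightarrow>
     (\<forall>U X Y Z. smooth_field M U X \<and> smooth_field M U Y \<and> smooth_field M U Z \<longrightarrow>
       (\<forall>p\<in>U. mderiv M (\<lambda>q. b q (Y q) (Z q)) p (X p)
             - b p (nabla D X Y p) (Z p) - b p (Y p) (nabla D X Z p) = 0))"

text \<open>\<open>\<nabla>df = 0\<close> on \<open>U\<close>.\<close>

definition affine_function_on :: "('a, 'n::finite) cmanifold \<Rightarrow> ('a, 'n) connection \<Rightarrow> 'a set \<Rightarrow> ('a \<Rightarrow> real) \<Rightarrow> bool" where
  "affine_function_on M D U f \<longleftrightarrow> msmooth_on M U f \<and>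
     (\<forall>W X Y. W \<subseteq> U \<and> smooth_field M W X \<and> smooth_field M W Y \<longrightarrow>
       (\<forall>p\<in>W. mderiv M (\<lambda>q. mderiv M f q (Y q)) p (X p) - mderiv M f p (nabla D X Y p) = 0))"

section \<open>Special manifolds\<close>

definition special_complex :: "('a, 'n::finite) cmanifold \<Rightarrow> ('a, 'n) connection \<Rightarrow> bool" where
  "special_complex M D \<longleftrightarrow> complex_manifold M \<and> affine_connection M D \<and>
     flat M D \<and> torsion_free M D \<and> dJ_zero M D"

definition special_symplectic :: "('a, 'n::finite) cmanifold \<Rightarrow> ('a, 'n) connection \<Rightarrow> ('a, 'n) tensor2 \<Rightarrow> bool" where
  "special_symplectic M D \<omega> \<longleftrightarrow> special_complex M D \<and> symplectic_form M \<omega> \<and> parallel_tensor2 M D \<omega>"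

definition special_kahler :: "('a, 'n::finite) cmanifold \<Rightarrow> ('a, 'n) connection \<Rightarrow> ('a, 'n) tensor2 \<Rightarrow> bool" where
  "special_kahler M D \<omega> \<longleftrightarrow> special_symplectic M D \<omega> \<and>
     (\<forall>p\<in>topspace (mtop M). \<forall>u v. \<omega> p (J u) (J v) = \<omega> p u v)"

subsection \<open>Special coordinates\<close>

text \<open>Wedge product of linear forms, without a factor \<open>1/2\<close>.\<close>

definition wedge :: "('v \<Rightarrow> 'k::comm_ring) \<Rightarrow> ('v \<Rightarrow> 'k) \<Rightarrow> 'v \<Rightarrow> 'v \<Rightarrow> 'k" where
  "wedge \<alpha> \<beta> u v = \<alpha> u * \<beta> v - \<alpha> v * \<beta> u"

definition real_coordinate_system :: "('a, 'n::finite) cmanifold \<Rightarrow> 'a set \<Rightarrow> ('a \<Rightarrow> real^('n + 'n)) \<Rightarrow> bool" where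
  "real_coordinate_system M U f \<longleftrightarrow> coordinate_map M U f \<and> msmooth_on M U f \<and>
     (\<forall>(V, c)\<in>atlas M. smooth_on (c \<circ> the_inv_into U f) (f ` (U \<inter> V)))"

definition holomorphic_coordinate_system :: "('a, 'n::finite) cmanifold \<Rightarrow> 'a set \<Rightarrow> ('a \<Rightarrow> complex^'n) \<Rightarrow> bool" where
  "holomorphic_coordinate_system M U z \<longleftrightarrow> coordinate_map M U z \<and> mholomorphic_on M U z \<and>
     (\<forall>(V, c)\<in>atlas M. holo_on (c \<circ> the_inv_into U z) (z ` (U \<inter> V)))"

text \<open>Elements of \<open>real^('n + 'n)\<close> and \<open>complex^('n + 'n)\<close> are written \<open>(x, y)\<close> and \<open>(z, w)\<close>, the
  first group of coordinates being indexed by \<open>Inl i\<close> and the second one by \<open>Inr i\<close>.\<close>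

definition real_special_coordinates ::
  "('a, 'n::finite) cmanifold \<Rightarrow> ('a, 'n) connection \<Rightarrow> ('a, 'n) tensor2 \<Rightarrow> 'a set \<Rightarrow> ('a \<Rightarrow> real^('n + 'n)) \<Rightarrow> bool" where
  "real_special_coordinates M D \<omega> U f \<longleftrightarrow> real_coordinate_system M U f \<and>
     (\<forall>k. affine_function_on M D U (\<lambda>p. f p $ k)) \<and>
     (\<forall>p\<in>U. \<forall>u v. \<omega> p u v =
        2 * (\<Sum>i\<in>UNIV. wedge (mderiv M (\<lambda>q. f q $ Inl i) p) (mderiv M (\<lambda>q. f q $ Inr i) p) u v))"

definition conjugate_pair ::
  "('a, 'n::finite) cmanifold \<Rightarrow> ('a, 'n) connection \<Rightarrow> ('a, 'n) tensor2 \<Rightarrow> 'a set \<Rightarrow>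
     ('a \<Rightarrow> complex^'n) \<Rightarrow> ('a \<Rightarrow> complex^'n) \<Rightarrow> bool" where
  "conjugate_pair M D \<omega> U z w \<longleftrightarrow>
     holomorphic_coordinate_system M U z \<and> holomorphic_coordinate_system M U w \<and>
     real_special_coordinates M D \<omega> U
       (\<lambda>p. \<chi> k. case k of Inl i \<Rightarrow> Re (z p $ i) | Inr i \<Rightarrow> Re (w p $ i))"

section \<open>The space \<open>V = T\<^sup>*\<complex>\<^sup>n\<close>\<close>

definition zpart :: "complex^('n + 'n) \<Rightarrow> complex^'n" where
  "zpart v = (\<chi> i. v $ Inl i)"

definition wpart :: "complex^('n + 'n) \<Rightarrow> complex^'n" where
  "wpart v = (\<chi> i. v $ Inr i)"

definition repart :: "complex^'m \<Rightarrow> real^'m" where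
  "repart v = (\<chi> k. Re (v $ k))"

definition \<Omega> :: "complex^('n::finite + 'n) \<Rightarrow> complex^('n + 'n) \<Rightarrow> complex" where
  "\<Omega> u v = (\<Sum>i\<in>UNIV. wedge (\<lambda>a. a $ Inl i) (\<lambda>a. a $ Inr i) u v)"

definition \<tau> :: "complex^'m \<Rightarrow> complex^'m" where
  "\<tau> v = (\<chi> k. cnj (v $ k))"

definition \<gamma> :: "complex^('n::finite + 'n) \<Rightarrow> complex^('n + 'n) \<Rightarrow> complex" where
  "\<gamma> u v = \<i> * \<Omega> u (\<tau> v)"

text \<open>\<open>\<Sum>\<^sub>i dx\<^sup>i \<and> dy\<^sub>i\<close> on \<open>V\<close>.\<close>

definition sum_dx_dy :: "complex^('n::finite + 'n) \<Rightarrow> complex^('n + 'n) \<Rightarrow> real" where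
  "sum_dx_dy u v = (\<Sum>i\<in>UNIV. wedge (\<lambda>a. Re (a $ Inl i)) (\<lambda>a. Re (a $ Inr i)) u v)"

text \<open>Linear automorphisms of \<open>V\<close> preserving its complex symplectic and real structures,
  i.e. the group \<open>Sp(\<real>\<^sup>2\<^sup>n)\<close>.\<close>

definition real_symplectic :: "(complex^('n::finite + 'n) \<Rightarrow> complex^('n + 'n)) \<Rightarrow> bool" where
  "real_symplectic A \<longleftrightarrow> complex_linear A \<and> (\<forall>u v. \<Omega> (A u) (A v) = \<Omega> u v) \<and> (\<forall>u. A (\<tau> u) = \<tau> (A u))"

subsection \<open>Immersions into \<open>V\<close> and the induced data\<close>

definition pullback :: "('a, 'n::finite) cmanifold \<Rightarrow> ('a \<Rightarrow> 'e::real_normed_vector) \<Rightarrow>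
    ('e \<Rightarrow> 'e \<Rightarrow> 'k) \<Rightarrow> 'a \<Rightarrow> complex^'n \<Rightarrow> complex^'n \<Rightarrow> 'k" where
  "pullback M \<phi> b p u v = b (mderiv M \<phi> p u) (mderiv M \<phi> p v)"

definition holomorphic_immersion :: "('a, 'n::finite) cmanifold \<Rightarrow> ('a \<Rightarrow> complex^'m) \<Rightarrow> bool" where
  "holomorphic_immersion M \<phi> \<longleftrightarrow> mholomorphic_on M (topspace (mtop M)) \<phi> \<and>
     (\<forall>p\<in>topspace (mtop M). inj (mderiv M \<phi> p))"

definition nondegenerate_map :: "('a, 'n::finite) cmanifold \<Rightarrow> ('a \<Rightarrow> complex^('n + 'n)) \<Rightarrow> bool" where
  "nondegenerate_map M \<phi> \<longleftrightarrow> (\<forall>p\<in>topspace (mtop M). nondegenerate (pullback M \<phi> \<gamma> p))"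

definition lagrangian :: "('a, 'n::finite) cmanifold \<Rightarrow> ('a \<Rightarrow> complex^('n + 'n)) \<Rightarrow> bool" where
  "lagrangian M \<phi> \<longleftrightarrow> (\<forall>p\<in>topspace (mtop M). \<forall>u v. pullback M \<phi> \<Omega> p u v = 0)"

definition totally_complex :: "('a, 'n::finite) cmanifold \<Rightarrow> ('a \<Rightarrow> complex^('n + 'n)) \<Rightarrow> bool" where
  "totally_complex M \<phi> \<longleftrightarrow>
     (\<forall>p\<in>topspace (mtop M). {v. \<tau> v = v} \<inter> range (mderiv M \<phi> p) = {0})"

definition induced_metric :: "('a, 'n::finite) cmanifold \<Rightarrow> ('a \<Rightarrow> complex^('n + 'n)) \<Rightarrow> ('a, 'n) tensor2" where
  "induced_metric M \<phi> p u v = Re (pullback M \<phi> \<gamma> p u v)"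

definition induced_form :: "('a, 'n::finite) cmanifold \<Rightarrow> ('a \<Rightarrow> complex^('n + 'n)) \<Rightarrow> ('a, 'n) tensor2" where
  "induced_form M \<phi> p u v = 2 * pullback M \<phi> sum_dx_dy p u v"

definition induced_connection ::
  "('a, 'n::finite) cmanifold \<Rightarrow> ('a \<Rightarrow> complex^('n + 'n)) \<Rightarrow> ('a, 'n) connection \<Rightarrow> bool" where
  "induced_connection M \<phi> D \<longleftrightarrow> affine_connection M D \<and> flat M D \<and> torsion_free M D \<and>
     (\<forall>k. affine_function_on M D (topspace (mtop M)) (\<lambda>p. Re (\<phi> p $ k)))"

text \<open>For an indefinite metric the pullbacks of \<open>z\<close> and \<open>w\<close> need not be holomorphic coordinate
  systems, although their real parts are always real special coordinates: for the immersion
  \<open>\<phi>(s, t) = (z, w) = ((s, \<i>s), (t, \<i>t))\<close> of \<open>\<complex>\<^sup>2\<close>, which is Lagrangian and nondegenerate (the metric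
  has signature \<open>(2, 2)\<close>), the map \<open>z \<circ> \<phi>\<close> is nowhere a local coordinate system. They form a
  conjugate pair near \<open>p\<close> if and only if their differentials at \<open>p\<close> are injective, as is the case
  if the metric is definite at \<open>p\<close>. In general they do so after a linear
  change of the canonical coordinates by an element of \<open>Sp(\<real>\<^sup>2\<^sup>n)\<close>, which does not
  affect the induced metric, connection and symplectic form.\<close>

definition conjugate_pair_around ::
  "('a, 'n::finite) cmanifold \<Rightarrow> ('a, 'n) connection \<Rightarrow> ('a, 'n) tensor2 \<Rightarrow> ('a \<Rightarrow> complex^('n + 'n)) \<Rightarrow> 'a \<Rightarrow> bool" where
  "conjugate_pair_around M D \<omega> \<psi> p \<longleftrightarrow>
     (\<exists>U. p \<in> U \<and> conjugate_pair M D \<omega> U (zpart \<circ> \<psi>) (wpart \<circ> \<psi>))"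

end

theory Submission
  imports Defs "HOL-Complex_Analysis.Cauchy_Integral_Formula"
begin

text \<open>
  At every point the differential of \<open>\<phi>\<close> has a Lagrangian image \<open>L\<close>, so \<open>\<gamma>(u, v) = \<i>\<Omega>(u, \<tau>v)\<close> vanishes
  on \<open>L\<close> if \<open>v \<in> L\<close> is real; by nondegeneracy \<open>\<phi>\<close> is totally complex, and \<open>F = Re \<phi>\<close> is a
  local diffeomorphism. The identity \<open>[X,Y]f = X(Yf) - Y(Xf)\<close> for arbitrary smooth functions \<open>f\<close>
  reduces all statements about connections and forms to \<open>F\<close> and \<open>\<phi>\<close>: the connection is determined by
  \<open>dF(\<nabla>\<^sub>XY) = X(YF)\<close>; it is torsion-free by the identity for \<open>F\<close> and flat by the identity for \<open>ZF\<close>;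
  the complex linearity of \<open>d\<phi>\<close> gives \<open>d\<^sup>\<nabla>J = 0\<close>. The equality of \<open>\<omega>\<close> and the Kaehler form is
  the pointwise identity \<open>2 \<Sum>dx \<and> dy = Re \<Omega> + Re \<Omega>(\<cdot>, \<tau>\<cdot>)\<close>, whose first term vanishes on \<open>L\<close>.
  Coordinates come from the inverse function theorem; a real symplectic change of coordinates
  making \<open>z\<close> and \<open>w\<close> injective on \<open>L\<close> is a composition of elementary shears.
\<close>



section \<open>Calculus of smooth maps\<close>

text \<open>\<open>holo_on\<close> asks for complex differentiability at each point and nothing
  more, so even the continuity of derivatives has to be extracted from Cauchy's formula on complex
  lines before holomorphic objects can be treated as smooth ones. A tangent vector is read in a
  chart that is selected at its base point without any continuity. A vector field is therefore never
  differentiated as such: only functions \<open>q \<mapsto> mderiv M f q (X q)\<close> are, whose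
  values do not depend on that selection. This is why the connection is handled through its image
  under dF, and why equations between tangent vectors are proved by applying the injective map dF to
  both sides. For an indefinite metric z may have a kernel on L. It consists of null vectors of
  \<gamma>, which settles the definite case. In general a shear adding w_i to z_i, applied where
  needed, forces w_i = 0 on the kernel of z and leaves w alone, so the construction can be repeated
  with z and w exchanged. A real symplectic map acts on Re \<phi> by a real linear map, so it keeps
  the affine functions and with them the connection.\<close>

lemma frechet_derivative_eq:
  "(f has_derivative f') (at x) \<Longrightarrow> frechet_derivative f (at x) = f'"
  by (metis frechet_derivative_at)

lemma frechet_derivative_cong:
  assumes "open S" "x \<in> S" "\<And>y. y \<in> S \<Longrightarrow> f y = g y"
  shows "frechet_derivative f (at x) = frechet_derivative g (at x)"
proof -
  have "(f has_derivative D) (at x) \<longleftrightarrow> (g has_derivative D) (at x)" for D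
    using assms by (metis has_derivative_transform_within_open)
  then show ?thesis
    unfolding frechet_derivative_def by simp
qed

lemma differentiable_cong_open:
  assumes "open S" "x \<in> S" "\<And>y. y \<in> S \<Longrightarrow> f y = g y"
  shows "f differentiable (at x) \<longleftrightarrow> g differentiable (at x)"
  using assms unfolding differentiable_def by (metis has_derivative_transform_within_open)

lemma times_differentiable_on_cong:
  assumes "open S" "\<And>x. x \<in> S \<Longrightarrow> f x = g x"
  shows "times_differentiable_on k f S \<longleftrightarrow> times_differentiable_on k g S"
  using assms(2)
proof (induction k arbitrary: f g)
  case 0
  then show ?case by (simp cong: continuous_on_cong)
next
  case (Suc k)
  have "times_differentiable_on k (\<lambda>x. frechet_derivative f (at x) v) S \<longleftrightarrow>
      times_differentiable_on k (\<lambda>x. frechet_derivative g (at x) v) S" for v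
    by (rule Suc.IH) (metis Suc.prems assms(1) frechet_derivative_cong)
  moreover have "f differentiable (at x) \<longleftrightarrow> g differentiable (at x)" if "x \<in> S" for x
    using differentiable_cong_open[OF assms(1) that] Suc.prems by blast
  ultimately show ?case by simp
qed

lemma times_differentiable_on_derivative:
  "times_differentiable_on (Suc k) f S \<Longrightarrow> x \<in> S \<Longrightarrow>
    (f has_derivative frechet_derivative f (at x)) (at x)"
  by (simp add: frechet_derivative_works)

text \<open>The inductions below produce derivatives by the product and chain rules. This rule
  accepts them in place of the chosen \<open>frechet_derivative\<close>, with which they agree on
  the whole open set.\<close>

lemma times_differentiable_on_SucI:
  assumes "open S" "\<And>x. x \<in> S \<Longrightarrow> (f has_derivative f' x) (at x)"
    "\<And>v. times_differentiable_on k (\<lambda>x. f' x v) S"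
  shows "times_differentiable_on (Suc k) f S"
proof -
  have "times_differentiable_on k (\<lambda>x. frechet_derivative f (at x) v) S" for v
    using times_differentiable_on_cong[OF assms(1), of "\<lambda>x. frechet_derivative f (at x) v" "\<lambda>x. f' x v"]
      assms(2,3) frechet_derivative_eq by metis
  then show ?thesis
    using assms(2) by (auto simp: differentiable_def)
qed

lemma times_differentiable_on_Suc_imp:
  "times_differentiable_on (Suc k) f S \<Longrightarrow> times_differentiable_on k f S"
proof (induction k arbitrary: f)
  case 0
  then show ?case
    by (simp add: continuous_at_imp_continuous_on differentiable_imp_continuous_within)
next
  case (Suc k)
  then show ?case by simp
qed

lemma times_differentiable_on_subset:
  "times_differentiable_on k f S \<Longrightarrow> T \<subseteq> S \<Longrightarrow> times_differentiable_on k f T"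
proof (induction k arbitrary: f)
  case 0
  then show ?case by (auto intro: continuous_on_subset)
next
  case (Suc k)
  then show ?case by auto
qed

lemma times_differentiable_on_const: "times_differentiable_on k (\<lambda>x. c) S"
  by (induction k arbitrary: c) auto

lemma times_differentiable_on_bounded_linear:
  assumes "open S" "bounded_linear L"
  shows "times_differentiable_on k f S \<Longrightarrow> times_differentiable_on k (\<lambda>x. L (f x)) S"
proof (induction k arbitrary: f)
  case 0
  then show ?case by (auto intro: bounded_linear.continuous_on[OF assms(2)])
next
  case (Suc k)
  show ?case
  proof (rule times_differentiable_on_SucI[OF assms(1)])
    show "((\<lambda>x. L (f x)) has_derivative (\<lambda>v. L (frechet_derivative f (at x) v))) (at x)" if "x \<in> S" for x
      using times_differentiable_on_derivative[OF Suc.prems that]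
      by (rule bounded_linear.has_derivative[OF assms(2)])
    show "times_differentiable_on k (\<lambda>x. L (frechet_derivative f (at x) v)) S" for v
      using Suc by simp
  qed
qed

lemma times_differentiable_on_add:
  assumes "open S"
  shows "times_differentiable_on k f S \<Longrightarrow> times_differentiable_on k g S \<Longrightarrow>
    times_differentiable_on k (\<lambda>x. f x + g x) S"
proof (induction k arbitrary: f g)
  case 0
  then show ?case by (auto intro: continuous_intros)
next
  case (Suc k)
  show ?case
  proof (rule times_differentiable_on_SucI[OF assms(1)])
    show "((\<lambda>x. f x + g x) has_derivative
        (\<lambda>v. frechet_derivative f (at x) v + frechet_derivative g (at x) v)) (at x)" if "x \<in> S" for x
      using times_differentiable_on_derivative[OF Suc.prems(1) that]
        times_differentiable_on_derivative[OF Suc.prems(2) that]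
      by (rule has_derivative_add)
    show "times_differentiable_on k
        (\<lambda>x. frechet_derivative f (at x) v + frechet_derivative g (at x) v) S" for v
      using Suc by simp
  qed
qed

lemma times_differentiable_on_sum:
  assumes "open S" "\<And>i. i \<in> I \<Longrightarrow> times_differentiable_on k (f i) S"
  shows "times_differentiable_on k (\<lambda>x. \<Sum>i\<in>I. f i x) S"
  using assms(2)
  by (induction I rule: infinite_finite_induct)
    (auto simp: times_differentiable_on_const intro!: times_differentiable_on_add[OF assms(1)])

lemma times_differentiable_on_bilinear:
  assumes "open S" "bounded_bilinear B"
  shows "times_differentiable_on k f S \<Longrightarrow> times_differentiable_on k g S \<Longrightarrow>
    times_differentiable_on k (\<lambda>x. B (f x) (g x)) S"
proof (induction k arbitrary: f g)
  case 0
  then show ?case by (auto intro: bounded_bilinear.continuous_on[OF assms(2)])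
next
  case (Suc k)
  show ?case
  proof (rule times_differentiable_on_SucI[OF assms(1)])
    show "((\<lambda>x. B (f x) (g x)) has_derivative
        (\<lambda>v. B (f x) (frechet_derivative g (at x) v) + B (frechet_derivative f (at x) v) (g x))) (at x)"
      if "x \<in> S" for x
      using times_differentiable_on_derivative[OF Suc.prems(1) that]
        times_differentiable_on_derivative[OF Suc.prems(2) that]
      by (rule bounded_bilinear.FDERIV[OF assms(2)])
    show "times_differentiable_on k (\<lambda>x. B (f x) (frechet_derivative g (at x) v)
        + B (frechet_derivative f (at x) v) (g x)) S" for v
      using Suc.prems times_differentiable_on_Suc_imp[OF Suc.prems(1)]
        times_differentiable_on_Suc_imp[OF Suc.prems(2)]
      by (intro times_differentiable_on_add[OF assms(1)] Suc.IH) simp_all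
  qed
qed

lemma linear_eq_sum_Basis:
  fixes L :: "'e::euclidean_space \<Rightarrow> 'f::real_vector"
  assumes "linear L"
  shows "L v = (\<Sum>b\<in>Basis. (v \<bullet> b) *\<^sub>R L b)"
proof -
  have "L v = L (\<Sum>b\<in>Basis. (v \<bullet> b) *\<^sub>R b)"
    by (simp add: euclidean_representation)
  also have "\<dots> = (\<Sum>b\<in>Basis. (v \<bullet> b) *\<^sub>R L b)"
    using assms by (simp add: linear_sum linear_scale)
  finally show ?thesis .
qed

text \<open>Higher differentiability is defined through derivatives in fixed directions only.
  Expanding \<open>g x\<close> in a basis turns a varying direction into scalar coefficients, to
  which the bilinear rule applies.\<close>

lemma times_differentiable_on_apply:
  fixes g :: "'e::real_normed_vector \<Rightarrow> 'd::euclidean_space"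
  assumes "open S" "\<And>x. x \<in> S \<Longrightarrow> linear (A x)"
    "\<And>b. times_differentiable_on k (\<lambda>x. A x b) S" "times_differentiable_on k g S"
  shows "times_differentiable_on k (\<lambda>x. A x (g x)) S"
proof -
  have "times_differentiable_on k (\<lambda>x. \<Sum>b\<in>Basis. (g x \<bullet> b) *\<^sub>R A x b) S"
    by (intro times_differentiable_on_sum assms
      times_differentiable_on_bilinear[OF assms(1) bounded_bilinear_scaleR]
      times_differentiable_on_bounded_linear[OF assms(1) bounded_linear_inner_left])
  moreover have "A x (g x) = (\<Sum>b\<in>Basis. (g x \<bullet> b) *\<^sub>R A x b)" if "x \<in> S" for x
    by (rule linear_eq_sum_Basis[OF assms(2)[OF that]])
  ultimately show ?thesis
    by (subst times_differentiable_on_cong[OF assms(1)])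
qed

lemma times_differentiable_on_componentwise:
  fixes f :: "'e::real_normed_vector \<Rightarrow> 'd::euclidean_space"
  assumes "open S" "\<And>b. b \<in> Basis \<Longrightarrow> times_differentiable_on k (\<lambda>x. f x \<bullet> b) S"
  shows "times_differentiable_on k f S"
proof -
  have "times_differentiable_on k (\<lambda>x. \<Sum>b\<in>Basis. (f x \<bullet> b) *\<^sub>R b) S"
    using assms by (intro times_differentiable_on_sum
      times_differentiable_on_bounded_linear[OF _ bounded_linear_scaleR_left])
  then show ?thesis by (simp add: euclidean_representation)
qed

lemma times_differentiable_on_compose:
  fixes g :: "'e::real_normed_vector \<Rightarrow> 'd::euclidean_space"
  assumes "open S" "open T" "g ` S \<subseteq> T"
  shows "times_differentiable_on k f T \<Longrightarrow> times_differentiable_on k g S \<Longrightarrow>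
    times_differentiable_on k (\<lambda>x. f (g x)) S"
proof (induction k arbitrary: f)
  case 0
  then show ?case using assms(3) by (auto intro: continuous_on_compose2)
next
  case (Suc k)
  show ?case
  proof (rule times_differentiable_on_SucI[OF assms(1)])
    show "((\<lambda>x. f (g x)) has_derivative
        (\<lambda>v. frechet_derivative f (at (g x)) (frechet_derivative g (at x) v))) (at x)" if "x \<in> S" for x
      using times_differentiable_on_derivative[OF Suc.prems(2) that]
        times_differentiable_on_derivative[OF Suc.prems(1)] assms(3) that
      by (auto intro: has_derivative_compose)
    show "times_differentiable_on k
      (\<lambda>x. frechet_derivative f (at (g x)) (frechet_derivative g (at x) v)) S" for v
    proof (rule times_differentiable_on_apply[OF assms(1)])
      show "linear (frechet_derivative f (at (g x)))" if "x \<in> S" for x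
        using Suc.prems(1) assms(3) that
        by (simp add: image_subset_iff linear_frechet_derivative)
      \<comment> \<open>The induction hypothesis is used for the derivative of f in the fixed
        direction b, still composed with g. Hence f varies in the induction and g does not.\<close>
      show "times_differentiable_on k (\<lambda>x. frechet_derivative f (at (g x)) b) S" for b
        by (rule Suc.IH) (use Suc.prems times_differentiable_on_Suc_imp[OF Suc.prems(2)] in auto)
    qed (use Suc.prems in auto)
  qed
qed

lemma times_differentiable_on_mult:
  fixes f g :: "'e::real_normed_vector \<Rightarrow> real"
  shows "open S \<Longrightarrow> times_differentiable_on k f S \<Longrightarrow> times_differentiable_on k g S \<Longrightarrow>
    times_differentiable_on k (\<lambda>x. f x * g x) S"
  by (rule times_differentiable_on_bilinear[OF _ bounded_bilinear_mult])

lemma times_differentiable_on_prod: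
  fixes f :: "'i \<Rightarrow> 'e::real_normed_vector \<Rightarrow> real"
  assumes "open S" "\<And>i. i \<in> I \<Longrightarrow> times_differentiable_on k (f i) S"
  shows "times_differentiable_on k (\<lambda>x. \<Prod>i\<in>I. f i x) S"
  using assms(2)
  by (induction I rule: infinite_finite_induct)
    (auto simp: times_differentiable_on_const intro!: times_differentiable_on_mult[OF assms(1)])

text \<open>The derivative of 1/f contains 1/f again, but only to the order already reached, so the
  induction closes.\<close>

lemma times_differentiable_on_inverse:
  fixes f :: "'e::real_normed_vector \<Rightarrow> real"
  assumes "open S" "\<And>x. x \<in> S \<Longrightarrow> f x \<noteq> 0"
  shows "times_differentiable_on k f S \<Longrightarrow> times_differentiable_on k (\<lambda>x. inverse (f x)) S"
proof (induction k)
  case 0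
  then show ?case using assms by (auto intro: continuous_intros)
next
  case (Suc k)
  show ?case
  proof (rule times_differentiable_on_SucI[OF assms(1)])
    show "((\<lambda>x. inverse (f x)) has_derivative
       (\<lambda>v. - (inverse (f x) * frechet_derivative f (at x) v * inverse (f x)))) (at x)" if "x \<in> S" for x
      using assms(2)[OF that] times_differentiable_on_derivative[OF Suc.prems that]
      by (rule Deriv.has_derivative_inverse)
    show "times_differentiable_on k
       (\<lambda>x. - (inverse (f x) * frechet_derivative f (at x) v * inverse (f x))) S" for v
      using Suc times_differentiable_on_Suc_imp[OF Suc.prems]
      by (intro times_differentiable_on_bounded_linear[OF assms(1) bounded_linear_minus[OF bounded_linear_ident]]
         times_differentiable_on_mult assms(1)) auto
  qed
qed

lemma times_differentiable_on_det:
  fixes A :: "'e::real_normed_vector \<Rightarrow> real^'m^'m"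
  assumes "open S" "\<And>i j. times_differentiable_on k (\<lambda>x. A x $ i $ j) S"
  shows "times_differentiable_on k (\<lambda>x. det (A x)) S"
  unfolding det_def
  by (intro times_differentiable_on_sum times_differentiable_on_mult times_differentiable_on_prod
    times_differentiable_on_const assms)

text \<open>Cramer's rule writes u as a quotient of determinants in the entries of
  \<open>A x\<close> and \<open>v x\<close>. So u inherits their regularity, although nothing at all
  is assumed about its dependence on x.\<close>

lemma times_differentiable_on_solve:
  fixes A :: "'e::real_normed_vector \<Rightarrow> real^'m \<Rightarrow> real^'m"
  assumes S: "open S" and A: "\<And>x. x \<in> S \<Longrightarrow> linear (A x) \<and> inj (A x)"
    "\<And>b. times_differentiable_on k (\<lambda>x. A x b) S"
    and v: "times_differentiable_on k v S"
    and u: "\<And>x. x \<in> S \<Longrightarrow> A x (u x) = v x"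
  shows "times_differentiable_on k u S"
proof -
  let ?N = "\<lambda>x l. \<chi> i j. if j = l then v x $ i else matrix (A x) $ i $ j"
  have comp: "times_differentiable_on k (\<lambda>x. w x $ i) S"
    if "times_differentiable_on k w S" for w :: "'e \<Rightarrow> real^'m" and i
    using times_differentiable_on_bounded_linear[OF S bounded_linear_vec_nth that] .
  have N: "times_differentiable_on k (\<lambda>x. det (?N x l)) S" for l
  proof (rule times_differentiable_on_det[OF S])
    show "times_differentiable_on k (\<lambda>x. ?N x l $ i $ j) S" for i j
      using comp[OF A(2)] comp[OF v] by (cases "j = l") (simp_all add: matrix_def)
  qed
  have D: "times_differentiable_on k (\<lambda>x. det (matrix (A x))) S"
    by (rule times_differentiable_on_det[OF S]) (use comp[OF A(2)] in \<open>auto simp: matrix_def\<close>)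
  have nz: "det (matrix (A x)) \<noteq> 0" if "x \<in> S" for x
    using A(1)[OF that] by (simp add: det_nz_iff_inj)
  have "u x = (\<chi> l. det (?N x l) * inverse (det (matrix (A x))))" if "x \<in> S" for x
    using cramer[OF nz[OF that], of "u x" "v x"] u[OF that] A(1)[OF that]
    by (simp add: matrix_works divide_inverse)
  then have *: "u x \<bullet> axis l 1 = det (?N x l) * inverse (det (matrix (A x)))" if "x \<in> S" for x l
    using that by (simp add: inner_axis)
  have "times_differentiable_on k (\<lambda>x. u x \<bullet> axis l 1) S" for l
  proof -
    have "times_differentiable_on k (\<lambda>x. det (?N x l) * inverse (det (matrix (A x)))) S"
      by (intro times_differentiable_on_mult times_differentiable_on_inverse S N D nz)
    then show ?thesis
      by (rule iffD2[OF times_differentiable_on_cong[OF S], rotated]) (rule *)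
  qed
  then show ?thesis
    by - (rule times_differentiable_on_componentwise[OF S], auto simp: Basis_vec_def)
qed

section \<open>Rules for smooth maps on open sets\<close>

lemma smooth_on_cong:
  assumes "open S" "\<And>x. x \<in> S \<Longrightarrow> f x = g x"
  shows "smooth_on f S \<longleftrightarrow> smooth_on g S"
  using times_differentiable_on_cong[OF assms] by (simp add: smooth_on_def)

lemma smooth_on_subset: "smooth_on f S \<Longrightarrow> T \<subseteq> S \<Longrightarrow> smooth_on f T"
  unfolding smooth_on_def by (metis times_differentiable_on_subset)

lemma smooth_on_has_derivative:
  "smooth_on f S \<Longrightarrow> x \<in> S \<Longrightarrow> (f has_derivative frechet_derivative f (at x)) (at x)"
  unfolding smooth_on_def using times_differentiable_on_derivative by metis

lemma smooth_on_derivative: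
  "smooth_on f S \<Longrightarrow> smooth_on (\<lambda>x. frechet_derivative f (at x) v) S"
  unfolding smooth_on_def by (metis times_differentiable_on.simps(2))

lemma smooth_on_continuous: "smooth_on f S \<Longrightarrow> continuous_on S f"
  unfolding smooth_on_def by (metis times_differentiable_on.simps(1))

lemma smooth_on_bounded_linear:
  "open S \<Longrightarrow> bounded_linear L \<Longrightarrow> smooth_on f S \<Longrightarrow> smooth_on (\<lambda>x. L (f x)) S"
  unfolding smooth_on_def by (metis times_differentiable_on_bounded_linear)

lemma smooth_on_bilinear:
  "open S \<Longrightarrow> bounded_bilinear B \<Longrightarrow> smooth_on f S \<Longrightarrow> smooth_on g S \<Longrightarrow> smooth_on (\<lambda>x. B (f x) (g x)) S"
  unfolding smooth_on_def by (rule allI, rule times_differentiable_on_bilinear[of S B _ f g]) auto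

lemma smooth_on_compose:
  fixes g :: "'e::real_normed_vector \<Rightarrow> 'd::euclidean_space"
  shows "open S \<Longrightarrow> open T \<Longrightarrow> g ` S \<subseteq> T \<Longrightarrow> smooth_on f T \<Longrightarrow> smooth_on g S \<Longrightarrow> smooth_on (\<lambda>x. f (g x)) S"
  unfolding smooth_on_def by (rule allI, rule times_differentiable_on_compose[of S T g _ f]) auto

lemma smooth_on_derivative_field:
  fixes f :: "'e::euclidean_space \<Rightarrow> 'f::real_normed_vector"
  assumes "open S" "smooth_on f S" "smooth_on Y S"
  shows "smooth_on (\<lambda>x. frechet_derivative f (at x) (Y x)) S"
  unfolding smooth_on_def
proof
  fix k
  show "times_differentiable_on k (\<lambda>x. frechet_derivative f (at x) (Y x)) S"
  proof (rule times_differentiable_on_apply[OF assms(1)])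
    show "linear (frechet_derivative f (at x))" if "x \<in> S" for x
      by (rule has_derivative_linear[OF smooth_on_has_derivative[OF assms(2) that]])
  qed (use smooth_on_derivative[OF assms(2)] assms(3) in \<open>auto simp: smooth_on_def\<close>)
qed

section \<open>Symmetry of second derivatives\<close>

text \<open>The mean value theorem is applied in direction b to the difference of f along a, and
  then in direction a to the derivative so obtained. In this order a single mixed derivative
  appears, and its continuity alone determines the limit of the difference quotient.\<close>

lemma second_difference_mvt:
  fixes f :: "'e::real_normed_vector \<Rightarrow> real"
  assumes f: "\<And>t u. 0 \<le> t \<Longrightarrow> t \<le> s \<Longrightarrow> 0 \<le> u \<Longrightarrow> u \<le> s \<Longrightarrow>
      (f has_derivative f' (x + t *\<^sub>R a + u *\<^sub>R b)) (at (x + t *\<^sub>R a + u *\<^sub>R b))"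
    and f': "\<And>t u. 0 \<le> t \<Longrightarrow> t \<le> s \<Longrightarrow> 0 \<le> u \<Longrightarrow> u \<le> s \<Longrightarrow>
      ((\<lambda>x. f' x b) has_derivative f'' (x + t *\<^sub>R a + u *\<^sub>R b)) (at (x + t *\<^sub>R a + u *\<^sub>R b))"
    and "s > 0"
  obtains t u where "0 < t" "t < s" "0 < u" "u < s"
    "f (x + s *\<^sub>R a + s *\<^sub>R b) - f (x + s *\<^sub>R a) - f (x + s *\<^sub>R b) + f x
      = s * s * f'' (x + t *\<^sub>R a + u *\<^sub>R b) a"
proof -
  \<comment> \<open>The summand \<open>0 *\<^sub>R a\<close> makes both terms instances of
    \<open>g1\<close>, with t = s and t = 0.\<close>
  let ?g = "\<lambda>u. f (x + s *\<^sub>R a + u *\<^sub>R b) - f (x + 0 *\<^sub>R a + u *\<^sub>R b)"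
  let ?g' = "\<lambda>u. f' (x + s *\<^sub>R a + u *\<^sub>R b) b - f' (x + 0 *\<^sub>R a + u *\<^sub>R b) b"
  have lin: "linear (f' (x + t *\<^sub>R a + u *\<^sub>R b))" "linear (f'' (x + t *\<^sub>R a + u *\<^sub>R b))"
    if "0 \<le> t" "t \<le> s" "0 \<le> u" "u \<le> s" for t u
    using f[OF that] f'[OF that] has_derivative_linear by auto
  have g1: "((\<lambda>u. f (x + t *\<^sub>R a + u *\<^sub>R b)) has_real_derivative f' (x + t *\<^sub>R a + u *\<^sub>R b) b) (at u)"
    if "0 \<le> t" "t \<le> s" "0 \<le> u" "u \<le> s" for t u
  proof -
    have "((\<lambda>u. x + t *\<^sub>R a + u *\<^sub>R b) has_derivative (\<lambda>h. h *\<^sub>R b)) (at u)"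
      by (auto intro!: derivative_eq_intros)
    from has_derivative_compose[OF this f[OF that]] show ?thesis
      using lin(1)[OF that] by (simp add: has_field_derivative_def linear_scale mult_commute_abs)
  qed
  have "\<exists>u>0. u < s \<and> ?g s - ?g 0 = (s - 0) * ?g' u"
    using \<open>s > 0\<close> by (intro MVT2 DERIV_diff g1) auto
  then obtain u where u: "0 < u" "u < s" "?g s - ?g 0 = s * ?g' u" by auto
  have "\<exists>t>0. t < s \<and> f' (x + s *\<^sub>R a + u *\<^sub>R b) b - f' (x + 0 *\<^sub>R a + u *\<^sub>R b) b
     = (s - 0) * f'' (x + t *\<^sub>R a + u *\<^sub>R b) a"
  proof (rule MVT2[OF \<open>s > 0\<close>])
    fix t :: real assume t: "0 \<le> t" "t \<le> s"
    have "((\<lambda>t. x + t *\<^sub>R a + u *\<^sub>R b) has_derivative (\<lambda>h. h *\<^sub>R a)) (at t)"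
      by (auto intro!: derivative_eq_intros)
    from has_derivative_compose[OF this f'[OF t]]
    show "((\<lambda>t. f' (x + t *\<^sub>R a + u *\<^sub>R b) b) has_real_derivative f'' (x + t *\<^sub>R a + u *\<^sub>R b) a) (at t)"
      using lin(2)[OF t] u by (simp add: has_field_derivative_def linear_scale mult_commute_abs)
  qed
  then obtain t where t: "0 < t" "t < s"
    "?g' u = s * f'' (x + t *\<^sub>R a + u *\<^sub>R b) a" by auto
  show thesis
    using that[OF t(1,2) u(1,2)] u(3) t(3) by (simp add: algebra_simps)
qed

lemma second_derivative_limit:
  fixes f :: "'e::real_normed_vector \<Rightarrow> real"
  assumes "open S" "smooth_on f S" "x \<in> S"
  shows "((\<lambda>s. (f (x + s *\<^sub>R a + s *\<^sub>R b) - f (x + s *\<^sub>R a) - f (x + s *\<^sub>R b) + f x) / (s * s)) \<longlongrightarrow>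
     frechet_derivative (\<lambda>y. frechet_derivative f (at y) b) (at x) a) (at_right 0)"
proof (rule tendstoI)
  fix e :: real assume "e > 0"
  let ?F = "\<lambda>y. frechet_derivative (\<lambda>y. frechet_derivative f (at y) b) (at y)"
  have "continuous_on S (\<lambda>y. ?F y a)"
    by (intro smooth_on_continuous smooth_on_derivative assms(2))
  then have "isCont (\<lambda>y. ?F y a) x"
    using assms continuous_on_eq_continuous_at by blast
  then obtain d where d: "d > 0" "\<And>y. dist y x < d \<Longrightarrow> dist (?F y a) (?F x a) < e"
    using \<open>e > 0\<close> unfolding continuous_at_eps_delta by blast
  obtain r where r: "r > 0" "ball x r \<subseteq> S"
    using assms openE by blast
  \<comment> \<open>For t and u between 0 and s < s0 the displacement has norm at most s(|a| + |b|),
    which is below both radii. The summand 1 keeps the denominator positive.\<close>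
  define s0 where "s0 = min d r / (norm a + norm b + 1)"
  have "s0 > 0" using d r by (simp add: s0_def add_nonneg_pos)
  have near: "dist (x + t *\<^sub>R a + u *\<^sub>R b) x < min d r"
    if "0 \<le> t" "t \<le> s" "0 \<le> u" "u \<le> s" "0 < s" "s < s0" for s t u
  proof -
    have "dist (x + t *\<^sub>R a + u *\<^sub>R b) x \<le> norm (t *\<^sub>R a) + norm (u *\<^sub>R b)"
      by (simp add: dist_norm) (metis add.assoc add_diff_cancel_left' norm_scaleR norm_triangle_ineq)
    also have "\<dots> \<le> s * norm a + s * norm b"
      using that by (intro add_mono) (auto intro: mult_right_mono)
    also have "\<dots> < s * (norm a + norm b + 1)"
      using that by (simp add: algebra_simps)
    also have "\<dots> < min d r"
      using that(6) by (simp add: s0_def pos_less_divide_eq add_nonneg_pos)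
    finally show ?thesis .
  qed
  have "dist ((f (x + s *\<^sub>R a + s *\<^sub>R b) - f (x + s *\<^sub>R a) - f (x + s *\<^sub>R b) + f x) / (s * s)) (?F x a) < e"
    if "0 < s" "s < s0" for s
  proof -
    have inS: "x + t *\<^sub>R a + u *\<^sub>R b \<in> S" if "0 \<le> t" "t \<le> s" "0 \<le> u" "u \<le> s" for t u
      using near[OF that \<open>0 < s\<close> \<open>s < s0\<close>] r(2) by (auto simp: dist_commute)
    obtain t u where "0 < t" "t < s" "0 < u" "u < s"
      "f (x + s *\<^sub>R a + s *\<^sub>R b) - f (x + s *\<^sub>R a) - f (x + s *\<^sub>R b) + f x
        = s * s * ?F (x + t *\<^sub>R a + u *\<^sub>R b) a"
      by (rule second_difference_mvt[where f = f and f' = "\<lambda>y. frechet_derivative f (at y)" and f'' = ?F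
          and x = x and a = a and b = b and s = s])
        (use \<open>0 < s\<close> inS in \<open>auto intro!: smooth_on_has_derivative[OF assms(2)]
          smooth_on_has_derivative[OF smooth_on_derivative[OF assms(2)]]\<close>)
    moreover from this have "dist (?F (x + t *\<^sub>R a + u *\<^sub>R b) a) (?F x a) < e"
      using near[of t s u] that by (intro d(2)) auto
    ultimately show ?thesis using \<open>0 < s\<close> by simp
  qed
  then show "\<forall>\<^sub>F s in at_right 0. dist ((f (x + s *\<^sub>R a + s *\<^sub>R b) - f (x + s *\<^sub>R a) - f (x + s *\<^sub>R b) + f x)
      / (s * s)) (?F x a) < e"
    using \<open>s0 > 0\<close> unfolding eventually_at_right_field by auto
qed

text \<open>The second difference is symmetric in a and b, so both mixed derivatives are limits of
  the same quotient.\<close>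

lemma second_derivative_symmetric_real:
  fixes f :: "'e::real_normed_vector \<Rightarrow> real"
  assumes "open S" "smooth_on f S" "x \<in> S"
  shows "frechet_derivative (\<lambda>y. frechet_derivative f (at y) b) (at x) a
    = frechet_derivative (\<lambda>y. frechet_derivative f (at y) a) (at x) b"
proof (rule tendsto_unique[OF _ second_derivative_limit[OF assms]])
  show "((\<lambda>s. (f (x + s *\<^sub>R a + s *\<^sub>R b) - f (x + s *\<^sub>R a) - f (x + s *\<^sub>R b) + f x) / (s * s)) \<longlongrightarrow>
     frechet_derivative (\<lambda>y. frechet_derivative f (at y) a) (at x) b) (at_right 0)"
    using second_derivative_limit[OF assms, of b a] by (simp add: algebra_simps)
qed simp

lemma frechet_derivative_bounded_linear:
  assumes "bounded_linear L" "f differentiable (at x)"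
  shows "frechet_derivative (\<lambda>x. L (f x)) (at x) v = L (frechet_derivative f (at x) v)"
proof -
  have "((\<lambda>x. L (f x)) has_derivative (\<lambda>v. L (frechet_derivative f (at x) v))) (at x)"
    using assms(2) by (intro bounded_linear.has_derivative[OF assms(1)]) (simp add: frechet_derivative_works)
  then show ?thesis by (simp add: frechet_derivative_eq)
qed

lemma second_derivative_symmetric:
  fixes f :: "'e::real_normed_vector \<Rightarrow> 'f::euclidean_space"
  assumes S: "open S" and f: "smooth_on f S" and x: "x \<in> S"
  shows "frechet_derivative (\<lambda>y. frechet_derivative f (at y) b) (at x) a
    = frechet_derivative (\<lambda>y. frechet_derivative f (at y) a) (at x) b"
proof (rule euclidean_eqI)
  fix k :: 'f
  have *: "frechet_derivative (\<lambda>y. frechet_derivative f (at y) b) (at x) a \<bullet> k =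
    frechet_derivative (\<lambda>y. frechet_derivative (\<lambda>z. f z \<bullet> k) (at y) b) (at x) a" for a b
  proof -
    have "frechet_derivative (\<lambda>y. frechet_derivative f (at y) b) (at x) a \<bullet> k =
      frechet_derivative (\<lambda>y. frechet_derivative f (at y) b \<bullet> k) (at x) a"
      using smooth_on_has_derivative[OF smooth_on_derivative[OF f] x]
      by (subst frechet_derivative_bounded_linear[OF bounded_linear_inner_left])
         (auto simp: differentiable_def)
    also have "frechet_derivative (\<lambda>y. frechet_derivative f (at y) b \<bullet> k) (at x)
        = frechet_derivative (\<lambda>y. frechet_derivative (\<lambda>z. f z \<bullet> k) (at y) b) (at x)"
    proof (rule frechet_derivative_cong[OF S x])
      fix y assume "y \<in> S"
      then have "f differentiable (at y)"
        using smooth_on_has_derivative[OF f] by (auto simp: differentiable_def)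
      then show "frechet_derivative f (at y) b \<bullet> k = frechet_derivative (\<lambda>z. f z \<bullet> k) (at y) b"
        by (rule frechet_derivative_bounded_linear[OF bounded_linear_inner_left, symmetric])
    qed
    finally show ?thesis .
  qed
  show "frechet_derivative (\<lambda>y. frechet_derivative f (at y) b) (at x) a \<bullet> k
    = frechet_derivative (\<lambda>y. frechet_derivative f (at y) a) (at x) b \<bullet> k"
    unfolding * by (rule second_derivative_symmetric_real[OF S smooth_on_bounded_linear[OF S bounded_linear_inner_left f] x])
qed

text \<open>After the product rule, symmetry of the second derivative exchanges u and the value of
  Y. In the commutator of two fields the second-order terms then cancel, and only the derivatives of
  the components survive.\<close>

lemma derivative_of_derivative_field:
  fixes f :: "'e::euclidean_space \<Rightarrow> 'f::euclidean_space"
  assumes S: "open S" and f: "smooth_on f S" and Y: "smooth_on Y S" and x: "x \<in> S"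
  shows "frechet_derivative (\<lambda>y. frechet_derivative f (at y) (Y y)) (at x) u
    = frechet_derivative (\<lambda>y. frechet_derivative f (at y) u) (at x) (Y x)
      + frechet_derivative f (at x) (frechet_derivative Y (at x) u)"
proof -
  let ?f = "\<lambda>x. frechet_derivative f (at x)"
  let ?S = "\<lambda>b. frechet_derivative (\<lambda>y. ?f y b) (at x)"
  let ?Y = "frechet_derivative Y (at x)"
  have "((\<lambda>y. \<Sum>b\<in>Basis. (Y y \<bullet> b) *\<^sub>R ?f y b) has_derivative
     (\<lambda>u. \<Sum>b\<in>Basis. (Y x \<bullet> b) *\<^sub>R ?S b u + (?Y u \<bullet> b) *\<^sub>R ?f x b)) (at x)"
    by (intro has_derivative_sum bounded_bilinear.FDERIV[OF bounded_bilinear_scaleR]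
        bounded_linear.has_derivative[OF bounded_linear_inner_left]
        smooth_on_has_derivative[OF smooth_on_derivative[OF f] x] smooth_on_has_derivative[OF Y x])
  then have "((\<lambda>y. ?f y (Y y)) has_derivative
     (\<lambda>u. \<Sum>b\<in>Basis. (Y x \<bullet> b) *\<^sub>R ?S b u + (?Y u \<bullet> b) *\<^sub>R ?f x b)) (at x)"
    by (rule has_derivative_transform_within_open[OF _ S x])
      (rule linear_eq_sum_Basis[OF has_derivative_linear[OF smooth_on_has_derivative[OF f]], symmetric])
  then have "frechet_derivative (\<lambda>y. ?f y (Y y)) (at x) u
     = (\<Sum>b\<in>Basis. (Y x \<bullet> b) *\<^sub>R ?S b u) + (\<Sum>b\<in>Basis. (?Y u \<bullet> b) *\<^sub>R ?f x b)"
    by (simp add: frechet_derivative_eq sum.distrib)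
  also have "(\<Sum>b\<in>Basis. (Y x \<bullet> b) *\<^sub>R ?S b u) = (\<Sum>b\<in>Basis. (Y x \<bullet> b) *\<^sub>R ?S u b)"
    by (simp only: second_derivative_symmetric[OF S f x, where a = u])
  also have "\<dots> = ?S u (Y x)"
    by (rule linear_eq_sum_Basis[OF has_derivative_linear, symmetric,
      OF smooth_on_has_derivative[OF smooth_on_derivative[OF f] x]])
  also have "(\<Sum>b\<in>Basis. (?Y u \<bullet> b) *\<^sub>R ?f x b) = ?f x (?Y u)"
    by (rule linear_eq_sum_Basis[OF has_derivative_linear, symmetric, OF smooth_on_has_derivative[OF f x]])
  finally show ?thesis .
qed


section \<open>Holomorphic maps of several variables\<close>

lemma complex_linear_scale: "complex_linear L \<Longrightarrow> L (a *s v) = a *s L v"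
  by (simp add: complex_linear_def)

lemma scaleR_conv_smult: "(c::real) *\<^sub>R v = complex_of_real c *s (v :: complex^'n)"
  by (simp add: vec_eq_iff) (simp add: scaleR_conv_of_real)

lemma complex_linear_linear: "complex_linear L \<Longrightarrow> linear L"
  unfolding complex_linear_def by (auto simp: linear_iff scaleR_conv_smult)

lemma norm_smult: "norm (a *s v) = norm a * norm (v :: complex^'n)"
  by (simp add: norm_vec_def norm_mult L2_set_right_distrib)

lemma linear_smult_left: "linear (\<lambda>a. a *s (v :: complex^'n))"
  by (auto simp: linear_iff vec_eq_iff algebra_simps)

lemma linear_smult_right: "linear (\<lambda>v. a *s (v :: complex^'n))"
  by (auto simp: linear_iff vec_eq_iff algebra_simps)

lemma continuous_on_smult [continuous_intros]:
  fixes g :: "'a::topological_space \<Rightarrow> complex^'n"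
  assumes "continuous_on S f" "continuous_on S g"
  shows "continuous_on S (\<lambda>x. f x *s g x)"
  unfolding vector_scalar_mult_def using assms by (intro continuous_intros)

lemma has_derivative_vec_iff:
  fixes f :: "'e::real_normed_vector \<Rightarrow> complex^'m"
  shows "(f has_derivative D) (at x) \<longleftrightarrow>
    (\<forall>k. ((\<lambda>x. f x $ k) has_derivative (\<lambda>v. D v $ k)) (at x))"
proof
  assume R: "\<forall>k. ((\<lambda>x. f x $ k) has_derivative (\<lambda>v. D v $ k)) (at x)"
  show "(f has_derivative D) (at x)"
    unfolding has_derivative_componentwise_within[of f]
  proof
    fix b :: "complex^'m" assume "b \<in> Basis"
    then obtain k c where b: "b = axis k c" by (auto simp: Basis_vec_def)
    show "((\<lambda>x. f x \<bullet> b) has_derivative (\<lambda>v. D v \<bullet> b)) (at x)"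
      unfolding b inner_axis using R by (intro has_derivative_inner_left) auto
  qed
qed (auto intro: bounded_linear.has_derivative[OF bounded_linear_vec_nth])

text \<open>On the complex line through x in direction v, h is a function of one variable with
  derivative \<open>h' x v\<close> at 0, and Cauchy's formula applies on the circle of radius r.
  Parametrizing the circle over the unit interval makes x a mere parameter of an integral with fixed
  limits, in which only values of h occur.\<close>

lemma directional_Cauchy_formula:
  fixes h :: "complex^'n \<Rightarrow> complex"
  assumes h: "\<And>y. y \<in> S \<Longrightarrow> (h has_derivative h' y) (at y)"
      "\<And>y a v. y \<in> S \<Longrightarrow> h' y (a *s v) = a * h' y v"
    and r: "0 < r" "\<And>\<zeta>. norm \<zeta> \<le> r \<Longrightarrow> x + \<zeta> *s v \<in> S"
  shows "h' x v = integral {0..1}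
    (\<lambda>t. h (x + (r * exp (2 * of_real pi * \<i> * of_real t)) *s v) / (r * exp (2 * of_real pi * \<i> * of_real t)))"
proof -
  let ?k = "\<lambda>\<zeta>. h (x + \<zeta> *s v)"
  let ?e = "\<lambda>t::real. exp (2 * of_real pi * \<i> * of_real t)"
  have der: "(?k has_field_derivative h' (x + \<zeta> *s v) v) (at \<zeta>)" if "norm \<zeta> \<le> r" for \<zeta>
  proof -
    have "((\<lambda>\<zeta>. x + \<zeta> *s v) has_derivative (\<lambda>a. 0 + a *s v)) (at \<zeta>)"
      by (intro derivative_intros bounded_linear_imp_has_derivative)
        (simp add: linear_smult_left flip: linear_conv_bounded_linear)
    from has_derivative_compose[OF this h(1)[OF r(2)[OF that]]]
    show ?thesis
      by (simp add: has_field_derivative_def h(2)[OF r(2)[OF that]] mult_commute_abs)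
  qed
  have "continuous_on (cball 0 r) ?k"
    using der by (intro DERIV_continuous_on) (auto intro: has_field_derivative_at_within)
  moreover have "?k holomorphic_on ball 0 r"
    unfolding holomorphic_on_open[OF open_ball] using der by (meson mem_ball_0 less_imp_le)
  ultimately have "(?k has_field_derivative (1 / (2 * of_real pi * \<i>)
      * contour_integral (circlepath 0 r) (\<lambda>u. ?k u / (u - 0)^2))) (at 0)"
    using r(1) by (intro Cauchy_derivative_integral_circlepath) auto
  then have "h' (x + 0 *s v) v = 1 / (2 * of_real pi * \<i>) * contour_integral (circlepath 0 r) (\<lambda>u. ?k u / (u - 0)^2)"
    using r(1) by (intro DERIV_unique[OF der]) auto
  also have "\<dots> = 1 / (2 * of_real pi * \<i>) *
     integral {0..1} (\<lambda>t. ?k (r * ?e t) / (r * ?e t)^2 * (2 * pi * \<i> * r * ?e t))"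
    by (simp add: contour_integral_integral vector_derivative_circlepath) (simp add: circlepath)
  also have "\<dots> = integral {0..1} (\<lambda>t. 1 / (2 * of_real pi * \<i>) *
      (?k (r * ?e t) / (r * ?e t)^2 * (2 * pi * \<i> * r * ?e t)))"
    by (rule integral_mult_right[symmetric])
  also have "\<dots> = integral {0..1} (\<lambda>t. ?k (r * ?e t) / (r * ?e t))"
    using r(1) by (intro integral_cong) (simp add: power2_eq_square field_simps)
  finally show ?thesis by simp
qed

text \<open>The first part is needed for the second one: Cauchy's formula may be differentiated under
  the integral sign only if the derivative of \<open>h\<close> is known to be continuous.\<close>

lemma directional_derivative_holomorphic:
  fixes h :: "complex^'n \<Rightarrow> complex"
  assumes S: "open S" and h: "\<And>y. y \<in> S \<Longrightarrow> (h has_derivative h' y) (at y)"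
      "\<And>y a v. y \<in> S \<Longrightarrow> h' y (a *s v) = a * h' y v"
  shows "continuous_on S (\<lambda>y. h' y v)"
    and "x0 \<in> S \<Longrightarrow> \<exists>L. ((\<lambda>y. h' y v) has_derivative L) (at x0) \<and> (\<forall>a u. L (a *s u) = a * L u)"
proof -
  let ?e = "\<lambda>t::real. exp (2 * of_real pi * \<i> * of_real t)"
  have conth: "continuous_on S h"
    using h(1) by (meson continuous_at_imp_continuous_on has_derivative_continuous)
  \<comment> \<open>One radius r has to serve all x near x0, since the integral is to be studied as
    a function of x. Halving the distance to the boundary leaves room for the circles.\<close>
  have local: "\<exists>R r. 0 < R \<and> 0 < r \<and> ball x0 R \<subseteq> S \<and>
      (\<forall>x\<in>ball x0 R. \<forall>\<zeta>. norm \<zeta> \<le> r \<longrightarrow> x + \<zeta> *s v \<in> S)" if "x0 \<in> S" for x0 v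
  proof -
    obtain d where d: "d > 0" "ball x0 d \<subseteq> S" using S \<open>x0 \<in> S\<close> openE by blast
    define r where "r = d / 2 / (norm v + 1)"
    have "r > 0" using d by (simp add: r_def add_nonneg_pos)
    moreover have "x + \<zeta> *s v \<in> S" if "x \<in> ball x0 (d/2)" "norm \<zeta> \<le> r" for x \<zeta>
    proof -
      have "norm (\<zeta> *s v) \<le> r * (norm v + 1)"
        using that(2) \<open>r > 0\<close> unfolding norm_smult by (intro mult_mono) auto
      also have "\<dots> = d / 2" using add_nonneg_pos[OF norm_ge_zero[of v] zero_less_one] by (simp add: r_def field_simps)
      finally have "dist x0 (x + \<zeta> *s v) < d"
        using that(1) norm_triangle_ineq4[of "x0 - x" "\<zeta> *s v"] by (simp add: dist_norm diff_diff_eq)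
      then show ?thesis using d(2) by auto
    qed
    ultimately show ?thesis using d by (intro exI[of _ "d/2"] exI[of _ r]) auto
  qed
  \<comment> \<open>Stated for any continuous q because it serves twice: for h itself, and later for
    the directional derivatives of h.\<close>
  have pt: "continuous_on (U \<times> cbox 0 1) (\<lambda>(x, t). q (x + (complex_of_real r * ?e t) *s v) / (r * ?e t))"
    if "continuous_on S q" "r > 0" "\<forall>x\<in>U. \<forall>\<zeta>. norm \<zeta> \<le> r \<longrightarrow> x + \<zeta> *s v \<in> S" for q :: "complex^'n \<Rightarrow> complex" and r U v
    unfolding case_prod_beta using that
    by (auto intro!: continuous_intros continuous_on_compose2[OF that(1)] simp: norm_mult)
  \<comment> \<open>Proved for all directions v at once: differentiating the formula for one
    direction brings in the derivatives of h in every direction u.\<close>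
  show cont: "continuous_on S (\<lambda>y. h' y v)" for v
    unfolding continuous_on_eq_continuous_at[OF S]
  proof
    fix x0 assume "x0 \<in> S"
    obtain R r where R: "0 < R" "0 < r" "ball x0 R \<subseteq> S"
      "\<forall>x\<in>ball x0 R. \<forall>\<zeta>. norm \<zeta> \<le> r \<longrightarrow> x + \<zeta> *s v \<in> S" using local[OF \<open>x0 \<in> S\<close>, of v] by blast
    have "continuous_on (ball x0 R) (\<lambda>x. integral (cbox 0 1) (\<lambda>t. h (x + (r * ?e t) *s v) / (r * ?e t)))"
      by (rule integral_continuous_on_param[OF pt[OF conth R(2,4)]])
    then have "continuous_on (ball x0 R) (\<lambda>x. h' x v)"
      using directional_Cauchy_formula[of S h h' r _ v, OF h R(2)] R(4)
      by (auto elim: continuous_on_eq)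
    then show "isCont (\<lambda>y. h' y v) x0"
      using R(1) by (simp add: continuous_on_eq_continuous_at)
  qed
  show "\<exists>L. ((\<lambda>y. h' y v) has_derivative L) (at x0) \<and> (\<forall>a u. L (a *s u) = a * L u)" if "x0 \<in> S"
  proof -
    obtain R r where R: "0 < R" "0 < r" "ball x0 R \<subseteq> S"
      "\<forall>x\<in>ball x0 R. \<forall>\<zeta>. norm \<zeta> \<le> r \<longrightarrow> x + \<zeta> *s v \<in> S" using local[OF \<open>x0 \<in> S\<close>, of v] by blast
    let ?p = "\<lambda>x t. x + (complex_of_real r * ?e t) *s v"
    \<comment> \<open>The Leibniz rule takes the derivative as a bundled bounded linear map that is
      jointly continuous in x and t. Joint continuity is checked one direction u at a time by means
      of \<open>cont\<close>.\<close>
    define fx where "fx x t = Blinfun (\<lambda>u. h' (?p x t) u / (r * ?e t))" for x t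
    have pS: "?p x t \<in> S" if "x \<in> ball x0 R" for x t
      using R(2,4) that by (simp add: norm_mult)
    have der: "((\<lambda>x. h (?p x t) / (r * ?e t)) has_derivative (\<lambda>u. h' (?p x t) u / (r * ?e t))) (at x)"
      if "x \<in> ball x0 R" for x t
    proof -
      have "((\<lambda>x. ?p x t) has_derivative (\<lambda>u. u)) (at x)" by (auto intro!: derivative_eq_intros)
      from has_derivative_compose[OF this h(1)[OF pS[OF that]]] show ?thesis
        by (rule bounded_linear.has_derivative[OF bounded_linear_divide])
    qed
    have fx: "blinfun_apply (fx x t) u = h' (?p x t) u / (r * ?e t)" if "x \<in> ball x0 R" for x t u
      unfolding fx_def using has_derivative_bounded_linear[OF der[OF that]]
      by (simp add: bounded_linear_Blinfun_apply)
    have contfx: "continuous_on (ball x0 R \<times> cbox 0 1) (\<lambda>(x, t). fx x t)"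
    proof (rule continuous_on_blinfun_componentwise)
      fix u :: "complex^'n"
      show "continuous_on (ball x0 R \<times> cbox 0 1) (\<lambda>z. blinfun_apply (case z of (x, t) \<Rightarrow> fx x t) u)"
        using pt[OF cont[of u] R(2,4)] by (rule continuous_on_eq) (auto simp: fx)
    qed
    let ?L = "blinfun_apply (integral (cbox 0 1) (fx x0))"
    have "((\<lambda>x. integral (cbox 0 1) (\<lambda>t. h (?p x t) / (complex_of_real r * ?e t))) has_derivative ?L) (at x0 within ball x0 R)"
    proof (rule leibniz_rule[OF _ _ contfx])
      show "((\<lambda>x. h (?p x t) / (complex_of_real r * ?e t)) has_derivative blinfun_apply (fx x t)) (at x within ball x0 R)"
        if "x \<in> ball x0 R" for x t
      proof -
        have "blinfun_apply (fx x t) = (\<lambda>u. h' (?p x t) u / (complex_of_real r * ?e t))"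
          by (intro ext fx that)
        then show ?thesis
          using der[OF that, of t] by (simp add: has_derivative_at_withinI)
      qed
      show "(\<lambda>t. h (?p x t) / (complex_of_real r * ?e t)) integrable_on cbox 0 1" if "x \<in> ball x0 R" for x
        using R(2,4) that
        by (intro integrable_continuous continuous_intros continuous_on_compose2[OF conth]) (auto simp: norm_mult)
    qed (use R in auto)
    then have "((\<lambda>x. integral (cbox 0 1) (\<lambda>t. h (?p x t) / (complex_of_real r * ?e t))) has_derivative ?L) (at x0)"
      unfolding at_within_open[OF centre_in_ball[THEN iffD2, OF R(1)] open_ball] .
    then have "((\<lambda>y. h' y v) has_derivative ?L) (at x0)"
    proof (rule has_derivative_transform_within_open[of _ _ _ _ "ball x0 R"])
      show "integral (cbox 0 1) (\<lambda>t. h (?p x t) / (complex_of_real r * ?e t)) = h' x v"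
        if "x \<in> ball x0 R" for x
        using directional_Cauchy_formula[of S h h' r x v, OF h R(2)] R(4) that
        unfolding cbox_interval by metis
    qed (use R(1) in auto)
    \<comment> \<open>Homogeneity over the complex numbers passes from \<open>h'\<close> through the
      integral; with it the directional derivative is holomorphic again.\<close>
    moreover have "?L (a *s u) = a * ?L u" for a u
    proof -
      have x0: "x0 \<in> ball x0 R" using R(1) by simp
      have "continuous_on (cbox 0 1) (\<lambda>t. fx x0 t)"
        using continuous_on_compose2[OF contfx continuous_on_Pair[OF continuous_on_const continuous_on_id],
            of x0 "cbox 0 1"] R(1) by (simp add: image_subset_iff)
      then have i: "fx x0 integrable_on cbox 0 1" by (rule integrable_continuous)
      show ?thesis
        unfolding blinfun_apply_integral[OF i] fx[OF x0] h(2)[OF pS[OF x0]] times_divide_eq_right[symmetric]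
        by (rule integral_mult_right)
    qed
    ultimately show ?thesis by blast
  qed
qed

lemma holo_on_has_derivative:
  assumes "holo_on f S" "x \<in> S"
  shows "(f has_derivative frechet_derivative f (at x)) (at x)"
    and "complex_linear (frechet_derivative f (at x))"
  using assms unfolding holo_on_def by (metis frechet_derivative_at)+

lemma holo_on_derivative:
  assumes S: "open S" and f: "holo_on f S"
  shows "holo_on (\<lambda>x. frechet_derivative f (at x) v) S"
  unfolding holo_on_def
proof
  fix x assume x: "x \<in> S"
  have "\<exists>L. ((\<lambda>x. frechet_derivative f (at x) v $ k) has_derivative L) (at x)
      \<and> (\<forall>a u. L (a *s u) = a * L u)" for k
  proof (rule directional_derivative_holomorphic(2)[OF S _ _ x, of "\<lambda>x. f x $ k"])
    show "((\<lambda>x. f x $ k) has_derivative (\<lambda>v. frechet_derivative f (at y) v $ k)) (at y)" if "y \<in> S" for y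
      using holo_on_has_derivative(1)[OF f that] by (simp add: has_derivative_vec_iff)
    show "frechet_derivative f (at y) (a *s v) $ k = a * frechet_derivative f (at y) v $ k"
      if "y \<in> S" for y a v
      using holo_on_has_derivative(2)[OF f that] by (simp add: complex_linear_scale)
  qed
  then obtain L where L: "\<And>k. ((\<lambda>x. frechet_derivative f (at x) v $ k) has_derivative L k) (at x)"
      "\<And>k a u. L k (a *s u) = a * L k u"
    by metis
  have "((\<lambda>x. frechet_derivative f (at x) v) has_derivative (\<lambda>u. \<chi> k. L k u)) (at x)"
    unfolding has_derivative_vec_iff using L(1) by simp
  moreover have "complex_linear (\<lambda>u. \<chi> k. L k u)"
    using linear_add[OF has_derivative_linear[OF L(1)]]
    by (auto simp: complex_linear_def L(2) vec_eq_iff)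
  ultimately show "\<exists>L. ((\<lambda>x. frechet_derivative f (at x) v) has_derivative L) (at x) \<and> complex_linear L"
    by blast
qed

text \<open>Directional derivatives of holomorphic maps are holomorphic, so the induction on the
  order runs over all f simultaneously.\<close>

lemma holo_on_imp_smooth_on:
  assumes "open S" "holo_on f S"
  shows "smooth_on f S"
  unfolding smooth_on_def
proof
  fix k show "times_differentiable_on k f S"
    using assms(2)
  proof (induction k arbitrary: f)
    case 0
    then show ?case
      using holo_on_has_derivative(1)
      by (auto intro!: continuous_at_imp_continuous_on intro: has_derivative_continuous)
  next
    case (Suc k)
    then show ?case
      using holo_on_has_derivative(1)[OF Suc.prems] holo_on_derivative[OF assms(1) Suc.prems]
      by (auto simp: differentiable_def)
  qed
qed

section \<open>Inverse functions\<close>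

text \<open>The derivative of the inverse is recorded as a formula valid on all of V, and
  bijectivity on all of U. The holomorphic version reads complex linearity off this formula, the
  smooth version higher differentiability.\<close>

lemma local_inverse:
  fixes f :: "'e::euclidean_space \<Rightarrow> 'e"
  assumes S: "open S" and f: "smooth_on f S" and x0: "x0 \<in> S" "inj (frechet_derivative f (at x0))"
  obtains U V g where "open U" "U \<subseteq> S" "x0 \<in> U" "open V" "homeomorphism U V f g"
    "\<And>y. y \<in> V \<Longrightarrow> (g has_derivative inv (frechet_derivative f (at (g y)))) (at y)"
    "\<And>x. x \<in> U \<Longrightarrow> bij (frechet_derivative f (at x))"
proof -
  let ?f = "\<lambda>x. frechet_derivative f (at x)"
  define f' where "f' x = Blinfun (?f x)" for x
  have f': "blinfun_apply (f' x) = ?f x" if "x \<in> S" for x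
    unfolding f'_def using smooth_on_has_derivative[OF f that] has_derivative_bounded_linear
    by (intro bounded_linear_Blinfun_apply)
  have lin: "linear (?f x0)"
    using smooth_on_has_derivative[OF f x0(1)] has_derivative_linear by blast
  then obtain l where l: "linear l" "l \<circ> ?f x0 = id"
    using linear_injective_left_inverse x0(2) by blast
  have "continuous_on S f'"
  proof (rule continuous_on_blinfun_componentwise)
    fix b show "continuous_on S (\<lambda>x. blinfun_apply (f' x) b)"
      using smooth_on_continuous[OF smooth_on_derivative[OF f]] f'
      by (subst continuous_on_cong[OF refl, of _ _ "\<lambda>x. ?f x b"]) auto
  qed
  moreover have "(f has_derivative blinfun_apply (f' x)) (at x)" if "x \<in> S" for x
    unfolding f'[OF that] by (rule smooth_on_has_derivative[OF f that])
  moreover have "Blinfun l o\<^sub>L f' x0 = id_blinfun"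
    using l(2) f'[OF x0(1)] l(1)
    by (intro blinfun_eqI) (simp add: bounded_linear_Blinfun_apply linear_conv_bounded_linear o_def fun_eq_iff)
  ultimately obtain U V g g' where U: "open U" "U \<subseteq> S" "x0 \<in> U" "open V" "homeomorphism U V f g"
    and g: "\<And>y. y \<in> V \<Longrightarrow> (g has_derivative g' y) (at y)" "\<And>y. y \<in> V \<Longrightarrow> g' y = inv (blinfun_apply (f' (g y)))"
      "\<And>y. y \<in> V \<Longrightarrow> bij (blinfun_apply (f' (g y)))"
    using inverse_function_theorem[OF S _ _ x0(1), of f f' "Blinfun l"] by metis
  have gU: "g y \<in> S" if "y \<in> V" for y
    using U(2,5) that by (auto simp: homeomorphism_def)
  show thesis
  proof (rule that[OF U])
    show "(g has_derivative inv (?f (g y))) (at y)" if "y \<in> V" for y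
      using g(1)[OF that] g(2)[OF that] f'[OF gU[OF that]] by simp
    show "bij (?f x)" if "x \<in> U" for x
    proof -
      have "f x \<in> V" "g (f x) = x" using U(5) that by (auto simp: homeomorphism_def)
      then show ?thesis using g(3)[of "f x"] f'[of x] U(2) that by auto
    qed
  qed
qed

lemma complex_linear_inv:
  assumes "complex_linear L" "bij L"
  shows "complex_linear (inv L)"
  unfolding complex_linear_def
proof (intro conjI allI)
  fix u v a
  have *: "L (inv L w) = w" "inv L (L w') = w'" for w w'
    using assms(2) by (simp_all add: bij_is_surj surj_f_inv_f bij_is_inj)
  have "inv L (L (inv L u) + L (inv L v)) = inv L u + inv L v"
    using assms(1) * unfolding complex_linear_def by metis
  then show "inv L (u + v) = inv L u + inv L v" by (simp add: *)
  have "inv L (a *s L (inv L v)) = a *s inv L v"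
    using assms(1) * unfolding complex_linear_def by metis
  then show "inv L (a *s v) = a *s inv L v" by (simp add: *)
qed

lemma local_holomorphic_inverse:
  fixes f :: "complex^'n \<Rightarrow> complex^'n"
  assumes S: "open S" and f: "holo_on f S" and x0: "x0 \<in> S" "inj (frechet_derivative f (at x0))"
  obtains U V g where "open U" "U \<subseteq> S" "x0 \<in> U" "open V" "homeomorphism U V f g" "holo_on g V"
proof -
  obtain U V g where U: "open U" "U \<subseteq> S" "x0 \<in> U" "open V" "homeomorphism U V f g"
    and g: "\<And>y. y \<in> V \<Longrightarrow> (g has_derivative inv (frechet_derivative f (at (g y)))) (at y)"
    "\<And>x. x \<in> U \<Longrightarrow> bij (frechet_derivative f (at x))"
    using local_inverse[OF S holo_on_imp_smooth_on[OF S f] x0] by blast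
  have "holo_on g V"
    unfolding holo_on_def
  proof
    fix y assume "y \<in> V"
    then have "g y \<in> U" using U(5) by (auto simp: homeomorphism_def)
    then have "complex_linear (inv (frechet_derivative f (at (g y))))"
      using U(2) by (intro complex_linear_inv holo_on_has_derivative(2)[OF f] g(2)) auto
    then show "\<exists>L. (g has_derivative L) (at y) \<and> complex_linear L"
      using g(1)[OF \<open>y \<in> V\<close>] by blast
  qed
  then show thesis using that[OF U] by blast
qed

text \<open>An auxiliary real isomorphism, unrelated to the splitting of V into z and w. Matrices
  and the inverse function theorem require source and target of one type, whereas the maps of
  interest go from \<open>complex^'n\<close> to \<open>real^('n + 'n)\<close>.\<close>

definition realify :: "complex^'n \<Rightarrow> real^('n + 'n)" where
  "realify z = (\<chi> k. case k of Inl i \<Rightarrow> Re (z $ i) | Inr i \<Rightarrow> Im (z $ i))"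

definition complexify :: "real^('n + 'n) \<Rightarrow> complex^'n" where
  "complexify y = (\<chi> i. Complex (y $ Inl i) (y $ Inr i))"

lemma complexify_realify [simp]: "complexify (realify z) = z"
  by (simp add: complexify_def realify_def vec_eq_iff)

lemma realify_complexify [simp]: "realify (complexify y) = y"
  by (simp add: complexify_def realify_def vec_eq_iff split: sum.split)

lemma linear_complexify: "linear (complexify :: real^('n::finite + 'n) \<Rightarrow> complex^'n)"
  by (auto simp: linear_iff complexify_def vec_eq_iff complex_eq_iff)

lemma bounded_linear_complexify: "bounded_linear (complexify :: real^('n::finite + 'n) \<Rightarrow> complex^'n)"
  using linear_complexify linear_conv_bounded_linear by blast

lemma smooth_on_solve:
  fixes A :: "'e::real_normed_vector \<Rightarrow> complex^'n \<Rightarrow> real^('n + 'n)"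
  assumes S: "open S" and A: "\<And>x. x \<in> S \<Longrightarrow> linear (A x)" "\<And>x. x \<in> S \<Longrightarrow> inj (A x)"
      "\<And>b. times_differentiable_on k (\<lambda>x. A x b) S"
    and v: "times_differentiable_on k v S" and u: "\<And>x. x \<in> S \<Longrightarrow> A x (u x) = v x"
  shows "times_differentiable_on k u S"
proof -
  have "times_differentiable_on k (\<lambda>x. realify (u x)) S"
  proof (rule times_differentiable_on_solve[OF S _ _ v])
    show "linear (\<lambda>y. A x (complexify y)) \<and> inj (\<lambda>y. A x (complexify y))" if "x \<in> S" for x
      using linear_compose[OF linear_complexify A(1)[OF that]] A(2)[OF that]
      by (auto simp: o_def inj_def) (metis realify_complexify)
  qed (use A u in auto)
  from times_differentiable_on_bounded_linear[OF S bounded_linear_complexify this]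
  show ?thesis by simp
qed

text \<open>A bootstrap: the derivative of g in direction w solves a linear system whose matrix is
  the derivative of f at \<open>g y\<close>. If g is k times differentiable, then so is the matrix,
  and by Cramer's rule the solution, hence g is k + 1 times differentiable.\<close>

lemma local_smooth_inverse:
  fixes f :: "complex^'n \<Rightarrow> real^('n::finite + 'n)"
  assumes S: "open S" and f: "smooth_on f S" and x0: "x0 \<in> S" "inj (frechet_derivative f (at x0))"
  obtains U V g where "open U" "U \<subseteq> S" "x0 \<in> U" "open V" "homeomorphism U V f g" "smooth_on g V"
proof -
  let ?f = "\<lambda>x. complexify (f x)"
  have f': "frechet_derivative ?f (at x) = (\<lambda>u. complexify (frechet_derivative f (at x) u))" if "x \<in> S" for x
    using smooth_on_has_derivative[OF f that]
    by (intro frechet_derivative_eq bounded_linear.has_derivative[OF bounded_linear_complexify])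
  have "inj (frechet_derivative ?f (at x0))"
    unfolding f'[OF x0(1)] using x0(2) by (auto simp: inj_def) (metis realify_complexify)
  then obtain U V g where U: "open U" "U \<subseteq> S" "x0 \<in> U" and V: "open V" "homeomorphism U V ?f g"
    and g: "\<And>y. y \<in> V \<Longrightarrow> (g has_derivative inv (frechet_derivative ?f (at (g y)))) (at y)"
    "\<And>x. x \<in> U \<Longrightarrow> bij (frechet_derivative ?f (at x))"
    using local_inverse[OF S smooth_on_bounded_linear[OF S bounded_linear_complexify f] x0(1)] by metis
  let ?g = "\<lambda>y. g (complexify y)"
  let ?V = "complexify -` V"
  have contc: "continuous_on T (complexify :: real^('n + 'n) \<Rightarrow> complex^'n)" for T
    by (rule linear_continuous_on[OF bounded_linear_complexify])
  have oV: "open ?V"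
    by (rule open_vimage[OF V(1) contc])
  have hom: "homeomorphism U ?V f ?g"
  proof (rule homeomorphismI)
    show "continuous_on U f" using smooth_on_continuous[OF f] U(2) continuous_on_subset by blast
    show "continuous_on ?V ?g"
      using V(2) by (intro continuous_on_compose2[OF _ contc]) (auto simp: homeomorphism_def)
  qed (use V(2) in \<open>auto simp: homeomorphism_def\<close>, metis realify_complexify)
  have gU: "?g y \<in> U" "f (?g y) = y" if "y \<in> ?V" for y
    using hom that by (auto simp: homeomorphism_def)
  have gder: "(?g has_derivative (\<lambda>w. inv (frechet_derivative ?f (at (?g y))) (complexify w))) (at y)"
    if "y \<in> ?V" for y
    using has_derivative_compose[OF bounded_linear_imp_has_derivative[OF bounded_linear_complexify] g(1)] that
    by auto
  have solve: "frechet_derivative f (at (?g y)) (inv (frechet_derivative ?f (at (?g y))) (complexify w)) = w"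
    if "y \<in> ?V" for y w
  proof -
    have "complexify (frechet_derivative f (at (?g y)) (inv (frechet_derivative ?f (at (?g y))) (complexify w)))
      = complexify w"
      using surj_f_inv_f[OF bij_is_surj[OF g(2)[OF gU(1)[OF that]]], of "complexify w"]
        f'[of "?g y"] gU(1)[OF that] U(2) by auto
    then show ?thesis by (metis realify_complexify)
  qed
  have "smooth_on ?g ?V"
    unfolding smooth_on_def
  proof
    fix k show "times_differentiable_on k ?g ?V"
    proof (induction k)
      case 0
      then show ?case using hom by (auto simp: homeomorphism_def)
    next
      case (Suc k)
      show ?case
      proof (rule times_differentiable_on_SucI[OF oV gder])
        fix w
        show "times_differentiable_on k
          (\<lambda>y. inv (frechet_derivative ?f (at (?g y))) (complexify w)) ?V"
        proof (rule smooth_on_solve[where A = "\<lambda>y. frechet_derivative f (at (?g y))" and v = "\<lambda>_. w"])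
          fix y assume "y \<in> ?V"
          then have y: "?g y \<in> S" "?g y \<in> U" using gU U(2) by auto
          show "linear (frechet_derivative f (at (?g y)))"
            by (rule has_derivative_linear[OF smooth_on_has_derivative[OF f y(1)]])
          show "inj (frechet_derivative f (at (?g y)))"
            using bij_is_inj[OF g(2)[OF y(2)]] f'[OF y(1)] by (auto simp: inj_def)
        next
          fix b
          show "times_differentiable_on k (\<lambda>y. frechet_derivative f (at (?g y)) b) ?V"
            using smooth_on_derivative[OF f] Suc gU U(2)
            by (intro times_differentiable_on_compose[OF oV S, where f = "\<lambda>x. frechet_derivative f (at x) b"])
               (auto simp: smooth_on_def)
        qed (auto intro: oV solve times_differentiable_on_const)
      qed
    qed
  qed
  then show thesis using that[OF U oV hom] by blast
qed


section \<open>Calculus on complex manifolds\<close>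

lemma coordinate_map_inj: "coordinate_map M V c \<Longrightarrow> inj_on c V"
  unfolding coordinate_map_def homeomorphic_eq_everything_map
  by (metis openin_subset topspace_subtopology_subset)

lemma coordinate_map_inv: "coordinate_map M V c \<Longrightarrow> p \<in> V \<Longrightarrow> the_inv_into V c (c p) = p"
  by (simp add: coordinate_map_inj the_inv_into_f_f)

lemma coordinate_map_image_open:
  assumes "coordinate_map M V c" "openin (mtop M) W"
  shows "open (c ` (W \<inter> V))"
proof -
  have "open_map (subtopology (mtop M) V) (top_of_set (c ` V)) c"
    using assms(1) homeomorphic_imp_open_map unfolding coordinate_map_def by blast
  then have "openin (top_of_set (c ` V)) (c ` (W \<inter> V))"
    using openin_subtopology_Int[OF assms(2)] unfolding open_map_def by blast
  then show ?thesis
    using assms(1) openin_open_eq unfolding coordinate_map_def by blast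
qed

lemma coordinate_map_preimage_open:
  assumes "coordinate_map M V c" "open T"
  shows "openin (mtop M) {p \<in> V. c p \<in> T}"
proof -
  have V: "openin (mtop M) V" "topspace (subtopology (mtop M) V) = V"
    using assms(1) openin_subset by (fastforce simp: coordinate_map_def)+
  have "continuous_map (subtopology (mtop M) V) (top_of_set (c ` V)) c"
    using assms(1) homeomorphic_imp_continuous_map unfolding coordinate_map_def by blast
  then have "continuous_map (subtopology (mtop M) V) euclidean c"
    using continuous_map_into_fulltopology by blast
  from openin_continuous_map_preimage[OF this open_openin[THEN iffD1, OF assms(2)]]
  have "openin (subtopology (mtop M) V) {p \<in> V. c p \<in> T}"
    unfolding V(2) .
  then show ?thesis
    using V(1) openin_open_subtopology by blast
qed

section \<open>Charts and derivatives of functions on a manifold\<close>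

locale cmanifold =
  fixes M :: "('a, 'n::finite) cmanifold"
  assumes complex_manifold: "complex_manifold M"
begin

lemma chart_coordinate_map: "(V, c) \<in> atlas M \<Longrightarrow> coordinate_map M V c"
  using complex_manifold unfolding complex_manifold_def by auto

lemma chart_open: "(V, c) \<in> atlas M \<Longrightarrow> openin (mtop M) V"
  using chart_coordinate_map unfolding coordinate_map_def by blast

lemma chart_inv: "(V, c) \<in> atlas M \<Longrightarrow> p \<in> V \<Longrightarrow> the_inv_into V c (c p) = p"
  by (rule coordinate_map_inv[OF chart_coordinate_map])

lemma chart_image_open: "(V, c) \<in> atlas M \<Longrightarrow> openin (mtop M) W \<Longrightarrow> open (c ` (W \<inter> V))"
  by (rule coordinate_map_image_open[OF chart_coordinate_map])

lemma chart_at: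
  assumes "p \<in> topspace (mtop M)" "chart_at M p = (U, c)"
  shows "(U, c) \<in> atlas M" "p \<in> U"
proof -
  have "p \<in> \<Union> (fst ` atlas M)"
    using assms(1) complex_manifold unfolding complex_manifold_def by blast
  then have "\<exists>C. C \<in> atlas M \<and> p \<in> fst C"
    by blast
  then have "chart_at M p \<in> atlas M \<and> p \<in> fst (chart_at M p)"
    unfolding chart_at_def by (rule someI_ex)
  then show "(U, c) \<in> atlas M" "p \<in> U" by (simp_all add: assms(2))
qed

lemma chart_atE:
  assumes "p \<in> topspace (mtop M)"
  obtains U c where "chart_at M p = (U, c)" "(U, c) \<in> atlas M" "p \<in> U"
  using that chart_at[OF assms] by (cases "chart_at M p") blast

lemma openin_topspaceD: "openin (mtop M) W \<Longrightarrow> p \<in> W \<Longrightarrow> p \<in> topspace (mtop M)"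
  using openin_subset by blast

lemma transition_holo_on:
  assumes "(U, c) \<in> atlas M" "(V, d) \<in> atlas M"
  shows "holo_on (d \<circ> the_inv_into U c) (c ` (V \<inter> U))"
proof -
  have "\<forall>(U, c)\<in>atlas M. \<forall>(V, d)\<in>atlas M. holo_on (d \<circ> the_inv_into U c) (c ` (U \<inter> V))"
    using complex_manifold unfolding complex_manifold_def by (elim conjE)
  from bspec[OF this assms(1)] have "\<forall>(V, d)\<in>atlas M. holo_on (d \<circ> the_inv_into U c) (c ` (U \<inter> V))"
    by (rule case_prodD)
  from bspec[OF this assms(2)] have "holo_on (d \<circ> the_inv_into U c) (c ` (U \<inter> V))"
    by (rule case_prodD)
  then show ?thesis by (simp only: Int_commute)
qed

text \<open>Passing from the selected chart to c multiplies by the Jacobian of the transition map,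
  and this Jacobian is \<open>mderiv M c p\<close>. So derivatives may be computed in any chart
  around p.\<close>

lemma mderiv_has_derivative_chart:
  assumes c: "(V, c) \<in> atlas M" "p \<in> V" and U: "chart_at M p = (U, d)"
    and f: "((f \<circ> the_inv_into V c) has_derivative f') (at (c p))"
  shows "((f \<circ> the_inv_into U d) has_derivative mderiv M f p) (at (d p))"
    and "mderiv M f p = (\<lambda>v. f' (mderiv M c p v))"
proof -
  have d: "(U, d) \<in> atlas M" "p \<in> U"
    by (rule chart_at[OF openin_topspaceD[OF chart_open[OF c(1)] c(2)] U])+
  have S: "open (d ` (V \<inter> U))" "d p \<in> d ` (V \<inter> U)"
    using chart_image_open[OF d(1) chart_open[OF c(1)]] c(2) d(2) by auto
  have T: "((c \<circ> the_inv_into U d) has_derivative mderiv M c p) (at (d p))"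
    using holo_on_has_derivative(1)[OF transition_holo_on[OF d(1) c(1)] S(2)]
    by (simp add: mderiv_def U)
  have "c p = (c \<circ> the_inv_into U d) (d p)"
    by (simp add: chart_inv[OF d])
  with f have "((f \<circ> the_inv_into V c) has_derivative f') (at ((c \<circ> the_inv_into U d) (d p)))"
    by simp
  from has_derivative_compose[OF T this] have "((\<lambda>x. (f \<circ> the_inv_into V c) ((c \<circ> the_inv_into U d) x)) has_derivative
      (\<lambda>v. f' (mderiv M c p v))) (at (d p))" .
  then have *: "((f \<circ> the_inv_into U d) has_derivative (\<lambda>v. f' (mderiv M c p v))) (at (d p))"
    by (rule has_derivative_transform_within_open[OF _ S])
      (use chart_inv[OF c(1)] chart_inv[OF d(1)] in auto)
  show "mderiv M f p = (\<lambda>v. f' (mderiv M c p v))"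
    using frechet_derivative_eq[OF *] by (simp add: mderiv_def U)
  then show "((f \<circ> the_inv_into U d) has_derivative mderiv M f p) (at (d p))"
    using * by simp
qed

lemma mderiv_chart_at:
  assumes "p \<in> topspace (mtop M)" "chart_at M p = (U, d)"
  shows "mderiv M d p = id"
proof -
  have d: "(U, d) \<in> atlas M" "p \<in> U"
    using chart_at[OF assms] by auto
  have S: "open (d ` U)" "d p \<in> d ` U"
    using chart_image_open[OF d(1) chart_open[OF d(1)]] d(2) by auto
  have "((d \<circ> the_inv_into U d) has_derivative id) (at (d p))"
    by (rule has_derivative_transform_within_open[OF has_derivative_id S])
      (use chart_inv[OF d(1)] in auto)
  then show ?thesis
    using frechet_derivative_eq by (fastforce simp: mderiv_def assms(2))
qed

text \<open>The transition back to the selected chart supplies a left inverse; surjectivity follows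
  by dimension.\<close>

lemma mderiv_chart:
  assumes c: "(V, c) \<in> atlas M" "p \<in> V"
  shows "complex_linear (mderiv M c p)" "bij (mderiv M c p)"
proof -
  have p: "p \<in> topspace (mtop M)"
    using openin_topspaceD[OF chart_open[OF c(1)] c(2)] .
  then obtain U d where U: "chart_at M p = (U, d)" and d: "(U, d) \<in> atlas M" "p \<in> U"
    by (rule chart_atE)
  have "d p \<in> d ` (V \<inter> U)" "c p \<in> c ` (U \<inter> V)"
    using c(2) d(2) by auto
  note T = holo_on_has_derivative[OF transition_holo_on[OF d(1) c(1)] this(1)]
    holo_on_has_derivative[OF transition_holo_on[OF c(1) d(1)] this(2)]
  show cl: "complex_linear (mderiv M c p)"
    using T(2) by (simp add: mderiv_def U)
  have "mderiv M d p = (\<lambda>v. frechet_derivative (d \<circ> the_inv_into V c) (at (c p)) (mderiv M c p v))"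
    by (rule mderiv_has_derivative_chart(2)[OF c U T(3)])
  from fun_cong[OF this] have "inj (mderiv M c p)"
    unfolding mderiv_chart_at[OF p U] by (intro injI) (metis id_apply)
  then show "bij (mderiv M c p)"
    using complex_linear_linear[OF cl] linear_injective_imp_surjective by (auto simp: bij_def)
qed

lemma mderiv_at:
  "chart_at M p = (U, d) \<Longrightarrow> mderiv M f p = frechet_derivative (f \<circ> the_inv_into U d) (at (d p))"
  by (simp add: mderiv_def)

lemma mderiv_cong:
  assumes "openin (mtop M) W" "p \<in> W" "\<And>q. q \<in> W \<Longrightarrow> f q = g q"
  shows "mderiv M f p = mderiv M g p"
proof -
  obtain U d where U: "chart_at M p = (U, d)" and d: "(U, d) \<in> atlas M" "p \<in> U"
    by (rule chart_atE[OF openin_topspaceD[OF assms(1,2)]])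
  have "frechet_derivative (f \<circ> the_inv_into U d) (at (d p)) = frechet_derivative (g \<circ> the_inv_into U d) (at (d p))"
    by (rule frechet_derivative_cong[OF chart_image_open[OF d(1) assms(1)]])
      (use assms d chart_inv[OF d(1)] in auto)
  then show ?thesis by (simp add: mderiv_def U)
qed

lemma msmooth_onD:
  "msmooth_on M W f \<Longrightarrow> (V, c) \<in> atlas M \<Longrightarrow> smooth_on (f \<circ> the_inv_into V c) (c ` (W \<inter> V))"
  unfolding msmooth_on_def by blast

lemma mderiv_has_derivative:
  assumes "msmooth_on M W f" "openin (mtop M) W" "p \<in> W" "chart_at M p = (U, d)"
  shows "((f \<circ> the_inv_into U d) has_derivative mderiv M f p) (at (d p))"
proof -
  have d: "(U, d) \<in> atlas M" "p \<in> U"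
    by (rule chart_at[OF openin_topspaceD[OF assms(2,3)] assms(4)])+
  show ?thesis
    using smooth_on_has_derivative[OF msmooth_onD[OF assms(1) d(1)]] assms(3) d(2)
    by (simp add: mderiv_def assms(4))
qed

lemma mderiv_eqI:
  assumes "openin (mtop M) W" "p \<in> W"
    and "\<And>U d. chart_at M p = (U, d) \<Longrightarrow> ((f \<circ> the_inv_into U d) has_derivative f') (at (d p))"
  shows "mderiv M f p = f'"
proof -
  obtain U d where U: "chart_at M p = (U, d)"
    by fastforce
  show ?thesis using frechet_derivative_eq[OF assms(3)[OF U]] by (simp add: mderiv_def U)
qed

lemma linear_mderiv:
  assumes "msmooth_on M W f" "openin (mtop M) W" "p \<in> W"
  shows "linear (mderiv M f p)"
  using has_derivative_linear[OF mderiv_has_derivative[OF assms]] by (metis surj_pair)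

lemma mderiv_in_chart:
  assumes "msmooth_on M W f" "p \<in> W" "(V, c) \<in> atlas M" "p \<in> V"
  shows "mderiv M f p v = frechet_derivative (f \<circ> the_inv_into V c) (at (c p)) (mderiv M c p v)"
proof -
  obtain U d where U: "chart_at M p = (U, d)"
    by fastforce
  have "((f \<circ> the_inv_into V c) has_derivative frechet_derivative (f \<circ> the_inv_into V c) (at (c p))) (at (c p))"
    using assms by (intro smooth_on_has_derivative[OF msmooth_onD[OF assms(1,3)]]) auto
  from mderiv_has_derivative_chart(2)[OF assms(3,4) U this] show ?thesis
    by simp
qed

lemma msmooth_on_subset:
  assumes "msmooth_on M W f" "W' \<subseteq> W"
  shows "msmooth_on M W' f"
  unfolding msmooth_on_def
proof clarify
  fix V c assume c: "(V, c) \<in> atlas M"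
  show "smooth_on (f \<circ> the_inv_into V c) (c ` (W' \<inter> V))"
    by (rule smooth_on_subset[OF msmooth_onD[OF assms(1) c]]) (use assms(2) in auto)
qed

lemma msmooth_on_bounded_linear:
  assumes "openin (mtop M) W" "bounded_linear L" "msmooth_on M W f"
  shows "msmooth_on M W (\<lambda>q. L (f q))"
  unfolding msmooth_on_def
proof clarify
  fix V c assume c: "(V, c) \<in> atlas M"
  show "smooth_on ((\<lambda>q. L (f q)) \<circ> the_inv_into V c) (c ` (W \<inter> V))"
    using smooth_on_bounded_linear[OF chart_image_open[OF c assms(1)] assms(2) msmooth_onD[OF assms(3) c]]
    by (simp add: o_def)
qed

lemma msmooth_on_bilinear:
  assumes "openin (mtop M) W" "bounded_bilinear B" "msmooth_on M W f" "msmooth_on M W g"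
  shows "msmooth_on M W (\<lambda>q. B (f q) (g q))"
  unfolding msmooth_on_def
proof clarify
  fix V c assume c: "(V, c) \<in> atlas M"
  show "smooth_on ((\<lambda>q. B (f q) (g q)) \<circ> the_inv_into V c) (c ` (W \<inter> V))"
    using smooth_on_bilinear[OF chart_image_open[OF c assms(1)] assms(2)
      msmooth_onD[OF assms(3) c] msmooth_onD[OF assms(4) c]] by (simp add: o_def)
qed

lemma mderiv_bounded_linear:
  assumes W: "openin (mtop M) W" "p \<in> W" and "bounded_linear L" "msmooth_on M W f"
  shows "mderiv M (\<lambda>q. L (f q)) p v = L (mderiv M f p v)"
proof -
  have "mderiv M (\<lambda>q. L (f q)) p = (\<lambda>v. L (mderiv M f p v))"
    using bounded_linear.has_derivative[OF assms(3) mderiv_has_derivative[OF assms(4) W]]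
    by (intro mderiv_eqI[OF W]) (simp add: o_def)
  then show ?thesis by simp
qed

lemma mderiv_bilinear:
  assumes W: "openin (mtop M) W" "p \<in> W" and B: "bounded_bilinear B" and f: "msmooth_on M W f" "msmooth_on M W g"
  shows "mderiv M (\<lambda>q. B (f q) (g q)) p v = B (mderiv M f p v) (g p) + B (f p) (mderiv M g p v)"
proof -
  have "mderiv M (\<lambda>q. B (f q) (g q)) p = (\<lambda>v. B (f p) (mderiv M g p v) + B (mderiv M f p v) (g p))"
  proof (rule mderiv_eqI[OF W])
    fix U d assume U: "chart_at M p = (U, d)"
    then have "(U, d) \<in> atlas M" "p \<in> U"
      using chart_at[OF openin_topspaceD[OF W]] by auto
    then show "((\<lambda>q. B (f q) (g q)) \<circ> the_inv_into U d has_derivative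
       (\<lambda>v. B (f p) (mderiv M g p v) + B (mderiv M f p v) (g p))) (at (d p))"
      using bounded_bilinear.FDERIV[OF B mderiv_has_derivative[OF f(1) W U] mderiv_has_derivative[OF f(2) W U]]
      by (simp add: o_def chart_inv)
  qed
  then show ?thesis by simp
qed

lemma mderiv_add:
  assumes W: "openin (mtop M) W" "p \<in> W" and "msmooth_on M W f" "msmooth_on M W g"
  shows "mderiv M (\<lambda>q. f q + g q) p v = mderiv M f p v + mderiv M g p v"
proof -
  have "mderiv M (\<lambda>q. f q + g q) p = (\<lambda>v. mderiv M f p v + mderiv M g p v)"
  proof (rule mderiv_eqI[OF W])
    fix U d assume U: "chart_at M p = (U, d)"
    show "((\<lambda>q. f q + g q) \<circ> the_inv_into U d has_derivative (\<lambda>v. mderiv M f p v + mderiv M g p v)) (at (d p))"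
      using has_derivative_add[OF mderiv_has_derivative[OF assms(3) W U] mderiv_has_derivative[OF assms(4) W U]]
      by (simp add: o_def)
  qed
  then show ?thesis by simp
qed

lemma mholomorphic_on_imp_msmooth_on:
  assumes "openin (mtop M) W" "mholomorphic_on M W f"
  shows "msmooth_on M W f"
  unfolding msmooth_on_def
proof clarify
  fix V c assume c: "(V, c) \<in> atlas M"
  then have "holo_on (f \<circ> the_inv_into V c) (c ` (W \<inter> V))"
    using assms(2) unfolding mholomorphic_on_def by blast
  then show "smooth_on (f \<circ> the_inv_into V c) (c ` (W \<inter> V))"
    by (rule holo_on_imp_smooth_on[OF chart_image_open[OF c assms(1)]])
qed

lemma mholomorphic_on_mderiv:
  assumes "openin (mtop M) W" "mholomorphic_on M W f" "p \<in> W"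
  shows "complex_linear (mderiv M f p)"
proof -
  obtain U d where U: "chart_at M p = (U, d)" and d: "(U, d) \<in> atlas M" "p \<in> U"
    by (rule chart_atE[OF openin_topspaceD[OF assms(1,3)]])
  have "holo_on (f \<circ> the_inv_into U d) (d ` (W \<inter> U))"
    using assms(2) d(1) unfolding mholomorphic_on_def by blast
  then show ?thesis
    using holo_on_has_derivative(2) assms(3) d(2) by (auto simp: mderiv_def U)
qed

lemma chart_msmooth_on: "(V, c) \<in> atlas M \<Longrightarrow> msmooth_on M V c"
  by (rule mholomorphic_on_imp_msmooth_on[OF chart_open])
    (auto simp: mholomorphic_on_def transition_holo_on)

text \<open>One chart containing W suffices: in any other chart f is its expression in c composed
  with a holomorphic transition map.\<close>

lemma msmooth_on_chartI:
  assumes W: "openin (mtop M) W" "W \<subseteq> V" and c: "(V, c) \<in> atlas M"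
    and f: "smooth_on (f \<circ> the_inv_into V c) (c ` W)"
  shows "msmooth_on M W f"
  unfolding msmooth_on_def
proof clarify
  fix U d assume d: "(U, d) \<in> atlas M"
  have open_d: "open (d ` (W \<inter> U))" by (rule chart_image_open[OF d W(1)])
  have open_c: "open (c ` W)"
    using chart_image_open[OF c W(1)] W(2) by (simp add: Int_absorb2)
  have "smooth_on (c \<circ> the_inv_into U d) (d ` (W \<inter> U))"
    using holo_on_imp_smooth_on[OF chart_image_open[OF d chart_open[OF c]] transition_holo_on[OF d c]]
    by (rule smooth_on_subset) (use W(2) in auto)
  moreover have "(c \<circ> the_inv_into U d) ` d ` (W \<inter> U) \<subseteq> c ` W"
    using chart_inv[OF d] by auto
  ultimately have "smooth_on (\<lambda>x. (f \<circ> the_inv_into V c) ((c \<circ> the_inv_into U d) x)) (d ` (W \<inter> U))"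
    using smooth_on_compose[OF open_d open_c _ f] by blast
  then show "smooth_on (f \<circ> the_inv_into U d) (d ` (W \<inter> U))"
    by (rule iffD2[OF smooth_on_cong[OF open_d], rotated])
      (use chart_inv[OF d] chart_inv[OF c] W(2) in auto)
qed

section \<open>Smooth vector fields and their brackets\<close>

lemma smooth_field_open: "smooth_field M W X \<Longrightarrow> openin (mtop M) W"
  unfolding smooth_field_def by blast

text \<open>The definition tests the components with respect to c in every chart of the atlas; here
  it is enough to test them in c itself.\<close>

lemma smooth_fieldI:
  assumes W: "openin (mtop M) W"
    and X: "\<And>V c. (V, c) \<in> atlas M \<Longrightarrow> smooth_on ((\<lambda>q. mderiv M c q (X q)) \<circ> the_inv_into V c) (c ` (W \<inter> V))"
  shows "smooth_field M W X"
  unfolding smooth_field_def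
proof (intro conjI W, clarify)
  fix V c assume c: "(V, c) \<in> atlas M"
  show "msmooth_on M (W \<inter> V) (\<lambda>q. mderiv M c q (X q))"
    by (rule msmooth_on_chartI[OF openin_Int[OF W chart_open[OF c]] _ c X[OF c]]) auto
qed

lemma smooth_fieldD:
  assumes "smooth_field M W X" "(V, c) \<in> atlas M"
  shows "smooth_on ((\<lambda>q. mderiv M c q (X q)) \<circ> the_inv_into V c) (c ` (W \<inter> V))"
proof -
  have "msmooth_on M (W \<inter> V) (\<lambda>q. mderiv M c q (X q))"
    using assms unfolding smooth_field_def by blast
  from msmooth_onD[OF this assms(2)] show ?thesis by (simp add: Int_assoc)
qed

lemma smooth_field_subset:
  assumes "smooth_field M W X" "openin (mtop M) W'" "W' \<subseteq> W"
  shows "smooth_field M W' X"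
proof (rule smooth_fieldI[OF assms(2)])
  show "smooth_on ((\<lambda>q. mderiv M c q (X q)) \<circ> the_inv_into V c) (c ` (W' \<inter> V))" if "(V, c) \<in> atlas M" for V c
    by (rule smooth_on_subset[OF smooth_fieldD[OF assms(1) that]]) (use assms(3) in auto)
qed

lemma mderiv_field_in_chart:
  assumes "msmooth_on M W f" "(V, c) \<in> atlas M" "x \<in> c ` (W \<inter> V)"
  shows "((\<lambda>q. mderiv M f q (X q)) \<circ> the_inv_into V c) x =
    frechet_derivative (f \<circ> the_inv_into V c) (at x) (((\<lambda>q. mderiv M c q (X q)) \<circ> the_inv_into V c) x)"
  using assms(3) chart_inv[OF assms(2)] mderiv_in_chart[OF assms(1) _ assms(2)] by auto

lemma msmooth_on_mderiv_field:
  assumes f: "msmooth_on M W f" and X: "smooth_field M W X"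
  shows "msmooth_on M W (\<lambda>q. mderiv M f q (X q))"
  unfolding msmooth_on_def
proof clarify
  fix V c assume c: "(V, c) \<in> atlas M"
  have S: "open (c ` (W \<inter> V))" by (rule chart_image_open[OF c smooth_field_open[OF X]])
  show "smooth_on ((\<lambda>q. mderiv M f q (X q)) \<circ> the_inv_into V c) (c ` (W \<inter> V))"
    using smooth_on_derivative_field[OF S msmooth_onD[OF f c] smooth_fieldD[OF X c]]
    by (rule iffD2[OF smooth_on_cong[OF S], rotated]) (rule mderiv_field_in_chart[OF f c])
qed

lemma mderiv_lie_bracket:
  fixes f :: "'a \<Rightarrow> 'e::euclidean_space"
  assumes f: "msmooth_on M W f" and X: "smooth_field M W X" and Y: "smooth_field M W Y" and p: "p \<in> W"
  shows "mderiv M f p (lie_bracket M X Y p) =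
    mderiv M (\<lambda>q. mderiv M f q (Y q)) p (X p) - mderiv M (\<lambda>q. mderiv M f q (X q)) p (Y p)"
proof -
  have W: "openin (mtop M) W" by (rule smooth_field_open[OF X])
  have pM: "p \<in> topspace (mtop M)" by (rule openin_topspaceD[OF W p])
  obtain U d where U: "chart_at M p = (U, d)" and d: "(U, d) \<in> atlas M" "p \<in> U"
    by (rule chart_atE[OF pM])
  let ?r = "\<lambda>Z. (\<lambda>q. mderiv M d q (Z q)) \<circ> the_inv_into U d"
  let ?f = "f \<circ> the_inv_into U d"
  have S: "open (d ` (W \<inter> U))" "d p \<in> d ` (W \<inter> U)"
    using chart_image_open[OF d(1) W] p d(2) by auto
  \<comment> \<open>Tangent vectors at p are by convention their own components in the chart
    selected at p. At neighbouring points this need not hold.\<close>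
  have at_p: "?r Z (d p) = Z p" for Z
    using mderiv_chart_at[OF pM U] by (simp add: chart_inv[OF d])
  have *: "mderiv M (\<lambda>q. mderiv M f q (Z q)) p v =
     frechet_derivative (\<lambda>x. frechet_derivative ?f (at x) v) (at (d p)) (Z p)
     + mderiv M f p (mderiv M (\<lambda>q. mderiv M d q (Z q)) p v)" if Z: "smooth_field M W Z" for Z v
  proof -
    have "mderiv M (\<lambda>q. mderiv M f q (Z q)) p v =
      frechet_derivative (\<lambda>x. frechet_derivative ?f (at x) (?r Z x)) (at (d p)) v"
    proof -
      have "frechet_derivative ((\<lambda>q. mderiv M f q (Z q)) \<circ> the_inv_into U d) (at (d p)) =
          frechet_derivative (\<lambda>x. frechet_derivative ?f (at x) (?r Z x)) (at (d p))"
        by (rule frechet_derivative_cong[OF S]) (rule mderiv_field_in_chart[OF f d(1)])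
      then show ?thesis by (simp only: mderiv_at[OF U])
    qed
    also have "\<dots> = frechet_derivative (\<lambda>x. frechet_derivative ?f (at x) v) (at (d p)) (?r Z (d p))
      + frechet_derivative ?f (at (d p)) (frechet_derivative (?r Z) (at (d p)) v)"
      by (rule derivative_of_derivative_field[OF S(1) msmooth_onD[OF f d(1)] smooth_fieldD[OF Z d(1)] S(2)])
    finally show ?thesis
      unfolding at_p mderiv_at[OF U] .
  qed
  show ?thesis
    unfolding *[OF X] *[OF Y] lie_bracket_def U Let_def snd_conv
    using linear_diff[OF linear_mderiv[OF f W p]]
      second_derivative_symmetric[OF S(1) msmooth_onD[OF f d(1)] S(2), of "X p" "Y p"]
    by simp
qed

text \<open>Affine functions constrain covariant derivatives along fields only; extending a single
  vector to a field makes these constraints available at a point.\<close>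

lemma exists_smooth_field:
  assumes "p \<in> topspace (mtop M)"
  obtains W X where "smooth_field M W X" "p \<in> W" "X p = v"
proof -
  obtain U d where U: "chart_at M p = (U, d)" and d: "(U, d) \<in> atlas M" "p \<in> U"
    by (rule chart_atE[OF assms])
  \<comment> \<open>The field whose components in the chart d are constantly v.\<close>
  define X where "X q = inv (mderiv M d q) v" for q
  have X: "mderiv M d q (X q) = v" if "q \<in> U" for q
    unfolding X_def using mderiv_chart(2)[OF d(1) that] by (simp add: bij_is_surj surj_f_inv_f)
  have "smooth_field M U X"
    unfolding smooth_field_def
  proof (intro conjI chart_open[OF d(1)], clarify)
    fix V c assume c: "(V, c) \<in> atlas M"
    have UV: "openin (mtop M) (U \<inter> V)" by (intro openin_Int chart_open[OF d(1)] chart_open[OF c])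
    have S: "open (d ` (V \<inter> U))" by (rule chart_image_open[OF d(1) chart_open[OF c]])
    have "smooth_on (\<lambda>x. frechet_derivative (c \<circ> the_inv_into U d) (at x) v) (d ` (V \<inter> U))"
      by (intro smooth_on_derivative holo_on_imp_smooth_on[OF S] transition_holo_on d(1) c)
    then have "smooth_on ((\<lambda>q. mderiv M c q (X q)) \<circ> the_inv_into U d) (d ` (V \<inter> U))"
    proof (rule iffD2[OF smooth_on_cong[OF S], rotated])
      fix x assume "x \<in> d ` (V \<inter> U)"
      then obtain q where "x = d q" "q \<in> V" "q \<in> U" by auto
      then show "((\<lambda>q. mderiv M c q (X q)) \<circ> the_inv_into U d) x =
          frechet_derivative (c \<circ> the_inv_into U d) (at x) v"
        using mderiv_in_chart[OF chart_msmooth_on[OF c] _ d(1)] X chart_inv[OF d(1)] by simp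
    qed
    then show "msmooth_on M (U \<inter> V) (\<lambda>q. mderiv M c q (X q))"
      by (intro msmooth_on_chartI[OF UV _ d(1)]) (auto simp: Int_commute)
  qed
  moreover have "X p = v"
    using X[OF d(2)] mderiv_chart_at[OF assms U] by simp
  ultimately show thesis using that d(2) by blast
qed

text \<open>Covariant derivatives will be given implicitly as solutions of dF(X) = s. In a chart
  this is a linear system with smooth coefficients, and Cramer's rule yields smooth components of
  X.\<close>

lemma smooth_field_solve:
  fixes F :: "'a \<Rightarrow> real^('n + 'n)"
  assumes W: "openin (mtop M) W" and F: "msmooth_on M W F" "\<And>q. q \<in> W \<Longrightarrow> inj (mderiv M F q)"
    and s: "msmooth_on M W s" and X: "\<And>q. q \<in> W \<Longrightarrow> mderiv M F q (X q) = s q"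
  shows "smooth_field M W X"
proof (rule smooth_fieldI[OF W])
  fix V c assume c: "(V, c) \<in> atlas M"
  have S: "open (c ` (W \<inter> V))" by (rule chart_image_open[OF c W])
  let ?F = "F \<circ> the_inv_into V c"
  have F': "mderiv M F q v = frechet_derivative ?F (at (c q)) (mderiv M c q v)" if "q \<in> W" "q \<in> V" for q v
    using mderiv_in_chart[OF F(1) that(1) c that(2)] .
  show "smooth_on ((\<lambda>q. mderiv M c q (X q)) \<circ> the_inv_into V c) (c ` (W \<inter> V))"
    unfolding smooth_on_def
  proof
    fix k
    show "times_differentiable_on k ((\<lambda>q. mderiv M c q (X q)) \<circ> the_inv_into V c) (c ` (W \<inter> V))"
    proof (rule smooth_on_solve[OF S, where A = "\<lambda>x. frechet_derivative ?F (at x)" and v = "s \<circ> the_inv_into V c"])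
      show "linear (frechet_derivative ?F (at x))" if "x \<in> c ` (W \<inter> V)" for x
        by (rule has_derivative_linear[OF smooth_on_has_derivative[OF msmooth_onD[OF F(1) c] that]])
      show "inj (frechet_derivative ?F (at x))" if x: "x \<in> c ` (W \<inter> V)" for x
      proof -
        obtain q where q: "x = c q" "q \<in> W" "q \<in> V" using x by auto
        \<comment> \<open>The derivative of F factors through the chart derivative. As the latter is
          onto, injectivity passes to the outer factor.\<close>
        have "inj (frechet_derivative ?F (at (c q)) \<circ> mderiv M c q)"
          using F(2)[OF q(2)] F'[OF q(2,3)] by (simp add: inj_def)
        moreover have "surj (mderiv M c q)"
          using mderiv_chart(2)[OF c q(3)] bij_is_surj by blast
        ultimately show ?thesis
          unfolding q(1) using inj_on_imageI[of "frechet_derivative ?F (at (c q))" "mderiv M c q" UNIV] by simp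
      qed
      show "times_differentiable_on k (\<lambda>x. frechet_derivative ?F (at x) b) (c ` (W \<inter> V))" for b
        using smooth_on_derivative[OF msmooth_onD[OF F(1) c]] unfolding smooth_on_def by blast
      show "times_differentiable_on k (s \<circ> the_inv_into V c) (c ` (W \<inter> V))"
        using msmooth_onD[OF s c] unfolding smooth_on_def by blast
      show "frechet_derivative ?F (at x) (((\<lambda>q. mderiv M c q (X q)) \<circ> the_inv_into V c) x) = (s \<circ> the_inv_into V c) x"
        if "x \<in> c ` (W \<inter> V)" for x
        using that F'[symmetric] X chart_inv[OF c] by auto
    qed
  qed
qed

end


section \<open>Linear algebra of \<open>T\<^sup>*\<complex>\<^sup>n\<close>\<close>

lemma Omega_alt: "\<Omega> u v = (\<Sum>i\<in>UNIV. u $ Inl i * v $ Inr i - v $ Inl i * u $ Inr i)"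
  by (simp add: \<Omega>_def wedge_def)

lemma Omega_smult_left: "\<Omega> (a *s u) v = a * \<Omega> u v"
  by (simp add: Omega_alt sum_distrib_left algebra_simps)

lemma Omega_smult_right: "\<Omega> u (a *s v) = a * \<Omega> u v"
  by (simp add: Omega_alt sum_distrib_left algebra_simps)

lemma Omega_add: "\<Omega> u (v + w) = \<Omega> u v + \<Omega> u w" "\<Omega> (u + v) w = \<Omega> u w + \<Omega> v w"
  by (simp_all add: Omega_alt algebra_simps flip: sum.distrib)

lemma tau_add: "\<tau> (u + v) = \<tau> u + \<tau> v"
  by (simp add: \<tau>_def vec_eq_iff)

lemma tau_tau [simp]: "\<tau> (\<tau> u) = u"
  by (simp add: \<tau>_def vec_eq_iff)

lemma tau_smult: "\<tau> (a *s u) = cnj a *s \<tau> u"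
  by (simp add: \<tau>_def vec_eq_iff)

lemma Omega_tau: "\<Omega> (\<tau> u) (\<tau> v) = cnj (\<Omega> u v)"
  by (simp add: Omega_alt \<tau>_def)

lemma Omega_skew: "\<Omega> u v = - \<Omega> v u"
  by (simp add: Omega_alt flip: sum_negf)

lemma gamma_hermitian: "\<gamma> u v = cnj (\<gamma> v u)"
proof -
  have "cnj (\<gamma> v u) = - \<i> * \<Omega> (\<tau> v) u"
    using Omega_tau[of v "\<tau> u"] by (simp add: \<gamma>_def)
  then show ?thesis
    by (subst (asm) Omega_skew) (simp add: \<gamma>_def)
qed

lemma gamma_smult_right: "\<gamma> u (a *s v) = cnj a * \<gamma> u v"
  by (simp add: \<gamma>_def tau_smult Omega_smult_right)

lemma gamma_smult_left: "\<gamma> (a *s u) v = a * \<gamma> u v"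
  by (simp add: \<gamma>_def Omega_smult_left)

text \<open>Termwise this is 2 Re a Re b = Re (ab) + Re (a cnj b), which accounts for the factor 2
  in the induced form.\<close>

lemma sum_dx_dy_Omega: "2 * sum_dx_dy u v = Re (\<Omega> u v) + Re (\<Omega> u (\<tau> v))"
  by (simp add: sum_dx_dy_def wedge_def Omega_alt \<tau>_def sum_distrib_left flip: sum.distrib)
    (simp add: algebra_simps)

lemma sum_dx_dy_skew: "sum_dx_dy u v = - sum_dx_dy v u"
  by (simp add: sum_dx_dy_def wedge_def flip: sum_negf)

lemma linear_sum_dx_dy: "linear (sum_dx_dy u)" "linear (\<lambda>u. sum_dx_dy u v)"
  by (auto simp: linear_iff sum_dx_dy_def wedge_def sum_distrib_left algebra_simps simp flip: sum.distrib)

lemma linear_gamma: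
  fixes u v :: "complex^('n::finite + 'n)"
  shows "linear (\<gamma> u)" "linear (\<lambda>u. \<gamma> u v)"
proof -
  have "\<gamma> u (v + w) = \<gamma> u v + \<gamma> u w" "\<gamma> (v + w) u = \<gamma> v u + \<gamma> w u" for u v w :: "complex^('n + 'n)"
    by (simp_all add: \<gamma>_def tau_add Omega_add distrib_left)
  then show "linear (\<gamma> u)" "linear (\<lambda>u. \<gamma> u v)"
    by (auto simp: linear_iff scaleR_conv_smult gamma_smult_left gamma_smult_right scaleR_conv_of_real)
qed

lemma bounded_bilinear_Re_gamma:
  "bounded_bilinear (\<lambda>u v :: complex^('n::finite + 'n). Re (\<gamma> u v))"
proof -
  have "linear (\<lambda>v. Re (\<gamma> u v))" "linear (\<lambda>v. Re (\<gamma> v u))" for u :: "complex^('n + 'n)"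
    using linear_gamma[of u] linear_gamma(2)[of u] by (auto simp: linear_iff)
  then show ?thesis
    by (simp add: bilinear_def flip: bilinear_conv_bounded_bilinear)
qed

text \<open>For real \<open>T u\<close> the value of \<Omega> on \<open>T u\<close> and
  \<open>\<tau> (T v)\<close> is the conjugate of its value on \<open>T u\<close> and
  \<open>T v\<close>, which is 0.\<close>

lemma nondegenerate_isotropic_totally_complex:
  assumes "nondegenerate (\<lambda>u v. \<gamma> (T u) (T v))" "\<And>u v. \<Omega> (T u) (T v) = 0" "\<tau> (T u) = T u"
  shows "u = 0"
proof -
  have "\<gamma> (T u) (T v) = 0" for v
    using Omega_tau[of "T u" "T v"] assms(2,3) by (simp add: \<gamma>_def)
  then show ?thesis using assms(1) by (simp add: nondegenerate_def)
qed

text \<open>If \<open>T u\<close> is purely imaginary, then \<open>T (\<i> *s u)\<close> is real,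
  and a real vector in the image comes from 0 only.\<close>

lemma inj_repart:
  assumes T: "complex_linear T" and "\<And>u. \<tau> (T u) = T u \<Longrightarrow> u = 0"
  shows "inj (\<lambda>u. repart (T u))"
proof -
  have lin: "linear (\<lambda>u. repart (T u))"
    using complex_linear_linear[OF T] by (auto simp: linear_iff repart_def vec_eq_iff)
  have "u = 0" if "repart (T u) = 0" for u
  proof -
    have "\<tau> (T (\<i> *s u)) = T (\<i> *s u)"
      using that by (simp add: complex_linear_scale[OF T] \<tau>_def repart_def vec_eq_iff complex_eq_iff)
    then have "\<i> *s u = 0" by (rule assms(2))
    then show ?thesis by (simp add: vec_eq_iff)
  qed
  then show ?thesis
    unfolding linear_injective_0[OF lin] by blast
qed

text \<open>The subspaces z = 0 and w = 0 are Lagrangian and stable under conjugation, so \<gamma>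
  vanishes on them. In the definite case this excludes kernels of dz and dw.\<close>

lemma gamma_diag_eq_0: "zpart u = 0 \<or> wpart u = 0 \<Longrightarrow> \<gamma> u u = 0"
  by (auto simp: \<gamma>_def Omega_alt \<tau>_def zpart_def wpart_def vec_eq_iff)

lemma zpart_wpart_eq_0: "zpart u = 0 \<Longrightarrow> wpart u = 0 \<Longrightarrow> u = 0"
  unfolding zpart_def wpart_def vec_eq_iff by (simp, metis sum.exhaust)

section \<open>Real symplectic maps and transversality\<close>

lemma real_symplectic_compose:
  "real_symplectic A \<Longrightarrow> real_symplectic B \<Longrightarrow> real_symplectic (\<lambda>x. A (B x))"
  by (simp add: real_symplectic_def complex_linear_def)

lemma real_symplectic_id: "real_symplectic (\<lambda>x. x)"
  by (simp add: real_symplectic_def complex_linear_def)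

text \<open>Invariance makes u orthogonal to every vector, and pairing u with the unit vector of the
  conjugate coordinate isolates each of its components.\<close>

lemma real_symplectic_eq_0:
  assumes "real_symplectic A" "A u = 0"
  shows "u = 0"
proof -
  have *: "\<Omega> u v = 0" for v
    using assms Omega_smult_left[of 0 0 "A v"] by (metis mult_zero_left real_symplectic_def vector_smult_lzero)
  have "u $ Inl i = 0" for i
    using *[of "axis (Inr i) 1"] by (simp add: Omega_alt axis_def if_distrib[of "\<lambda>x. _ * x"] cong: if_cong)
  moreover have "u $ Inr i = 0" for i
    using *[of "axis (Inl i) 1"] by (simp add: Omega_alt axis_def if_distrib[of "\<lambda>x. x * _"] sum_negf cong: if_cong)
  ultimately show ?thesis
    by (intro zpart_wpart_eq_0) (simp_all add: zpart_def wpart_def vec_eq_iff)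
qed

lemma real_symplectic_gamma: "real_symplectic A \<Longrightarrow> \<gamma> (A u) (A v) = \<gamma> u v"
  by (metis \<gamma>_def real_symplectic_def)

lemma real_symplectic_sum_dx_dy:
  assumes "real_symplectic A"
  shows "sum_dx_dy (A u) (A v) = sum_dx_dy u v"
proof -
  have "2 * sum_dx_dy (A u) (A v) = 2 * sum_dx_dy u v"
    unfolding sum_dx_dy_Omega using assms by (metis real_symplectic_def)
  then show ?thesis by simp
qed

text \<open>A real symplectic transvection. It alters one z-coordinate and no w-coordinate, which
  allows many of them to be composed without losing control of w.\<close>

definition shear :: "'n \<Rightarrow> complex^('n::finite + 'n) \<Rightarrow> complex^('n + 'n)" where
  "shear i x = (\<chi> k. case k of Inl j \<Rightarrow> x $ Inl j + (if j = i then x $ Inr i else 0) | Inr j \<Rightarrow> x $ Inr j)"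

text \<open>It exchanges the roles of z and w. Its square is -1, so its inverse is its cube.\<close>

definition quarter_turn :: "complex^('n::finite + 'n) \<Rightarrow> complex^('n + 'n)" where
  "quarter_turn x = (\<chi> k. case k of Inl j \<Rightarrow> x $ Inr j | Inr j \<Rightarrow> - x $ Inl j)"

lemma real_symplectic_shear: "real_symplectic (shear i)"
  unfolding real_symplectic_def complex_linear_def
proof (intro conjI allI)
  show "\<Omega> (shear i u) (shear i v) = \<Omega> u v" for u v
    unfolding Omega_alt by (intro sum.cong) (auto simp: shear_def algebra_simps)
qed (auto simp: shear_def \<tau>_def vec_eq_iff algebra_simps split: sum.split)

lemma real_symplectic_quarter_turn: "real_symplectic quarter_turn"
  unfolding real_symplectic_def complex_linear_def
proof (intro conjI allI)
  show "\<Omega> (quarter_turn u) (quarter_turn v) = \<Omega> u v" for u v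
    unfolding Omega_alt by (intro sum.cong) (auto simp: quarter_turn_def)
qed (auto simp: quarter_turn_def \<tau>_def vec_eq_iff split: sum.split)

text \<open>A vector of the isotropic subspace with \<open>z = 0\<close> and \<open>w\<^sub>i \<noteq> 0\<close> is orthogonal to
  every vector killed by the new \<open>z\<close>, which forces the latter to have \<open>w\<^sub>i = 0\<close>.\<close>

lemma isotropic_partial_transversal:
  fixes T :: "'v \<Rightarrow> complex^('n::finite + 'n)"
  assumes iso: "\<And>u v. \<Omega> (T u) (T v) = 0" and "finite S"
  shows "\<exists>A. real_symplectic A \<and> (\<forall>x. wpart (A x) = wpart x) \<and>
    (\<forall>u. zpart (A (T u)) = 0 \<longrightarrow> (\<forall>i\<in>S. T u $ Inr i = 0))"
  using assms(2)
proof (induction S)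
  case empty
  then show ?case using real_symplectic_id by auto
next
  case (insert i S)
  then obtain A where A: "real_symplectic A" "\<And>x. wpart (A x) = wpart x"
    "\<And>u. zpart (A (T u)) = 0 \<Longrightarrow> \<forall>i\<in>S. T u $ Inr i = 0"
    by blast
  have w: "A x $ Inr j = x $ Inr j" for x j
    using A(2)[of x] by (simp add: wpart_def vec_eq_iff)
  show ?case
  proof (cases "\<forall>u. zpart (A (T u)) = 0 \<longrightarrow> T u $ Inr i = 0")
    case True
    then show ?thesis using A by blast
  next
    case False
    then obtain u0 where u0: "zpart (A (T u0)) = 0" "T u0 $ Inr i \<noteq> 0" by blast
    have kernel: "zpart (A (T u)) = 0 \<and> T u $ Inr i = 0" if "zpart (shear i (A (T u))) = 0" for u
    proof -
      \<comment> \<open>When the sheared z vanishes, the only z-coordinate that can survive is the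
        one of index i, with value -w_i. Pairing with the image of \<open>u0\<close>, whose z is 0,
        leaves the single term -w_i(\<open>T u\<close>) w_i(\<open>T u0\<close>), and the second
        factor is nonzero.\<close>
      have z: "A (T u) $ Inl j = (if j = i then - T u $ Inr i else 0)" for j
        using that by (cases "j = i") (auto simp: zpart_def shear_def vec_eq_iff w eq_neg_iff_add_eq_0 split: if_splits)
      have "\<Omega> (A (T u)) (A (T u0)) = 0"
        using A(1) iso by (simp add: real_symplectic_def)
      then have "(\<Sum>j\<in>UNIV. (if j = i then - T u $ Inr i else 0) * T u0 $ Inr j) = 0"
        using u0(1) by (simp add: Omega_alt z w zpart_def vec_eq_iff)
      then have "T u $ Inr i = 0"
        using u0(2) by (simp add: if_distrib[of "\<lambda>x. x * _"] cong: if_cong)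
      then show ?thesis using z by (simp add: zpart_def vec_eq_iff)
    qed
    have "wpart (shear i (A x)) = wpart x" for x
      using w by (simp add: wpart_def shear_def vec_eq_iff)
    then show ?thesis
      using kernel A(3) real_symplectic_compose[OF real_symplectic_shear[of i] A(1)]
      by (intro exI[of _ "\<lambda>x. shear i (A x)"]) blast
  qed
qed

text \<open>With all indices treated, z = 0 forces w = 0 on the image, since A leaves w unchanged;
  injectivity of A then gives \<open>T u = 0\<close>.\<close>

lemma isotropic_transversal:
  fixes T :: "'v \<Rightarrow> complex^('n::finite + 'n)"
  assumes "\<And>u v. \<Omega> (T u) (T v) = 0"
  shows "\<exists>A. real_symplectic A \<and> (\<forall>x. wpart (A x) = wpart x) \<and> (\<forall>u. zpart (A (T u)) = 0 \<longrightarrow> T u = 0)"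
proof -
  obtain A where A: "real_symplectic A" "\<And>x. wpart (A x) = wpart x"
    "\<And>u. zpart (A (T u)) = 0 \<Longrightarrow> \<forall>i\<in>UNIV. T u $ Inr i = 0"
    using isotropic_partial_transversal[of T UNIV, OF assms] by auto
  have "T u = 0" if "zpart (A (T u)) = 0" for u
  proof -
    have "wpart (A (T u)) = 0"
      using A(2)[of "T u"] A(3)[OF that] by (simp add: wpart_def vec_eq_iff)
    then show ?thesis
      using zpart_wpart_eq_0[OF that] real_symplectic_eq_0[OF A(1)] by blast
  qed
  then show ?thesis using A(1,2) by (intro exI[of _ A]) simp
qed

text \<open>Two passes: one makes z injective on the subspace, the other, conjugated by a quarter
  turn, does so for w. Since \<open>isotropic_transversal\<close> preserves w, its conjugate
  preserves z, and the second pass does not spoil the first.\<close>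

lemma isotropic_conjugate_transversal:
  fixes T :: "'v \<Rightarrow> complex^('n::finite + 'n)"
  assumes iso: "\<And>u v. \<Omega> (T u) (T v) = 0"
  obtains A where "real_symplectic A" "\<And>u. zpart (A (T u)) = 0 \<Longrightarrow> T u = 0"
    "\<And>u. wpart (A (T u)) = 0 \<Longrightarrow> T u = 0"
proof -
  let ?Q = "quarter_turn :: complex^('n + 'n) \<Rightarrow> _"
  have Q: "real_symplectic ?Q" by (rule real_symplectic_quarter_turn)
  obtain A where A: "real_symplectic A" "\<And>x. wpart (A x) = wpart x"
      "\<And>u. zpart (A (T u)) = 0 \<Longrightarrow> T u = 0"
    using isotropic_transversal[of T, OF iso] by (elim exE conjE) simp
  have "\<Omega> (?Q (A (T u))) (?Q (A (T v))) = 0" for u v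
    using iso A(1) Q by (simp add: real_symplectic_def)
  from isotropic_transversal[of "\<lambda>u. ?Q (A (T u))", OF this]
  obtain B where B: "real_symplectic B" "\<And>x. wpart (B x) = wpart x"
      "\<And>u. zpart (B (?Q (A (T u)))) = 0 \<Longrightarrow> ?Q (A (T u)) = 0"
    by (elim exE conjE) simp
  \<comment> \<open>The cube of the quarter turn is its inverse, so this is the conjugate of B by
    it.\<close>
  let ?C = "\<lambda>x. ?Q (?Q (?Q (B (?Q x))))"
  have C: "zpart (?C x) = zpart x" "wpart (?C x) = zpart (B (?Q x))" for x
    using B(2)[of "?Q x"] by (simp_all add: quarter_turn_def zpart_def wpart_def vec_eq_iff)
  show thesis
  proof
    show "real_symplectic (\<lambda>x. ?C (A x))"
      by (rule real_symplectic_compose[OF Q real_symplectic_compose[OF Q real_symplectic_compose[OF Q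
        real_symplectic_compose[OF B(1) real_symplectic_compose[OF Q A(1)]]]]])
    show "T u = 0" if "zpart (?C (A (T u))) = 0" for u
      by (rule A(3)) (use that in \<open>simp only: C\<close>)
    show "T u = 0" if "wpart (?C (A (T u))) = 0" for u
    proof -
      have "?Q (A (T u)) = 0"
        by (rule B(3)) (use that in \<open>simp only: C\<close>)
      from real_symplectic_eq_0[OF A(1) real_symplectic_eq_0[OF Q this]] show ?thesis .
    qed
  qed
qed


section \<open>Pulled back tensors\<close>

lemma linear_repart: "linear (repart :: complex^'m \<Rightarrow> real^'m)"
  by (auto simp: linear_iff repart_def vec_eq_iff)

lemma bounded_linear_repart: "bounded_linear (repart :: complex^'m \<Rightarrow> real^'m::finite)"
  using linear_repart linear_conv_bounded_linear by blast

lemma bounded_linear_smult: "bounded_linear (\<lambda>v :: complex^'m. a *s v)"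
  using linear_smult_right linear_conv_bounded_linear by blast

text \<open>Only real parts enter the form, and these are what the induced connection
  controls.\<close>

lemma sum_dx_dy_repart:
  "repart u = repart u' \<Longrightarrow> repart v = repart v' \<Longrightarrow> sum_dx_dy u v = sum_dx_dy u' v'"
  by (simp add: sum_dx_dy_def wedge_def repart_def vec_eq_iff)

context cmanifold
begin

lemma openin_topspace_mtop: "openin (mtop M) (topspace (mtop M))"
  by simp

lemma mderiv_pullback_fields:
  assumes f: "msmooth_on M W f" and Y: "smooth_field M W Y" and Z: "smooth_field M W Z"
    and p: "p \<in> W" and B: "bounded_bilinear B"
  shows "mderiv M (\<lambda>q. pullback M f B q (Y q) (Z q)) p v =
    B (mderiv M (\<lambda>q. mderiv M f q (Y q)) p v) (mderiv M f p (Z p))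
    + B (mderiv M f p (Y p)) (mderiv M (\<lambda>q. mderiv M f q (Z q)) p v)"
  unfolding pullback_def
  by (rule mderiv_bilinear[OF smooth_field_open[OF Y] p B msmooth_on_mderiv_field[OF f Y] msmooth_on_mderiv_field[OF f Z]])

lemma msmooth_on_smooth_field_subset:
  "msmooth_on M (topspace (mtop M)) f \<Longrightarrow> smooth_field M W X \<Longrightarrow> msmooth_on M W f"
  by (rule msmooth_on_subset) (auto dest: smooth_field_open openin_subset)

lemma smooth_tensor2_pullback:
  fixes f :: "'a \<Rightarrow> 'e::euclidean_space" and B :: "'e \<Rightarrow> 'e \<Rightarrow> real"
  assumes f: "msmooth_on M (topspace (mtop M)) f" and B: "bounded_bilinear B"
  shows "smooth_tensor2 M (pullback M f B)"
  unfolding smooth_tensor2_def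
proof (intro conjI ballI allI impI)
  fix p assume p: "p \<in> topspace (mtop M)"
  have lin: "linear (mderiv M f p)" by (rule linear_mderiv[OF f openin_topspace_mtop p])
  show "bilinear (pullback M f B p)"
    unfolding bilinear_def pullback_def
    using linear_compose[OF lin bounded_linear.linear[OF bounded_bilinear.bounded_linear_right[OF B]]]
      linear_compose[OF lin bounded_linear.linear[OF bounded_bilinear.bounded_linear_left[OF B]]]
    by (auto simp: o_def)
next
  fix U X Y assume "smooth_field M U X \<and> smooth_field M U Y"
  then have X: "smooth_field M U X" and Y: "smooth_field M U Y" by auto
  have f: "msmooth_on M U f" by (rule msmooth_on_smooth_field_subset[OF f X])
  show "msmooth_on M U (\<lambda>p. pullback M f B p (X p) (Y p))"
    unfolding pullback_def
    by (rule msmooth_on_bilinear[OF smooth_field_open[OF X] B msmooth_on_mderiv_field[OF f X] msmooth_on_mderiv_field[OF f Y]])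
qed

text \<open>The pulled back form has constant coefficients B. The Leibniz rule yields six terms, the
  bracket identity for f another six, and they cancel in pairs by skew symmetry.\<close>

lemma closed_form2_pullback:
  fixes f :: "'a \<Rightarrow> 'e::euclidean_space" and B :: "'e \<Rightarrow> 'e \<Rightarrow> real"
  assumes f: "msmooth_on M (topspace (mtop M)) f" and B: "bounded_bilinear B"
    and skew: "\<And>u v. B u v = - B v u"
  shows "closed_form2 M (pullback M f B)"
  unfolding closed_form2_def
proof (intro allI impI ballI)
  fix U X Y Z p
  assume fields: "smooth_field M U X \<and> smooth_field M U Y \<and> smooth_field M U Z" and p: "p \<in> U"
  then have X: "smooth_field M U X" and Y: "smooth_field M U Y" and Z: "smooth_field M U Z" by auto
  have f: "msmooth_on M U f" by (rule msmooth_on_smooth_field_subset[OF f X])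
  note diff = bounded_bilinear.diff_left[OF B] bounded_bilinear.diff_right[OF B]
  let ?D = "\<lambda>X Y. mderiv M (\<lambda>q. mderiv M f q (Y q)) p (X p)"
  have br: "pullback M f B p (lie_bracket M V W p) u = B (?D V W) (mderiv M f p u) - B (?D W V) (mderiv M f p u)"
    if "smooth_field M U V" "smooth_field M U W" for V W u
    by (simp add: pullback_def mderiv_lie_bracket[OF f that p] diff)
  note eqs = mderiv_pullback_fields[OF f Y Z p B] mderiv_pullback_fields[OF f X Z p B]
    mderiv_pullback_fields[OF f X Y p B] br[OF X Y] br[OF X Z] br[OF Y Z]
  show "mderiv M (\<lambda>q. pullback M f B q (Y q) (Z q)) p (X p)
      - mderiv M (\<lambda>q. pullback M f B q (X q) (Z q)) p (Y p)
      + mderiv M (\<lambda>q. pullback M f B q (X q) (Y q)) p (Z p)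
      - pullback M f B p (lie_bracket M X Y p) (Z p)
      + pullback M f B p (lie_bracket M X Z p) (Y p)
      - pullback M f B p (lie_bracket M Y Z p) (X p) = 0"
    unfolding eqs
    using skew[of "mderiv M f p (X p)" "?D Y Z"] skew[of "mderiv M f p (X p)" "?D Z Y"]
      skew[of "mderiv M f p (Y p)" "?D X Z"]
    by linarith
qed

text \<open>The induced form and the Kaehler form are known to agree at points of M only;
  derivatives there see an open set of such points.\<close>

lemma closed_form2_cong:
  assumes "\<And>p. p \<in> topspace (mtop M) \<Longrightarrow> b p = b' p" "closed_form2 M b"
  shows "closed_form2 M b'"
  unfolding closed_form2_def
proof (intro allI impI ballI)
  fix U X Y Z p
  assume fields: "smooth_field M U X \<and> smooth_field M U Y \<and> smooth_field M U Z" and p: "p \<in> U"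
  then have U: "openin (mtop M) U" by (auto dest: smooth_field_open)
  have eq: "b' q = b q" if "q \<in> U" for q using assms(1)[OF openin_topspaceD[OF U that]] by simp
  have "mderiv M (\<lambda>q. b' q (V q) (W q)) p = mderiv M (\<lambda>q. b q (V q) (W q)) p" for V W
    by (rule mderiv_cong[OF U p]) (simp add: eq)
  then show "mderiv M (\<lambda>q. b' q (Y q) (Z q)) p (X p)
      - mderiv M (\<lambda>q. b' q (X q) (Z q)) p (Y p)
      + mderiv M (\<lambda>q. b' q (X q) (Y q)) p (Z p)
      - b' p (lie_bracket M X Y p) (Z p)
      + b' p (lie_bracket M X Z p) (Y p)
      - b' p (lie_bracket M Y Z p) (X p) = 0"
    using assms(2) fields p unfolding closed_form2_def by (simp add: eq)
qed

text \<open>Derivatives of charts are complex linear, so J acts on the components as multiplication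
  by the imaginary unit.\<close>

lemma smooth_field_J:
  assumes "smooth_field M U Y"
  shows "smooth_field M U (\<lambda>q. J (Y q))"
proof (rule smooth_fieldI[OF smooth_field_open[OF assms]])
  fix V c assume c: "(V, c) \<in> atlas M"
  have S: "open (c ` (U \<inter> V))" by (rule chart_image_open[OF c smooth_field_open[OF assms]])
  have "smooth_on (\<lambda>x. \<i> *s ((\<lambda>q. mderiv M c q (Y q)) \<circ> the_inv_into V c) x) (c ` (U \<inter> V))"
    by (rule smooth_on_bounded_linear[OF S bounded_linear_smult smooth_fieldD[OF assms c]])
  then show "smooth_on ((\<lambda>q. mderiv M c q (J (Y q))) \<circ> the_inv_into V c) (c ` (U \<inter> V))"
    by (rule iffD2[OF smooth_on_cong[OF S], rotated])
      (auto simp: chart_inv[OF c] J_def complex_linear_scale[OF mderiv_chart(1)[OF c]])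
qed

end

section \<open>Lagrangian immersions and the induced connection\<close>

locale lagrangian_immersion = cmanifold M for M :: "('a, 'n::finite) cmanifold" +
  fixes \<phi> :: "'a \<Rightarrow> complex^('n + 'n)"
  assumes immersion: "holomorphic_immersion M \<phi>"
    and nondegenerate_map: "nondegenerate_map M \<phi>"
    and lagrangian: "lagrangian M \<phi>"
begin

abbreviation X\<^sub>M where "X\<^sub>M \<equiv> topspace (mtop M)"

abbreviation F where "F \<equiv> \<lambda>q. repart (\<phi> q)"

text \<open>The pull-back of the trivial connection of \<real>^(2n) under the local diffeomorphism
  F: the vector-valued function dF(Y) is differentiated along v and the result carried back by
  dF.\<close>

definition affine_connection_of_immersion :: "('a, 'n) connection" where
  "affine_connection_of_immersion p v Y = inv (mderiv M F p) (mderiv M (\<lambda>q. mderiv M F q (Y q)) p v)"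

lemma phi_mholomorphic: "mholomorphic_on M X\<^sub>M \<phi>"
  using immersion by (simp add: holomorphic_immersion_def)

lemma phi_msmooth: "msmooth_on M X\<^sub>M \<phi>"
  by (rule mholomorphic_on_imp_msmooth_on[OF openin_topspace_mtop phi_mholomorphic])

lemma F_msmooth: "msmooth_on M X\<^sub>M F"
  by (rule msmooth_on_bounded_linear[OF openin_topspace_mtop bounded_linear_repart phi_msmooth])

lemma mderiv_phi: "p \<in> X\<^sub>M \<Longrightarrow> complex_linear (mderiv M \<phi> p)"
  by (rule mholomorphic_on_mderiv[OF openin_topspace_mtop phi_mholomorphic])

lemma mderiv_phi_isotropic: "p \<in> X\<^sub>M \<Longrightarrow> \<Omega> (mderiv M \<phi> p u) (mderiv M \<phi> p v) = 0"
  using lagrangian by (simp add: lagrangian_def pullback_def)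

lemma nondegenerate_gamma: "p \<in> X\<^sub>M \<Longrightarrow> nondegenerate (\<lambda>u v. \<gamma> (mderiv M \<phi> p u) (mderiv M \<phi> p v))"
  using nondegenerate_map unfolding nondegenerate_map_def pullback_def by blast

lemma mderiv_phi_real: "p \<in> X\<^sub>M \<Longrightarrow> \<tau> (mderiv M \<phi> p u) = mderiv M \<phi> p u \<Longrightarrow> u = 0"
  by (rule nondegenerate_isotropic_totally_complex[OF nondegenerate_gamma mderiv_phi_isotropic])

lemma totally_complex_immersion: "totally_complex M \<phi>"
  unfolding totally_complex_def
proof
  fix p assume p: "p \<in> X\<^sub>M"
  have 0: "mderiv M \<phi> p 0 = 0"
    using linear_0[OF complex_linear_linear[OF mderiv_phi[OF p]]] .
  have "\<tau> (0 :: complex^('n + 'n)) = 0" by (simp add: \<tau>_def vec_eq_iff)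
  then show "{v. \<tau> v = v} \<inter> range (mderiv M \<phi> p) = {0}"
    using mderiv_phi_real[OF p] 0 by (auto intro: range_eqI[of _ _ 0])
qed

lemma mderiv_F: "p \<in> X\<^sub>M \<Longrightarrow> mderiv M F p v = repart (mderiv M \<phi> p v)"
  by (rule mderiv_bounded_linear[OF openin_topspace_mtop _ bounded_linear_repart phi_msmooth])

lemma linear_mderiv_F: "p \<in> X\<^sub>M \<Longrightarrow> linear (mderiv M F p)"
  by (rule linear_mderiv[OF F_msmooth openin_topspace_mtop])

text \<open>Injectivity is total complexity, and surjectivity is the equality of real dimensions,
  for which \<open>complexify\<close> brings source and target to one type.\<close>

lemma bij_mderiv_F:
  assumes p: "p \<in> X\<^sub>M"
  shows "bij (mderiv M F p)"
proof -
  have "mderiv M F p = (\<lambda>v. repart (mderiv M \<phi> p v))"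
    using mderiv_F[OF p] by blast
  then have inj: "inj (mderiv M F p)"
    using inj_repart[OF mderiv_phi[OF p] mderiv_phi_real[OF p]] by simp
  have "inj complexify"
    by (rule inj_on_inverseI[where g = realify]) simp
  then have "inj (complexify \<circ> mderiv M F p)"
    using inj by (rule inj_compose)
  then have "surj (complexify \<circ> mderiv M F p)"
    by (intro linear_injective_imp_surjective linear_compose[OF linear_mderiv_F[OF p] linear_complexify]) auto
  have "\<exists>v. y = mderiv M F p v" for y
  proof -
    obtain v where "complexify y = complexify (mderiv M F p v)"
      using surjD[OF \<open>surj (complexify \<circ> mderiv M F p)\<close>, of "complexify y"] by auto
    then show ?thesis by (metis realify_complexify)
  qed
  then have "surj (mderiv M F p)" by (simp add: surj_def)
  then show ?thesis using inj by (simp add: bij_def)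
qed

lemma mderiv_F_eqD: "p \<in> X\<^sub>M \<Longrightarrow> mderiv M F p u = mderiv M F p v \<Longrightarrow> u = v"
  using bij_is_inj[OF bij_mderiv_F] by (simp add: inj_eq)

lemma mderiv_F_field:
  assumes "smooth_field M U Y" "p \<in> U"
  shows "mderiv M (\<lambda>q. mderiv M F q (Y q)) p v = repart (mderiv M (\<lambda>q. mderiv M \<phi> q (Y q)) p v)"
proof -
  note U = smooth_field_open[OF assms(1)]
  have "mderiv M (\<lambda>q. mderiv M F q (Y q)) p = mderiv M (\<lambda>q. repart (mderiv M \<phi> q (Y q))) p"
    by (rule mderiv_cong[OF U assms(2)]) (simp add: mderiv_F openin_topspaceD[OF U])
  then show ?thesis
    using mderiv_bounded_linear[OF U assms(2) bounded_linear_repart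
      msmooth_on_mderiv_field[OF msmooth_on_smooth_field_subset[OF phi_msmooth assms(1)] assms(1)]] by simp
qed

lemma mderiv_F_connection:
  "p \<in> X\<^sub>M \<Longrightarrow> mderiv M F p (affine_connection_of_immersion p v Y) = mderiv M (\<lambda>q. mderiv M F q (Y q)) p v"
  unfolding affine_connection_of_immersion_def by (rule surj_f_inv_f[OF bij_is_surj[OF bij_mderiv_F]])

lemma induced_form_eq_pullback:
  "induced_form M \<phi> = pullback M \<phi> (\<lambda>u v. 2 * sum_dx_dy u v)"
  by (simp add: fun_eq_iff induced_form_def pullback_def)

lemma induced_metric_eq_pullback:
  "induced_metric M \<phi> = pullback M \<phi> (\<lambda>u v. Re (\<gamma> u v))"
  by (simp add: fun_eq_iff induced_metric_def pullback_def)

lemma bounded_bilinear_form: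
  "bounded_bilinear (\<lambda>u v :: complex^('n + 'n). 2 * sum_dx_dy u v)"
proof -
  have "linear (\<lambda>v. 2 * sum_dx_dy u v)" "linear (\<lambda>v. 2 * sum_dx_dy v u)" for u :: "complex^('n + 'n)"
    using linear_sum_dx_dy(1)[of u] linear_sum_dx_dy(2)[of u] by (auto simp: linear_iff algebra_simps)
  then show ?thesis
    by (simp add: bilinear_def flip: bilinear_conv_bounded_bilinear)
qed

text \<open>The second argument of \<gamma> is conjugate linear, so inserting J there cancels the
  factor i of \<gamma> and leaves Re \<Omega>(u, \<tau>v). This is the induced form up to Re
  \<Omega>(u, v), which vanishes on a Lagrangian image.\<close>

lemma induced_form_kahler:
  assumes p: "p \<in> X\<^sub>M"
  shows "induced_form M \<phi> p = kahler_form (induced_metric M \<phi>) p"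
proof (intro ext)
  fix u v
  show "induced_form M \<phi> p u v = kahler_form (induced_metric M \<phi>) p u v"
    unfolding induced_form_eq_pullback induced_metric_eq_pullback kahler_form_def pullback_def
      J_def sum_dx_dy_Omega complex_linear_scale[OF mderiv_phi[OF p]] gamma_smult_right
    by (simp add: mderiv_phi_isotropic[OF p] \<gamma>_def)
qed

lemma induced_metric_properties:
  assumes p: "p \<in> X\<^sub>M"
  shows "induced_metric M \<phi> p u v = induced_metric M \<phi> p v u"
    and "induced_metric M \<phi> p (J u) (J v) = induced_metric M \<phi> p u v"
    and "nondegenerate (induced_metric M \<phi> p)"
proof -
  show "induced_metric M \<phi> p u v = induced_metric M \<phi> p v u"
    unfolding induced_metric_def pullback_def
    by (subst gamma_hermitian) simp
  show "induced_metric M \<phi> p (J u) (J v) = induced_metric M \<phi> p u v"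
    by (simp add: induced_metric_def pullback_def J_def complex_linear_scale[OF mderiv_phi[OF p]]
       gamma_smult_right gamma_smult_left)
  show "nondegenerate (induced_metric M \<phi> p)"
    unfolding nondegenerate_def
  proof (intro allI impI)
    fix u assume u: "\<forall>v. induced_metric M \<phi> p u v = 0"
    \<comment> \<open>The metric sees only the real part of \<gamma>; replacing v by i v recovers
      the imaginary part.\<close>
    have "\<gamma> (mderiv M \<phi> p u) (mderiv M \<phi> p v) = 0" for v
      using spec[OF u, of v] spec[OF u, of "\<i> *s v"]
      by (simp add: induced_metric_def pullback_def complex_linear_scale[OF mderiv_phi[OF p]]
          gamma_smult_right complex_eq_iff)
    then show "u = 0"
      using nondegenerate_gamma[OF p] unfolding nondegenerate_def by blast
  qed
qed

lemma closed_induced_form: "closed_form2 M (induced_form M \<phi>)"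
  unfolding induced_form_eq_pullback
proof (rule closed_form2_pullback[OF phi_msmooth bounded_bilinear_form])
  show "2 * sum_dx_dy u v = - (2 * sum_dx_dy v u)" for u v :: "complex^('n + 'n)"
    using sum_dx_dy_skew[of u v] by simp
qed

lemma kahler_metric_induced: "kahler_metric M (induced_metric M \<phi>)"
  unfolding kahler_metric_def
proof (intro conjI ballI allI)
  show "smooth_tensor2 M (induced_metric M \<phi>)"
    unfolding induced_metric_eq_pullback
    by (rule smooth_tensor2_pullback[OF phi_msmooth bounded_bilinear_Re_gamma])
  show "closed_form2 M (kahler_form (induced_metric M \<phi>))"
    by (rule closed_form2_cong[OF induced_form_kahler closed_induced_form])
qed (use induced_metric_properties in auto)

lemma symplectic_induced_form: "symplectic_form M (induced_form M \<phi>)"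
  unfolding symplectic_form_def
proof (intro conjI ballI allI)
  show "smooth_tensor2 M (induced_form M \<phi>)"
    unfolding induced_form_eq_pullback
    by (rule smooth_tensor2_pullback[OF phi_msmooth bounded_bilinear_form])
  fix p assume p: "p \<in> X\<^sub>M"
  show "induced_form M \<phi> p u v = - induced_form M \<phi> p v u" for u v
    unfolding induced_form_def pullback_def by (subst sum_dx_dy_skew) simp
  show "nondegenerate (induced_form M \<phi> p)"
    unfolding nondegenerate_def induced_form_kahler[OF p] kahler_form_def
  proof (intro allI impI)
    fix u assume u: "\<forall>v. induced_metric M \<phi> p u (J v) = 0"
    \<comment> \<open>Surjectivity of J carries nondegeneracy from the metric over to its Kaehler
      form.\<close>
    have "J (- \<i> *s v) = v" for v :: "complex^'n" by (simp add: J_def vec_eq_iff)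
    then have "induced_metric M \<phi> p u v = 0" for v
      using spec[OF u, of "- \<i> *s v"] by simp
    then show "u = 0"
      using induced_metric_properties(3)[OF p] unfolding nondegenerate_def by blast
  qed
qed (rule closed_induced_form)

text \<open>After applying dF, each pointwise axiom becomes a rule for differentiating the function
  dF(Y), and injectivity of dF returns it to tangent vectors. Smoothness of the covariant derivative
  is the solvability of a smooth linear system.\<close>

lemma affine_connection_induced: "affine_connection M affine_connection_of_immersion" (is "affine_connection M ?D")
  unfolding affine_connection_def
proof (intro conjI allI impI ballI)
  fix U Y p assume Y: "smooth_field M U Y" and p: "p \<in> U"
  have pM: "p \<in> X\<^sub>M" by (rule openin_topspaceD[OF smooth_field_open[OF Y] p])
  note lin = linear_mderiv_F[OF pM]
  have linY: "linear (mderiv M (\<lambda>q. mderiv M F q (Y q)) p)"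
    by (rule linear_mderiv[OF msmooth_on_mderiv_field[OF msmooth_on_smooth_field_subset[OF F_msmooth Y] Y]
          smooth_field_open[OF Y] p])
  show "linear (\<lambda>v. ?D p v Y)"
  proof (rule linearI; rule mderiv_F_eqD[OF pM])
    show "mderiv M F p (?D p (u + v) Y) = mderiv M F p (?D p u Y + ?D p v Y)" for u v
      by (simp add: mderiv_F_connection[OF pM] linear_add[OF lin] linear_add[OF linY])
    show "mderiv M F p (?D p (r *\<^sub>R v) Y) = mderiv M F p (r *\<^sub>R ?D p v Y)" for r v
      by (simp add: mderiv_F_connection[OF pM] linear_scale[OF lin] linear_scale[OF linY])
  qed
next
  fix U Y Z p v assume "smooth_field M U Y \<and> smooth_field M U Z" and p: "p \<in> U"
  then have Y: "smooth_field M U Y" and Z: "smooth_field M U Z" by auto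
  note U = smooth_field_open[OF Y]
  have pM: "p \<in> X\<^sub>M" by (rule openin_topspaceD[OF U p])
  have "mderiv M (\<lambda>q. mderiv M F q (Y q + Z q)) p v = mderiv M (\<lambda>q. mderiv M F q (Y q) + mderiv M F q (Z q)) p v"
    by (rule fun_cong[OF mderiv_cong[OF U p]]) (rule linear_add[OF linear_mderiv_F[OF openin_topspaceD[OF U]]])
  also have "\<dots> = mderiv M (\<lambda>q. mderiv M F q (Y q)) p v + mderiv M (\<lambda>q. mderiv M F q (Z q)) p v"
    by (rule mderiv_add[OF U p msmooth_on_mderiv_field[OF msmooth_on_smooth_field_subset[OF F_msmooth Y] Y]
        msmooth_on_mderiv_field[OF msmooth_on_smooth_field_subset[OF F_msmooth Z] Z]])
  finally have "mderiv M F p (?D p v (\<lambda>q. Y q + Z q)) = mderiv M F p (?D p v Y + ?D p v Z)"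
    by (simp add: mderiv_F_connection[OF pM] linear_add[OF linear_mderiv_F[OF pM]])
  then show "?D p v (\<lambda>q. Y q + Z q) = ?D p v Y + ?D p v Z"
    by (rule mderiv_F_eqD[OF pM])
next
  fix U Y p v and f :: "'a \<Rightarrow> real" assume "smooth_field M U Y \<and> msmooth_on M U f" and p: "p \<in> U"
  then have Y: "smooth_field M U Y" and f: "msmooth_on M U f" by auto
  note U = smooth_field_open[OF Y]
  have pM: "p \<in> X\<^sub>M" by (rule openin_topspaceD[OF U p])
  have "mderiv M (\<lambda>q. mderiv M F q (f q *\<^sub>R Y q)) p v = mderiv M (\<lambda>q. f q *\<^sub>R mderiv M F q (Y q)) p v"
    by (rule fun_cong[OF mderiv_cong[OF U p]]) (rule linear_scale[OF linear_mderiv_F[OF openin_topspaceD[OF U]]])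
  also have "\<dots> = mderiv M f p v *\<^sub>R mderiv M F p (Y p) + f p *\<^sub>R mderiv M (\<lambda>q. mderiv M F q (Y q)) p v"
    by (rule mderiv_bilinear[OF U p bounded_bilinear_scaleR f
        msmooth_on_mderiv_field[OF msmooth_on_smooth_field_subset[OF F_msmooth Y] Y]])
  finally have "mderiv M F p (?D p v (\<lambda>q. f q *\<^sub>R Y q))
      = mderiv M F p (mderiv M f p v *\<^sub>R Y p + f p *\<^sub>R ?D p v Y)"
    by (simp add: mderiv_F_connection[OF pM] linear_add[OF linear_mderiv_F[OF pM]] linear_scale[OF linear_mderiv_F[OF pM]])
  then show "?D p v (\<lambda>q. f q *\<^sub>R Y q) = mderiv M f p v *\<^sub>R Y p + f p *\<^sub>R ?D p v Y"
    by (rule mderiv_F_eqD[OF pM])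
next
  fix U Y Z p v assume A: "smooth_field M U Y \<and> smooth_field M U Z \<and> (\<forall>q\<in>U. Y q = Z q)" and p: "p \<in> U"
  have "mderiv M (\<lambda>q. mderiv M F q (Y q)) p = mderiv M (\<lambda>q. mderiv M F q (Z q)) p"
    by (rule mderiv_cong[OF _ p]) (use A smooth_field_open in auto)
  then show "?D p v Y = ?D p v Z"
    by (simp add: affine_connection_of_immersion_def)
next
  fix U X Y assume "smooth_field M U X \<and> smooth_field M U Y"
  then have X: "smooth_field M U X" and Y: "smooth_field M U Y" by auto
  note U = smooth_field_open[OF Y]
  have F: "msmooth_on M U F" by (rule msmooth_on_smooth_field_subset[OF F_msmooth Y])
  show "smooth_field M U (nabla ?D X Y)"
  proof (rule smooth_field_solve[OF U F])
    show "inj (mderiv M F q)" if "q \<in> U" for q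
      by (rule bij_is_inj[OF bij_mderiv_F[OF openin_topspaceD[OF U that]]])
    show "msmooth_on M U (\<lambda>q. mderiv M (\<lambda>q'. mderiv M F q' (Y q')) q (X q))"
      by (rule msmooth_on_mderiv_field[OF msmooth_on_mderiv_field[OF F Y] X])
    show "mderiv M F q (nabla ?D X Y q) = mderiv M (\<lambda>q'. mderiv M F q' (Y q')) q (X q)" if "q \<in> U" for q
      unfolding nabla_def by (rule mderiv_F_connection[OF openin_topspaceD[OF U that]])
  qed
qed

text \<open>The 2n scalar equations for the coordinate functions combine into the one vector
  equation that later arguments use. It is stated for arbitrary D and U so as to serve on coordinate
  domains as well.\<close>

lemma affine_function_on_F_iff:
  "(\<forall>k. affine_function_on M D U (\<lambda>p. Re (\<phi> p $ k))) \<longleftrightarrow>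
    (\<forall>k. msmooth_on M U (\<lambda>p. F p $ k)) \<and>
    (\<forall>W X Y. W \<subseteq> U \<and> smooth_field M W X \<and> smooth_field M W Y \<longrightarrow>
      (\<forall>p\<in>W. mderiv M F p (nabla D X Y p) = mderiv M (\<lambda>q. mderiv M F q (Y q)) p (X p)))"
proof -
  have *: "(\<lambda>p. Re (\<phi> p $ k)) = (\<lambda>p. F p $ k)" for k
    by (simp add: repart_def)
  have "mderiv M (\<lambda>q. mderiv M (\<lambda>p. F p $ k) q (Y q)) p (X p) - mderiv M (\<lambda>p. F p $ k) p (nabla D X Y p)
    = (mderiv M (\<lambda>q. mderiv M F q (Y q)) p (X p) - mderiv M F p (nabla D X Y p)) $ k"
    if Y: "smooth_field M W Y" and p: "p \<in> W" for k W Y X p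
  proof -
    note W = smooth_field_open[OF Y]
    have F: "msmooth_on M W F" by (rule msmooth_on_smooth_field_subset[OF F_msmooth Y])
    have comp: "mderiv M (\<lambda>p. F p $ k) q v = mderiv M F q v $ k" if "q \<in> W" for q v
      by (rule mderiv_bounded_linear[OF W that bounded_linear_vec_nth F])
    have "mderiv M (\<lambda>q. mderiv M (\<lambda>p. F p $ k) q (Y q)) p (X p) = mderiv M (\<lambda>q. mderiv M F q (Y q) $ k) p (X p)"
      by (rule fun_cong[OF mderiv_cong[OF W p comp]])
    also have "\<dots> = mderiv M (\<lambda>q. mderiv M F q (Y q)) p (X p) $ k"
      by (rule mderiv_bounded_linear[OF W p bounded_linear_vec_nth msmooth_on_mderiv_field[OF F Y]])
    finally show ?thesis by (simp add: comp[OF p])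
  qed
  note eq = this
  show ?thesis (is "?L \<longleftrightarrow> ?R")
  proof
    assume L: ?L
    show ?R
    proof (intro conjI allI impI ballI)
      show "msmooth_on M U (\<lambda>p. F p $ k)" for k
        using L unfolding * affine_function_on_def by blast
      fix W X Y p assume A: "W \<subseteq> U \<and> smooth_field M W X \<and> smooth_field M W Y" and p: "p \<in> W"
      have "(mderiv M (\<lambda>q. mderiv M F q (Y q)) p (X p) - mderiv M F p (nabla D X Y p)) $ k = 0" for k
        using eq[of W Y p k X] L A p unfolding * affine_function_on_def by force
      then show "mderiv M F p (nabla D X Y p) = mderiv M (\<lambda>q. mderiv M F q (Y q)) p (X p)"
        by (simp add: vec_eq_iff)
    qed
  next
    assume R: ?R
    show ?L
      unfolding * affine_function_on_def
    proof (intro conjI allI impI ballI)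
      show "msmooth_on M U (\<lambda>p. F p $ k)" for k using R by blast
      fix k W X Y p assume A: "W \<subseteq> U \<and> smooth_field M W X \<and> smooth_field M W Y" and p: "p \<in> W"
      then have "mderiv M F p (nabla D X Y p) = mderiv M (\<lambda>q. mderiv M F q (Y q)) p (X p)"
        using R by blast
      then show "mderiv M (\<lambda>q. mderiv M (\<lambda>p. F p $ k) q (Y q)) p (X p)
          - mderiv M (\<lambda>p. F p $ k) p (nabla D X Y p) = 0"
        using eq[of W Y p k X] A p by simp
    qed
  qed
qed

lemma F_component_msmooth: "msmooth_on M X\<^sub>M (\<lambda>p. F p $ k)"
  by (rule msmooth_on_bounded_linear[OF openin_topspace_mtop bounded_linear_vec_nth F_msmooth])

lemma induced_connection_exists: "induced_connection M \<phi> affine_connection_of_immersion"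
  (is "induced_connection M \<phi> ?D")
  unfolding induced_connection_def affine_function_on_F_iff
proof (intro conjI allI impI ballI affine_connection_induced F_component_msmooth)
  show "torsion_free M ?D"
    unfolding torsion_free_def
  proof (intro allI impI ballI)
    fix U X Y p assume "smooth_field M U X \<and> smooth_field M U Y" and p: "p \<in> U"
    then have X: "smooth_field M U X" and Y: "smooth_field M U Y" by auto
    have pM: "p \<in> X\<^sub>M" by (rule openin_topspaceD[OF smooth_field_open[OF X] p])
    have "mderiv M F p (nabla ?D X Y p - nabla ?D Y X p) = mderiv M F p (lie_bracket M X Y p)"
      using mderiv_lie_bracket[OF msmooth_on_smooth_field_subset[OF F_msmooth X] X Y p]
      by (simp add: nabla_def linear_diff[OF linear_mderiv_F[OF pM]] mderiv_F_connection[OF pM])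
    then show "nabla ?D X Y p - nabla ?D Y X p = lie_bracket M X Y p"
      by (rule mderiv_F_eqD[OF pM])
  qed
  show "flat M ?D"
    unfolding flat_def
  proof (intro allI impI ballI)
    fix U X Y Z p assume "smooth_field M U X \<and> smooth_field M U Y \<and> smooth_field M U Z" and p: "p \<in> U"
    then have X: "smooth_field M U X" and Y: "smooth_field M U Y" and Z: "smooth_field M U Z" by auto
    note U = smooth_field_open[OF X]
    have pM: "p \<in> X\<^sub>M" by (rule openin_topspaceD[OF U p])
    let ?ZF = "\<lambda>q. mderiv M F q (Z q)"
    have ZF: "msmooth_on M U ?ZF"
      by (rule msmooth_on_mderiv_field[OF msmooth_on_smooth_field_subset[OF F_msmooth Z] Z])
    \<comment> \<open>The inner covariant derivative satisfies dF(\<nabla>_W Z) = W(ZF) on all of U,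
      so this equation may be differentiated once more at p.\<close>
    have nn: "mderiv M F p (nabla ?D V (nabla ?D W Z) p) = mderiv M (\<lambda>q. mderiv M ?ZF q (W q)) p (V p)" for V W
    proof -
      have "mderiv M (\<lambda>q. mderiv M F q (nabla ?D W Z q)) p = mderiv M (\<lambda>q. mderiv M ?ZF q (W q)) p"
        by (rule mderiv_cong[OF U p]) (simp add: nabla_def mderiv_F_connection openin_topspaceD[OF U])
      then show ?thesis by (simp add: nabla_def[of _ V] mderiv_F_connection[OF pM])
    qed
    have "mderiv M F p (nabla ?D X (nabla ?D Y Z) p - nabla ?D Y (nabla ?D X Z) p
        - nabla ?D (lie_bracket M X Y) Z p) = mderiv M F p 0"
      using mderiv_lie_bracket[OF ZF X Y p]
      by (simp add: linear_diff[OF linear_mderiv_F[OF pM]] linear_0[OF linear_mderiv_F[OF pM]] nn)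
        (simp add: nabla_def mderiv_F_connection[OF pM])
    then show "nabla ?D X (nabla ?D Y Z) p - nabla ?D Y (nabla ?D X Z) p
        - nabla ?D (lie_bracket M X Y) Z p = 0"
      by (rule mderiv_F_eqD[OF pM])
  qed
  fix W X Y p assume A: "W \<subseteq> X\<^sub>M \<and> smooth_field M W X \<and> smooth_field M W Y" and p: "p \<in> W"
  then have "p \<in> X\<^sub>M" by blast
  then show "mderiv M F p (nabla ?D X Y p) = mderiv M (\<lambda>q. mderiv M F q (Y q)) p (X p)"
    unfolding nabla_def by (rule mderiv_F_connection)
qed

lemma induced_connection_nabla:
  assumes D: "induced_connection M \<phi> D" and X: "smooth_field M U X" and Y: "smooth_field M U Y" and p: "p \<in> U"
  shows "mderiv M F p (nabla D X Y p) = mderiv M (\<lambda>q. mderiv M F q (Y q)) p (X p)"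
proof -
  have "U \<subseteq> X\<^sub>M" using openin_subset[OF smooth_field_open[OF X]] .
  then show ?thesis
    using D X Y p unfolding induced_connection_def affine_function_on_F_iff by blast
qed

text \<open>The vector v is extended to a smooth field, and both fields are restricted to a common
  domain, because affineness of functions is expressed by fields on the same open set.\<close>

lemma induced_connection_eq:
  assumes D: "induced_connection M \<phi> D" and Y: "smooth_field M U Y" and p: "p \<in> U"
  shows "mderiv M F p (D p v Y) = mderiv M (\<lambda>q. mderiv M F q (Y q)) p v"
proof -
  have pM: "p \<in> X\<^sub>M" by (rule openin_topspaceD[OF smooth_field_open[OF Y] p])
  obtain W X where X: "smooth_field M W X" "p \<in> W" "X p = v"
    by (rule exists_smooth_field[OF pM])
  have UW: "openin (mtop M) (U \<inter> W)"
    by (rule openin_Int[OF smooth_field_open[OF Y] smooth_field_open[OF X(1)]])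
  have "mderiv M F p (nabla D X Y p) = mderiv M (\<lambda>q. mderiv M F q (Y q)) p (X p)"
    by (rule induced_connection_nabla[OF D smooth_field_subset[OF X(1) UW] smooth_field_subset[OF Y UW]])
      (use p X(2) in auto)
  then show ?thesis by (simp add: nabla_def X(3))
qed

lemma induced_connection_unique:
  assumes "induced_connection M \<phi> D" "induced_connection M \<phi> D'"
  shows "same_connection M D D'"
  unfolding same_connection_def
proof (intro allI impI ballI)
  fix U Y p v assume Y: "smooth_field M U Y" and p: "p \<in> U"
  have pM: "p \<in> X\<^sub>M" by (rule openin_topspaceD[OF smooth_field_open[OF Y] p])
  show "D p v Y = D' p v Y"
    by (rule mderiv_F_eqD[OF pM])
      (simp only: induced_connection_eq[OF assms(1) Y p] induced_connection_eq[OF assms(2) Y p])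
qed

text \<open>Complex linearity of d\<phi> gives dF((\<nabla>_X J)Y) = Re (i (X(Y\<phi>) -
  d\<phi>(\<nabla>_X Y))). The inner difference is symmetric in X and Y: exchanging them changes
  both of its terms by d\<phi>([X,Y]), the first by the bracket identity for \<phi>, the second by
  vanishing torsion.\<close>

lemma induced_connection_dJ_zero:
  assumes D: "induced_connection M \<phi> D"
  shows "dJ_zero M D"
  unfolding dJ_zero_def
proof (intro allI impI ballI)
  fix U X Y p assume "smooth_field M U X \<and> smooth_field M U Y" and p: "p \<in> U"
  then have X: "smooth_field M U X" and Y: "smooth_field M U Y" by auto
  note U = smooth_field_open[OF X]
  have pM: "p \<in> X\<^sub>M" by (rule openin_topspaceD[OF U p])
  note lin = linear_mderiv_F[OF pM]
  have \<phi>: "msmooth_on M U \<phi>" by (rule msmooth_on_smooth_field_subset[OF phi_msmooth X])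
  have nJ: "mderiv M F p (nabla D V (\<lambda>q. J (W q)) p) = repart (\<i> *s mderiv M (\<lambda>q. mderiv M \<phi> q (W q)) p (V p))"
    if V: "smooth_field M U V" and W: "smooth_field M U W" for V W
  proof -
    have "mderiv M (\<lambda>q. mderiv M \<phi> q (J (W q))) p (V p) = mderiv M (\<lambda>q. \<i> *s mderiv M \<phi> q (W q)) p (V p)"
      by (rule fun_cong[OF mderiv_cong[OF U p]])
        (simp add: J_def complex_linear_scale[OF mderiv_phi[OF openin_topspaceD[OF U]]])
    also have "\<dots> = \<i> *s mderiv M (\<lambda>q. mderiv M \<phi> q (W q)) p (V p)"
      by (rule mderiv_bounded_linear[OF U p bounded_linear_smult msmooth_on_mderiv_field[OF \<phi> W]])
    finally show ?thesis
      by (simp add: induced_connection_nabla[OF D V smooth_field_J[OF W] p] mderiv_F_field[OF smooth_field_J[OF W] p])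
  qed
  have Jn: "mderiv M F p (J v) = repart (\<i> *s mderiv M \<phi> p v)" for v
    by (simp add: mderiv_F[OF pM] J_def complex_linear_scale[OF mderiv_phi[OF pM]])
  have "nabla D X Y p - nabla D Y X p = lie_bracket M X Y p"
    using D X Y p unfolding induced_connection_def torsion_free_def by blast
  then have "mderiv M \<phi> p (nabla D X Y p) - mderiv M \<phi> p (nabla D Y X p) =
      mderiv M (\<lambda>q. mderiv M \<phi> q (Y q)) p (X p) - mderiv M (\<lambda>q. mderiv M \<phi> q (X q)) p (Y p)"
    using mderiv_lie_bracket[OF \<phi> X Y p] linear_diff[OF linear_mderiv[OF \<phi> U p]] by metis
  then have eq: "mderiv M (\<lambda>q. mderiv M \<phi> q (Y q)) p (X p) - mderiv M \<phi> p (nabla D X Y p)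
      = mderiv M (\<lambda>q. mderiv M \<phi> q (X q)) p (Y p) - mderiv M \<phi> p (nabla D Y X p)"
    by (simp add: algebra_simps)
  have diff: "repart (\<i> *s u) - repart (\<i> *s v) = repart (\<i> *s (u - v))" for u v :: "complex^('n + 'n)"
    by (simp add: repart_def vec_eq_iff)
  have "mderiv M F p (nabla D X (\<lambda>q. J (Y q)) p - J (nabla D X Y p))
      = mderiv M F p (nabla D Y (\<lambda>q. J (X q)) p - J (nabla D Y X p))"
    unfolding linear_diff[OF lin] nJ[OF X Y] nJ[OF Y X] Jn diff eq ..
  then show "nabla D X (\<lambda>q. J (Y q)) p - J (nabla D X Y p) = nabla D Y (\<lambda>q. J (X q)) p - J (nabla D Y X p)"
    by (rule mderiv_F_eqD[OF pM])
qed

text \<open>The vectors d\<phi>(\<nabla>_X Y) and X(Y\<phi>) may differ, but they have the same real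
  part, and the form depends on real parts only. So the two Leibniz terms cancel.\<close>

lemma induced_form_parallel:
  assumes D: "induced_connection M \<phi> D"
  shows "parallel_tensor2 M D (induced_form M \<phi>)"
  unfolding parallel_tensor2_def
proof (intro allI impI ballI)
  fix U X Y Z p assume "smooth_field M U X \<and> smooth_field M U Y \<and> smooth_field M U Z" and p: "p \<in> U"
  then have X: "smooth_field M U X" and Y: "smooth_field M U Y" and Z: "smooth_field M U Z" by auto
  have pM: "p \<in> X\<^sub>M" by (rule openin_topspaceD[OF smooth_field_open[OF X] p])
  have \<phi>: "msmooth_on M U \<phi>" by (rule msmooth_on_smooth_field_subset[OF phi_msmooth X])
  have n: "repart (mderiv M \<phi> p (nabla D X W p)) = repart (mderiv M (\<lambda>q. mderiv M \<phi> q (W q)) p (X p))"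
    if W: "smooth_field M U W" for W
    using induced_connection_nabla[OF D X W p] unfolding mderiv_F[OF pM] mderiv_F_field[OF W p] .
  show "mderiv M (\<lambda>q. induced_form M \<phi> q (Y q) (Z q)) p (X p)
      - induced_form M \<phi> p (nabla D X Y p) (Z p) - induced_form M \<phi> p (Y p) (nabla D X Z p) = 0"
    unfolding induced_form_eq_pullback mderiv_pullback_fields[OF \<phi> Y Z p bounded_bilinear_form]
    by (simp add: pullback_def sum_dx_dy_repart[OF n[OF Y] refl] sum_dx_dy_repart[OF refl n[OF Z]])
qed

lemma induced_special_kahler:
  assumes D: "induced_connection M \<phi> D"
  shows "special_kahler M D (induced_form M \<phi>)"
  unfolding special_kahler_def special_symplectic_def special_complex_def
proof (intro conjI ballI allI complex_manifold induced_connection_dJ_zero[OF D]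
    symplectic_induced_form induced_form_parallel[OF D])
  show "affine_connection M D" "flat M D" "torsion_free M D"
    using D unfolding induced_connection_def by blast+
  show "induced_form M \<phi> p (J u) (J v) = induced_form M \<phi> p u v" if p: "p \<in> X\<^sub>M" for p u v
    unfolding induced_form_kahler[OF p] kahler_form_def by (rule induced_metric_properties(2)[OF p])
qed

end


section \<open>Special coordinates\<close>

lemma coordinate_map_restrict:
  assumes U: "coordinate_map M U f" and U': "openin (mtop M) U'" "U' \<subseteq> U"
  shows "coordinate_map M U' f"
proof -
  have top: "topspace (subtopology (mtop M) U) = U"
    using U by (simp add: coordinate_map_def openin_subset Int_absorb1)
  have "homeomorphic_map (subtopology (subtopology (mtop M) U) U') (subtopology (top_of_set (f ` U)) (f ` U')) f"
  proof (rule homeomorphic_map_subtopologies)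
    show "homeomorphic_map (subtopology (mtop M) U) (top_of_set (f ` U)) f"
      using U by (simp add: coordinate_map_def)
    show "f ` (topspace (subtopology (mtop M) U) \<inter> U') = topspace (top_of_set (f ` U)) \<inter> f ` U'"
      unfolding top using U'(2) by auto
  qed
  moreover have "subtopology (subtopology (mtop M) U) U' = subtopology (mtop M) U'"
    using U'(2) by (simp add: subtopology_subtopology Int_absorb1)
  moreover have "subtopology (top_of_set (f ` U)) (f ` U') = top_of_set (f ` U')"
    using U'(2) by (simp add: subtopology_subtopology Int_absorb1 image_mono)
  moreover have "open (f ` U')"
    using coordinate_map_image_open[OF U U'(1)] U'(2) by (simp add: Int_absorb2)
  ultimately show ?thesis using U'(1) by (simp add: coordinate_map_def)
qed

lemma coordinate_map_compose:
  assumes d: "coordinate_map M U d" and T: "open T" "T \<subseteq> d ` U" and V: "open V" "homeomorphism T V h g"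
    and f: "\<And>q. q \<in> U \<Longrightarrow> d q \<in> T \<Longrightarrow> f q = h (d q)"
  shows "coordinate_map M {q \<in> U. d q \<in> T} f" "f ` {q \<in> U. d q \<in> T} = V"
proof -
  let ?U = "{q \<in> U. d q \<in> T}"
  have U: "coordinate_map M ?U d"
    by (rule coordinate_map_restrict[OF d coordinate_map_preimage_open[OF d T(1)]]) auto
  have dU: "d ` ?U = T" using T(2) by auto
  have hh: "homeomorphic_map (top_of_set T) (top_of_set V) h"
    using V(2) unfolding homeomorphic_map_maps homeomorphic_maps_def homeomorphism_def
    by (intro exI[of _ g]) auto
  have "homeomorphic_map (subtopology (mtop M) ?U) (top_of_set T) d"
    using U unfolding coordinate_map_def dU by (elim conjE)
  from homeomorphic_map_compose[OF this hh]
  have hom: "homeomorphic_map (subtopology (mtop M) ?U) (top_of_set V) f"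
    by (rule homeomorphic_map_eq) (auto simp: f)
  have "f ` ?U = h ` d ` ?U" using f by (auto simp: image_image intro!: image_cong)
  also have "\<dots> = V" using V(2) unfolding dU homeomorphism_def by blast
  finally show fU: "f ` ?U = V" .
  show "coordinate_map M ?U f"
    unfolding coordinate_map_def fU
  proof (intro conjI hom V(1))
    show "openin (mtop M) ?U" using U unfolding coordinate_map_def by (elim conjE)
  qed
qed

lemma holo_on_cong:
  assumes "open S" "\<And>x. x \<in> S \<Longrightarrow> f x = g x" "holo_on f S"
  shows "holo_on g S"
  unfolding holo_on_def
proof
  fix x assume x: "x \<in> S"
  then obtain L where "(f has_derivative L) (at x)" "complex_linear L"
    using assms(3) unfolding holo_on_def by blast
  then show "\<exists>L. (g has_derivative L) (at x) \<and> complex_linear L"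
    using has_derivative_transform_within_open[OF _ assms(1) x assms(2)] by (intro exI[of _ L]) simp
qed

lemma holo_on_subset: "holo_on f S \<Longrightarrow> T \<subseteq> S \<Longrightarrow> holo_on f T"
  unfolding holo_on_def by blast

lemma complex_linear_compose:
  "complex_linear f \<Longrightarrow> complex_linear g \<Longrightarrow> complex_linear (\<lambda>x. f (g x))"
  by (simp add: complex_linear_def)

lemma complex_linear_imp_bounded_linear: "complex_linear L \<Longrightarrow> bounded_linear L"
  using complex_linear_linear linear_conv_bounded_linear by blast

lemma holo_on_compose:
  assumes "holo_on f T" "holo_on g S" "g ` S \<subseteq> T"
  shows "holo_on (\<lambda>x. f (g x)) S"
  unfolding holo_on_def
proof
  fix x assume x: "x \<in> S"
  then have gx: "g x \<in> T" using assms(3) by blast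
  have "((\<lambda>x. f (g x)) has_derivative (\<lambda>v. frechet_derivative f (at (g x)) (frechet_derivative g (at x) v))) (at x)"
    by (rule has_derivative_compose[OF holo_on_has_derivative(1)[OF assms(2) x] holo_on_has_derivative(1)[OF assms(1) gx]])
  moreover have "complex_linear (\<lambda>v. frechet_derivative f (at (g x)) (frechet_derivative g (at x) v))"
    by (rule complex_linear_compose[OF holo_on_has_derivative(2)[OF assms(1) gx] holo_on_has_derivative(2)[OF assms(2) x]])
  ultimately show "\<exists>L. ((\<lambda>x. f (g x)) has_derivative L) (at x) \<and> complex_linear L" by blast
qed

lemma complex_linear_holo_on: "complex_linear L \<Longrightarrow> holo_on L S"
  unfolding holo_on_def using bounded_linear_imp_has_derivative complex_linear_imp_bounded_linear by blast

context cmanifold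
begin

text \<open>Carries a local inverse from the selected chart back to M. The equation
  \<open>g (f q) = d q\<close> is exported because it writes the inverse of f through g, so that
  regularity of g passes to the transitions from f to the atlas.\<close>

lemma local_coordinate_map:
  assumes p: "p \<in> topspace (mtop M)" and chart: "chart_at M p = (U, d)"
    and T: "open T" "T \<subseteq> d ` (W \<inter> U)" "d p \<in> T"
    and V: "open V" "homeomorphism T V (f \<circ> the_inv_into U d) g"
  obtains U' where "p \<in> U'" "U' \<subseteq> W" "U' \<subseteq> U" "coordinate_map M U' f" "f ` U' = V"
    "\<And>q. q \<in> U' \<Longrightarrow> g (f q) = d q"
proof
  note d = chart_at[OF p chart]
  let ?U = "{q \<in> U. d q \<in> T}"
  have f: "f q = (f \<circ> the_inv_into U d) (d q)" if "q \<in> U" for q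
    by (simp add: chart_inv[OF d(1) that])
  show "p \<in> ?U" "?U \<subseteq> U" using T(3) d(2) by auto
  \<comment> \<open>T lies in the chart image of W, and injectivity of the chart turns this into a
    statement about points.\<close>
  show "?U \<subseteq> W"
  proof
    fix q assume q: "q \<in> ?U"
    then obtain q' where q': "d q = d q'" "q' \<in> W" "q' \<in> U" using T(2) by auto
    then have "q = q'"
      using chart_inv[OF d(1), of q] chart_inv[OF d(1), of q'] q by simp
    then show "q \<in> W" using q'(2) by simp
  qed
  have T': "T \<subseteq> d ` U" using T(2) by auto
  show "coordinate_map M ?U f" "f ` ?U = V"
    by (rule coordinate_map_compose[OF chart_coordinate_map[OF d(1)] T(1) T' V f], assumption)+
  show "g (f q) = d q" if "q \<in> ?U" for q
    using f[of q] that V(2) by (simp add: homeomorphism_def)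
qed

lemma local_real_coordinate_system:
  fixes f :: "'a \<Rightarrow> real^('n + 'n)"
  assumes f: "msmooth_on M W f" and W: "openin (mtop M) W" and p: "p \<in> W" and inj: "inj (mderiv M f p)"
  obtains U where "p \<in> U" "U \<subseteq> W" "real_coordinate_system M U f"
proof -
  have pM: "p \<in> topspace (mtop M)" by (rule openin_topspaceD[OF W p])
  obtain U0 d where chart: "chart_at M p = (U0, d)" and d: "(U0, d) \<in> atlas M" "p \<in> U0"
    by (rule chart_atE[OF pM])
  have S: "open (d ` (W \<inter> U0))" "d p \<in> d ` (W \<inter> U0)"
    using chart_image_open[OF d(1) W] p d(2) by auto
  obtain T V g where T: "open T" "T \<subseteq> d ` (W \<inter> U0)" "d p \<in> T"
    and V: "open V" "homeomorphism T V (f \<circ> the_inv_into U0 d) g" and g: "smooth_on g V"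
    by (rule local_smooth_inverse[OF S(1) msmooth_onD[OF f d(1)] S(2) inj[unfolded mderiv_at[OF chart]]])
  obtain U where U: "p \<in> U" "U \<subseteq> W" "U \<subseteq> U0" "coordinate_map M U f" "f ` U = V"
    and gf: "\<And>q. q \<in> U \<Longrightarrow> g (f q) = d q"
    using local_coordinate_map[OF pM chart T V] by metis
  have "smooth_on (c \<circ> the_inv_into U f) (f ` (U \<inter> U1))" if c: "(U1, c) \<in> atlas M" for U1 c
  proof -
    have oI: "open (f ` (U \<inter> U1))"
      using coordinate_map_image_open[OF U(4) chart_open[OF c]] by (simp add: Int_commute)
    have "smooth_on g (f ` (U \<inter> U1))"
      by (rule smooth_on_subset[OF g]) (use U(5) in auto)
    moreover have "smooth_on (c \<circ> the_inv_into U0 d) (d ` (U1 \<inter> U0))"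
      by (rule holo_on_imp_smooth_on[OF chart_image_open[OF d(1) chart_open[OF c]] transition_holo_on[OF d(1) c]])
    moreover have "g ` f ` (U \<inter> U1) \<subseteq> d ` (U1 \<inter> U0)" using gf U(3) by auto
    ultimately have "smooth_on (\<lambda>y. (c \<circ> the_inv_into U0 d) (g y)) (f ` (U \<inter> U1))"
      using smooth_on_compose[OF oI chart_image_open[OF d(1) chart_open[OF c]], of g "c \<circ> the_inv_into U0 d"] by simp
    then show ?thesis
      by (rule iffD2[OF smooth_on_cong[OF oI], rotated])
        (use gf U(3) chart_inv[OF d(1)] coordinate_map_inv[OF U(4)] in auto)
  qed
  then have "real_coordinate_system M U f"
    using U(4) msmooth_on_subset[OF f U(2)] unfolding real_coordinate_system_def by blast
  then show thesis using that U(1,2) by blast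
qed

lemma local_holomorphic_coordinate_system:
  fixes f :: "'a \<Rightarrow> complex^'n"
  assumes f: "mholomorphic_on M W f" and W: "openin (mtop M) W" and p: "p \<in> W" and inj: "inj (mderiv M f p)"
  obtains U where "p \<in> U" "U \<subseteq> W" "holomorphic_coordinate_system M U f"
proof -
  have pM: "p \<in> topspace (mtop M)" by (rule openin_topspaceD[OF W p])
  obtain U0 d where chart: "chart_at M p = (U0, d)" and d: "(U0, d) \<in> atlas M" "p \<in> U0"
    by (rule chart_atE[OF pM])
  have S: "open (d ` (W \<inter> U0))" "d p \<in> d ` (W \<inter> U0)"
    using chart_image_open[OF d(1) W] p d(2) by auto
  have "holo_on (f \<circ> the_inv_into U0 d) (d ` (W \<inter> U0))"
    using f d(1) unfolding mholomorphic_on_def by blast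
  from local_holomorphic_inverse[OF S(1) this S(2) inj[unfolded mderiv_at[OF chart]]]
  obtain T V g where T: "open T" "T \<subseteq> d ` (W \<inter> U0)" "d p \<in> T"
    and V: "open V" "homeomorphism T V (f \<circ> the_inv_into U0 d) g" and g: "holo_on g V" .
  obtain U where U: "p \<in> U" "U \<subseteq> W" "U \<subseteq> U0" "coordinate_map M U f" "f ` U = V"
    and gf: "\<And>q. q \<in> U \<Longrightarrow> g (f q) = d q"
    using local_coordinate_map[OF pM chart T V] by metis
  have "holo_on (c \<circ> the_inv_into U f) (f ` (U \<inter> U1))" if c: "(U1, c) \<in> atlas M" for U1 c
  proof -
    have oI: "open (f ` (U \<inter> U1))"
      using coordinate_map_image_open[OF U(4) chart_open[OF c]] by (simp add: Int_commute)
    have "holo_on g (f ` (U \<inter> U1))"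
      by (rule holo_on_subset[OF g]) (use U(5) in auto)
    moreover have "g ` f ` (U \<inter> U1) \<subseteq> d ` (U1 \<inter> U0)" using gf U(3) by auto
    ultimately have "holo_on (\<lambda>y. (c \<circ> the_inv_into U0 d) (g y)) (f ` (U \<inter> U1))"
      by (rule holo_on_compose[OF transition_holo_on[OF d(1) c]])
    then show ?thesis
      by (rule holo_on_cong[OF oI, rotated])
        (use gf U(3) chart_inv[OF d(1)] coordinate_map_inv[OF U(4)] in auto)
  qed
  moreover have "mholomorphic_on M U f"
    unfolding mholomorphic_on_def
  proof clarify
    fix V c assume "(V, c) \<in> atlas M"
    then have "holo_on (f \<circ> the_inv_into V c) (c ` (W \<inter> V))"
      using f unfolding mholomorphic_on_def by blast
    then show "holo_on (f \<circ> the_inv_into V c) (c ` (U \<inter> V))"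
      by (rule holo_on_subset) (use U(2) in auto)
  qed
  ultimately have "holomorphic_coordinate_system M U f"
    using U(4) unfolding holomorphic_coordinate_system_def by blast
  then show thesis using that U(1,2) by blast
qed

lemma real_coordinate_system_subset:
  assumes U: "real_coordinate_system M U f" and U': "openin (mtop M) U'" "U' \<subseteq> U"
  shows "real_coordinate_system M U' f"
proof -
  have cU: "coordinate_map M U f" using U by (simp add: real_coordinate_system_def)
  have cU': "coordinate_map M U' f" by (rule coordinate_map_restrict[OF cU U'])
  have "smooth_on (c \<circ> the_inv_into U' f) (f ` (U' \<inter> V))" if c: "(V, c) \<in> atlas M" for V c
  proof -
    have oI: "open (f ` (U' \<inter> V))"
      using coordinate_map_image_open[OF cU' chart_open[OF c]] by (simp add: Int_commute)
    have "smooth_on (c \<circ> the_inv_into U f) (f ` (U \<inter> V))"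
      using U c unfolding real_coordinate_system_def by blast
    then have "smooth_on (c \<circ> the_inv_into U f) (f ` (U' \<inter> V))"
      by (rule smooth_on_subset) (use U'(2) in auto)
    then show ?thesis
      by (rule iffD2[OF smooth_on_cong[OF oI], rotated])
        (use U'(2) coordinate_map_inv[OF cU] coordinate_map_inv[OF cU'] in auto)
  qed
  moreover have "msmooth_on M U' f"
    using U by (intro msmooth_on_subset[OF _ U'(2)]) (simp add: real_coordinate_system_def)
  ultimately show ?thesis using cU' unfolding real_coordinate_system_def by blast
qed

lemma holomorphic_coordinate_system_subset:
  assumes U: "holomorphic_coordinate_system M U f" and U': "openin (mtop M) U'" "U' \<subseteq> U"
  shows "holomorphic_coordinate_system M U' f"
proof -
  have cU: "coordinate_map M U f" using U by (simp add: holomorphic_coordinate_system_def)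
  have cU': "coordinate_map M U' f" by (rule coordinate_map_restrict[OF cU U'])
  have "holo_on (c \<circ> the_inv_into U' f) (f ` (U' \<inter> V)) \<and> holo_on (f \<circ> the_inv_into V c) (c ` (U' \<inter> V))"
    if c: "(V, c) \<in> atlas M" for V c
  proof
    have oI: "open (f ` (U' \<inter> V))"
      using coordinate_map_image_open[OF cU' chart_open[OF c]] by (simp add: Int_commute)
    have h: "holo_on (c \<circ> the_inv_into U f) (f ` (U \<inter> V))" "holo_on (f \<circ> the_inv_into V c) (c ` (U \<inter> V))"
      using U c unfolding holomorphic_coordinate_system_def mholomorphic_on_def by blast+
    have "holo_on (c \<circ> the_inv_into U f) (f ` (U' \<inter> V))"
      by (rule holo_on_subset[OF h(1)]) (use U'(2) in auto)
    then show "holo_on (c \<circ> the_inv_into U' f) (f ` (U' \<inter> V))"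
      by (rule holo_on_cong[OF oI, rotated])
        (use U'(2) coordinate_map_inv[OF cU] coordinate_map_inv[OF cU'] in auto)
    show "holo_on (f \<circ> the_inv_into V c) (c ` (U' \<inter> V))"
      by (rule holo_on_subset[OF h(2)]) (use U'(2) in auto)
  qed
  then show ?thesis
    using cU' unfolding holomorphic_coordinate_system_def mholomorphic_on_def by blast
qed

text \<open>The inverse of f is differentiable in charts, and its derivative is a left inverse of
  the derivative of f. This is the necessity in the criterion for conjugate pairs.\<close>

lemma holomorphic_coordinate_system_inj:
  assumes U: "holomorphic_coordinate_system M U f" and p: "p \<in> U"
  shows "inj (mderiv M f p)"
proof -
  have cU: "coordinate_map M U f" using U by (simp add: holomorphic_coordinate_system_def)
  have oU: "openin (mtop M) U" using cU by (simp add: coordinate_map_def)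
  obtain U0 d where chart: "chart_at M p = (U0, d)" and d: "(U0, d) \<in> atlas M" "p \<in> U0"
    by (rule chart_atE[OF openin_topspaceD[OF oU p]])
  have h: "holo_on (d \<circ> the_inv_into U f) (f ` (U \<inter> U0))" "holo_on (f \<circ> the_inv_into U0 d) (d ` (U \<inter> U0))"
    using U d(1) unfolding holomorphic_coordinate_system_def mholomorphic_on_def by blast+
  have S: "open (d ` (U \<inter> U0))" "d p \<in> d ` (U \<inter> U0)"
    using chart_image_open[OF d(1) oU] p d(2) by auto
  have f: "((f \<circ> the_inv_into U0 d) has_derivative mderiv M f p) (at (d p))"
    using holo_on_has_derivative(1)[OF h(2) S(2)] by (simp add: mderiv_at[OF chart])
  have "(f \<circ> the_inv_into U0 d) (d p) \<in> f ` (U \<inter> U0)"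
    using p d(2) by (simp add: chart_inv[OF d])
  from has_derivative_compose[OF f holo_on_has_derivative(1)[OF h(1) this]]
  obtain L where "((\<lambda>x. (d \<circ> the_inv_into U f) ((f \<circ> the_inv_into U0 d) x)) has_derivative (\<lambda>v. L (mderiv M f p v))) (at (d p))"
    by blast
  then have "((\<lambda>x. x) has_derivative (\<lambda>v. L (mderiv M f p v))) (at (d p))"
    by (rule has_derivative_transform_within_open[OF _ S])
      (use chart_inv[OF d(1)] coordinate_map_inv[OF cU] in auto)
  then have "(\<lambda>v. L (mderiv M f p v)) = (\<lambda>v. v)"
    by (rule has_derivative_unique[OF _ has_derivative_ident])
  then show ?thesis by (intro inj_on_inverseI[of _ L]) (rule fun_cong)
qed

lemma mholomorphic_on_complex_linear:
  assumes "complex_linear L" "mholomorphic_on M W f"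
  shows "mholomorphic_on M W (\<lambda>q. L (f q))"
  unfolding mholomorphic_on_def
proof clarify
  fix V c assume "(V, c) \<in> atlas M"
  then have "holo_on (f \<circ> the_inv_into V c) (c ` (W \<inter> V))"
    using assms(2) unfolding mholomorphic_on_def by blast
  from holo_on_compose[OF complex_linear_holo_on[OF assms(1), of UNIV] this]
  show "holo_on ((\<lambda>q. L (f q)) \<circ> the_inv_into V c) (c ` (W \<inter> V))"
    by (simp add: o_def)
qed

end

lemma complex_linear_zpart: "complex_linear zpart"
  by (simp add: complex_linear_def zpart_def vec_eq_iff)

lemma complex_linear_wpart: "complex_linear wpart"
  by (simp add: complex_linear_def wpart_def vec_eq_iff)

lemma repart_zpart_wpart:
  "(\<lambda>p. \<chi> k. case k of Inl i \<Rightarrow> Re ((zpart \<circ> \<psi>) p $ i) | Inr i \<Rightarrow> Re ((wpart \<circ> \<psi>) p $ i)) = repart \<circ> \<psi>"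
  by (auto simp: fun_eq_iff zpart_def wpart_def repart_def vec_eq_iff split: sum.split)

text \<open>Commuting with conjugation, A maps (x + \<tau>x)/2 to the real part of
  \<open>A x\<close>. So the real part of the image depends on that of x alone.\<close>

lemma real_symplectic_repart:
  assumes "real_symplectic A"
  shows "repart (A x) = repart (A (\<chi> k. of_real (repart x $ k)))"
proof -
  have cl: "complex_linear A" using assms by (simp add: real_symplectic_def)
  have "(\<chi> k. of_real (repart x $ k)) = (1 / 2) *s (x + \<tau> x)"
    by (simp add: vec_eq_iff repart_def \<tau>_def complex_eq_iff)
  then have "A (\<chi> k. of_real (repart x $ k)) = (1 / 2) *s (A x + \<tau> (A x))"
    using assms cl by (simp add: real_symplectic_def complex_linear_def)
  then show ?thesis by (simp add: repart_def \<tau>_def vec_eq_iff)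
qed

context lagrangian_immersion
begin

lemma mderiv_linear_phi:
  "complex_linear L \<Longrightarrow> p \<in> X\<^sub>M \<Longrightarrow> mderiv M (L \<circ> \<phi>) p v = L (mderiv M \<phi> p v)"
  using mderiv_bounded_linear[OF openin_topspace_mtop _ complex_linear_imp_bounded_linear phi_msmooth]
  by (simp add: o_def)

lemma inj_mderiv_linear_phi_iff:
  assumes L: "complex_linear L" and p: "p \<in> X\<^sub>M"
  shows "inj (mderiv M (L \<circ> \<phi>) p) \<longleftrightarrow> (\<forall>u. L (mderiv M \<phi> p u) = 0 \<longrightarrow> u = 0)"
proof -
  have eq: "mderiv M (L \<circ> \<phi>) p = (\<lambda>u. L (mderiv M \<phi> p u))"
    using mderiv_linear_phi[OF L p] by blast
  have "linear (\<lambda>u. L (mderiv M \<phi> p u))"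
    by (rule complex_linear_linear[OF complex_linear_compose[OF L mderiv_phi[OF p]]])
  then show ?thesis unfolding eq by (rule linear_injective_0)
qed

lemma real_coordinate_system_F:
  assumes p: "p \<in> X\<^sub>M"
  obtains U where "p \<in> U" "real_coordinate_system M U (repart \<circ> \<phi>)"
proof -
  obtain U where "p \<in> U" "U \<subseteq> X\<^sub>M" "real_coordinate_system M U F"
    by (rule local_real_coordinate_system[OF F_msmooth openin_topspace_mtop p bij_is_inj[OF bij_mderiv_F[OF p]]])
  then show thesis using that[of U] by (simp add: o_def)
qed

lemma real_special_coordinatesI:
  assumes D: "induced_connection M \<phi> D" and U: "real_coordinate_system M U (repart \<circ> \<phi>)"
  shows "real_special_coordinates M D (induced_form M \<phi>) U (repart \<circ> \<phi>)"
  unfolding real_special_coordinates_def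
proof (intro conjI allI ballI U)
  have "openin (mtop M) U" using U by (simp add: real_coordinate_system_def coordinate_map_def)
  then have UM: "U \<subseteq> X\<^sub>M" by (rule openin_subset)
  have "\<forall>k. affine_function_on M D U (\<lambda>p. Re (\<phi> p $ k))"
    unfolding affine_function_on_F_iff
  proof (intro conjI allI impI ballI)
    show "msmooth_on M U (\<lambda>p. F p $ k)" for k
      by (rule msmooth_on_subset[OF F_component_msmooth UM])
    fix W X Y p assume "W \<subseteq> U \<and> smooth_field M W X \<and> smooth_field M W Y" and p: "p \<in> W"
    then show "mderiv M F p (nabla D X Y p) = mderiv M (\<lambda>q. mderiv M F q (Y q)) p (X p)"
      using induced_connection_nabla[OF D _ _ p] by blast
  qed
  then show "affine_function_on M D U (\<lambda>p. (repart \<circ> \<phi>) p $ k)" for k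
    by (simp add: repart_def)
  fix p u v assume "p \<in> U"
  then have p: "p \<in> X\<^sub>M" using UM by blast
  have "mderiv M (\<lambda>q. (repart \<circ> \<phi>) q $ k) p u = Re (mderiv M \<phi> p u $ k)" for k u
    using mderiv_bounded_linear[OF openin_topspace_mtop p bounded_linear_vec_nth F_msmooth, of k u]
    by (simp add: mderiv_F[OF p]) (simp add: repart_def)
  then show "induced_form M \<phi> p u v = 2 * (\<Sum>i\<in>UNIV. wedge (mderiv M (\<lambda>q. (repart \<circ> \<phi>) q $ Inl i) p)
      (mderiv M (\<lambda>q. (repart \<circ> \<phi>) q $ Inr i) p) u v)"
    by (simp add: induced_form_def pullback_def sum_dx_dy_def wedge_def)
qed

text \<open>For the converse the inverse function theorem is invoked for z, for w and for Re \<phi>,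
  and the three domains are intersected. The real coordinates exist in any case, so the two
  injectivity conditions are the whole obstruction.\<close>

lemma conjugate_pair_around_iff:
  assumes D: "induced_connection M \<phi> D" and p: "p \<in> X\<^sub>M"
  shows "conjugate_pair_around M D (induced_form M \<phi>) \<phi> p \<longleftrightarrow>
    inj (mderiv M (zpart \<circ> \<phi>) p) \<and> inj (mderiv M (wpart \<circ> \<phi>) p)"
proof
  assume "conjugate_pair_around M D (induced_form M \<phi>) \<phi> p"
  then show "inj (mderiv M (zpart \<circ> \<phi>) p) \<and> inj (mderiv M (wpart \<circ> \<phi>) p)"
    unfolding conjugate_pair_around_def conjugate_pair_def using holomorphic_coordinate_system_inj by blast
next
  assume inj: "inj (mderiv M (zpart \<circ> \<phi>) p) \<and> inj (mderiv M (wpart \<circ> \<phi>) p)"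
  have hol: "mholomorphic_on M X\<^sub>M (zpart \<circ> \<phi>)" "mholomorphic_on M X\<^sub>M (wpart \<circ> \<phi>)"
    using mholomorphic_on_complex_linear[OF complex_linear_zpart phi_mholomorphic]
      mholomorphic_on_complex_linear[OF complex_linear_wpart phi_mholomorphic] by (simp_all add: o_def)
  obtain Uz where Uz: "p \<in> Uz" "holomorphic_coordinate_system M Uz (zpart \<circ> \<phi>)"
    by (rule local_holomorphic_coordinate_system[OF hol(1) openin_topspace_mtop p conjunct1[OF inj]])
  obtain Uw where Uw: "p \<in> Uw" "holomorphic_coordinate_system M Uw (wpart \<circ> \<phi>)"
    by (rule local_holomorphic_coordinate_system[OF hol(2) openin_topspace_mtop p conjunct2[OF inj]])
  obtain Ur where Ur: "p \<in> Ur" "real_coordinate_system M Ur (repart \<circ> \<phi>)"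
    by (rule real_coordinate_system_F[OF p])
  let ?U = "Uz \<inter> Uw \<inter> Ur"
  have "openin (mtop M) Uz" "openin (mtop M) Uw" "openin (mtop M) Ur"
    using Uz(2) Uw(2) Ur(2)
    by (auto simp: holomorphic_coordinate_system_def real_coordinate_system_def coordinate_map_def)
  then have U: "openin (mtop M) ?U" by (intro openin_Int)
  have "conjugate_pair M D (induced_form M \<phi>) ?U (zpart \<circ> \<phi>) (wpart \<circ> \<phi>)"
    unfolding conjugate_pair_def repart_zpart_wpart
  proof (intro conjI)
    show "holomorphic_coordinate_system M ?U (zpart \<circ> \<phi>)"
      by (rule holomorphic_coordinate_system_subset[OF Uz(2) U]) auto
    show "holomorphic_coordinate_system M ?U (wpart \<circ> \<phi>)"
      by (rule holomorphic_coordinate_system_subset[OF Uw(2) U]) auto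
    show "real_special_coordinates M D (induced_form M \<phi>) ?U (repart \<circ> \<phi>)"
      by (rule real_special_coordinatesI[OF D real_coordinate_system_subset[OF Ur(2) U]]) auto
  qed
  then show "conjugate_pair_around M D (induced_form M \<phi>) \<phi> p"
    unfolding conjugate_pair_around_def by (intro exI[of _ ?U] conjI IntI Uz(1) Uw(1) Ur(1))
qed

text \<open>A vector in the kernel of dz or dw is null for the metric.\<close>

lemma definite_inj:
  assumes p: "p \<in> X\<^sub>M" and "definite (induced_metric M \<phi> p)"
  shows "inj (mderiv M (zpart \<circ> \<phi>) p)" "inj (mderiv M (wpart \<circ> \<phi>) p)"
proof -
  have *: "u = 0" if "zpart (mderiv M \<phi> p u) = 0 \<or> wpart (mderiv M \<phi> p u) = 0" for u
  proof (rule ccontr)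
    assume "u \<noteq> 0"
    moreover have "induced_metric M \<phi> p u u = 0"
      using gamma_diag_eq_0[OF that] by (simp add: induced_metric_def pullback_def)
    ultimately show False using assms(2) unfolding definite_def by (metis less_irrefl)
  qed
  show "inj (mderiv M (zpart \<circ> \<phi>) p)"
    unfolding inj_mderiv_linear_phi_iff[OF complex_linear_zpart p] by (intro allI impI *) simp
  show "inj (mderiv M (wpart \<circ> \<phi>) p)"
    unfolding inj_mderiv_linear_phi_iff[OF complex_linear_wpart p] by (intro allI impI *) simp
qed

section \<open>Changes of the canonical coordinates\<close>

lemma lagrangian_immersion_real_symplectic:
  assumes A: "real_symplectic A"
  shows "lagrangian_immersion M (A \<circ> \<phi>)"
proof
  have cl: "complex_linear A" using A by (simp add: real_symplectic_def)
  have A0: "mderiv M \<phi> p u = 0" if "A (mderiv M \<phi> p u) = 0" for p u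
    by (rule real_symplectic_eq_0[OF A that])
  show "holomorphic_immersion M (A \<circ> \<phi>)"
    unfolding holomorphic_immersion_def
  proof (intro conjI ballI)
    show "mholomorphic_on M X\<^sub>M (A \<circ> \<phi>)"
      using mholomorphic_on_complex_linear[OF cl phi_mholomorphic] by (simp add: o_def)
    fix p assume p: "p \<in> X\<^sub>M"
    \<comment> \<open>Zero is a real vector, so \<open>mderiv_phi_real\<close> also contains the
      injectivity of d\<phi>.\<close>
    have "\<tau> (0 :: complex^('n + 'n)) = 0" by (simp add: \<tau>_def vec_eq_iff)
    then show "inj (mderiv M (A \<circ> \<phi>) p)"
      unfolding inj_mderiv_linear_phi_iff[OF cl p] using A0 mderiv_phi_real[OF p] by metis
  qed
  show "nondegenerate_map M (A \<circ> \<phi>)"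
    using nondegenerate_map unfolding nondegenerate_map_def nondegenerate_def pullback_def
    by (simp add: mderiv_linear_phi[OF cl] real_symplectic_gamma[OF A])
  show "lagrangian M (A \<circ> \<phi>)"
    using lagrangian A unfolding lagrangian_def pullback_def
    by (simp add: mderiv_linear_phi[OF cl] real_symplectic_def)
qed

text \<open>The new real coordinate functions are constant linear combinations of the old ones, so
  they are affine for the same D.\<close>

lemma induced_connection_real_symplectic:
  assumes A: "real_symplectic A" and D: "induced_connection M \<phi> D"
  shows "induced_connection M (A \<circ> \<phi>) D"
proof -
  interpret A: lagrangian_immersion M "A \<circ> \<phi>" by (rule lagrangian_immersion_real_symplectic[OF A])
  define L where "L = (\<lambda>y. repart (A (\<chi> k. complex_of_real (y $ k))))"
  have cl: "complex_linear A" using A by (simp add: real_symplectic_def)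
  have "linear (\<lambda>y :: real^('n + 'n). \<chi> k. complex_of_real (y $ k))"
    by (simp add: linear_iff vec_eq_iff) (simp add: scaleR_conv_of_real)
  from linear_compose[OF linear_compose[OF this complex_linear_linear[OF cl]] linear_repart]
  have "linear L" by (simp add: L_def o_def)
  then have L: "bounded_linear L" by (simp add: linear_conv_bounded_linear)
  have AF: "repart ((A \<circ> \<phi>) q) = L (F q)" for q
    unfolding L_def comp_apply by (rule real_symplectic_repart[OF A])
  have "mderiv M A.F p (nabla D X Y p) = mderiv M (\<lambda>q. mderiv M A.F q (Y q)) p (X p)"
    if X: "smooth_field M W X" and Y: "smooth_field M W Y" and p: "p \<in> W" for W X Y p
  proof -
    note W = smooth_field_open[OF X]
    have F: "msmooth_on M W F" by (rule msmooth_on_smooth_field_subset[OF F_msmooth X])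
    have LF: "mderiv M (\<lambda>q. L (F q)) q v = L (mderiv M F q v)" if "q \<in> W" for q v
      by (rule mderiv_bounded_linear[OF W that L F])
    have "mderiv M (\<lambda>q. mderiv M (\<lambda>q. L (F q)) q (Y q)) p = mderiv M (\<lambda>q. L (mderiv M F q (Y q))) p"
      by (rule mderiv_cong[OF W p LF])
    then have "mderiv M (\<lambda>q. mderiv M (\<lambda>q. L (F q)) q (Y q)) p (X p) = L (mderiv M (\<lambda>q. mderiv M F q (Y q)) p (X p))"
      using mderiv_bounded_linear[OF W p L msmooth_on_mderiv_field[OF F Y]] by simp
    then show ?thesis
      unfolding AF LF[OF p] induced_connection_nabla[OF D X Y p] by simp
  qed
  then show ?thesis
    using D A.F_component_msmooth unfolding induced_connection_def A.affine_function_on_F_iff by blast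
qed

text \<open>The injectivity criterion is applied to the transformed immersion, which has the same
  connection. The resulting pair is then referred back to the original form, with which the
  transformed one agrees on M.\<close>

lemma conjugate_pair_around_real_symplectic:
  assumes D: "induced_connection M \<phi> D" and p: "p \<in> X\<^sub>M"
  shows "\<exists>A. real_symplectic A \<and> conjugate_pair_around M D (induced_form M \<phi>) (A \<circ> \<phi>) p"
proof -
  obtain A where A: "real_symplectic A"
      "\<And>u. zpart (A (mderiv M \<phi> p u)) = 0 \<Longrightarrow> mderiv M \<phi> p u = 0"
      "\<And>u. wpart (A (mderiv M \<phi> p u)) = 0 \<Longrightarrow> mderiv M \<phi> p u = 0"
    using isotropic_conjugate_transversal[of "mderiv M \<phi> p", OF mderiv_phi_isotropic[OF p]] by metis
  interpret A: lagrangian_immersion M "A \<circ> \<phi>" by (rule lagrangian_immersion_real_symplectic[OF A(1)])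
  have cl: "complex_linear A" using A(1) by (simp add: real_symplectic_def)
  have D': "induced_connection M (A \<circ> \<phi>) D" by (rule induced_connection_real_symplectic[OF A(1) D])
  have form: "induced_form M (A \<circ> \<phi>) q = induced_form M \<phi> q" if "q \<in> X\<^sub>M" for q
    by (simp add: fun_eq_iff induced_form_def pullback_def mderiv_linear_phi[OF cl that] real_symplectic_sum_dx_dy[OF A(1)])
  have inj0: "u = 0" if "mderiv M \<phi> p u = 0" for u
    by (rule mderiv_phi_real[OF p]) (simp add: that \<tau>_def vec_eq_iff)
  have "inj (mderiv M (zpart \<circ> (A \<circ> \<phi>)) p)"
    unfolding A.inj_mderiv_linear_phi_iff[OF complex_linear_zpart p] mderiv_linear_phi[OF cl p]
    by (intro allI impI) (rule inj0[OF A(2)])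
  moreover have "inj (mderiv M (wpart \<circ> (A \<circ> \<phi>)) p)"
    unfolding A.inj_mderiv_linear_phi_iff[OF complex_linear_wpart p] mderiv_linear_phi[OF cl p]
    by (intro allI impI) (rule inj0[OF A(3)])
  ultimately have "conjugate_pair_around M D (induced_form M (A \<circ> \<phi>)) (A \<circ> \<phi>) p"
    using A.conjugate_pair_around_iff[OF D' p] by blast
  then obtain U where U: "p \<in> U" "conjugate_pair M D (induced_form M (A \<circ> \<phi>)) U (zpart \<circ> (A \<circ> \<phi>)) (wpart \<circ> (A \<circ> \<phi>))"
    unfolding conjugate_pair_around_def by blast
  \<comment> \<open>The two forms are known to be equal at points of M only, so the domain has to
    lie inside.\<close>
  have "U \<subseteq> X\<^sub>M"
    using U(2)
    by (intro openin_subset) (simp add: conjugate_pair_def holomorphic_coordinate_system_def coordinate_map_def)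
  then have "conjugate_pair M D (induced_form M \<phi>) U (zpart \<circ> (A \<circ> \<phi>)) (wpart \<circ> (A \<circ> \<phi>))"
    using U(2) form unfolding conjugate_pair_def real_special_coordinates_def by (simp add: subset_iff)
  then show ?thesis
    unfolding conjugate_pair_around_def by (intro exI[of _ A] exI[of _ U] conjI A(1) U(1))
qed

end

text \<open>A connection is determined on smooth fields only, with free values elsewhere; hence
  existence, uniqueness up to \<open>same_connection\<close>, and assertions for every induced D.
  The claim on conjugate pairs fails for some indefinite metrics and is given as an exact criterion,
  as its validity in the definite case, and up to a real symplectic change of coordinates.\<close>

theorem theorem3:
  fixes M :: "('a, 'n::finite) cmanifold" and \<phi> :: "'a \<Rightarrow> complex^('n + 'n)"
  assumes "complex_manifold M"
    and "holomorphic_immersion M \<phi>"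
    and "nondegenerate_map M \<phi>"
    and "lagrangian M \<phi>"
  shows "kahler_metric M (induced_metric M \<phi>) \<and>
    totally_complex M \<phi> \<and>
    (\<exists>D. induced_connection M \<phi> D) \<and>
    (\<forall>D D'. induced_connection M \<phi> D \<and> induced_connection M \<phi> D' \<longrightarrow> same_connection M D D') \<and>
    (\<forall>D. induced_connection M \<phi> D \<longrightarrow>
      special_kahler M D (induced_form M \<phi>) \<and>
      (\<forall>p\<in>topspace (mtop M). induced_form M \<phi> p = kahler_form (induced_metric M \<phi>) p) \<and>
      (\<forall>p\<in>topspace (mtop M).
        (\<exists>U. p \<in> U \<and> real_special_coordinates M D (induced_form M \<phi>) U (repart \<circ> \<phi>)) \<and>
        (definite (induced_metric M \<phi> p) \<longrightarrow>
           conjugate_pair_around M D (induced_form M \<phi>) \<phi> p) \<and>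
        (conjugate_pair_around M D (induced_form M \<phi>) \<phi> p \<longleftrightarrow>
           inj (mderiv M (zpart \<circ> \<phi>) p) \<and> inj (mderiv M (wpart \<circ> \<phi>) p)) \<and>
        (\<exists>A. real_symplectic A \<and>
           conjugate_pair_around M D (induced_form M \<phi>) (A \<circ> \<phi>) p)))"
proof -
  interpret lagrangian_immersion M \<phi>
    using assms by unfold_locales
  have "\<exists>U. p \<in> U \<and> real_special_coordinates M D (induced_form M \<phi>) U (repart \<circ> \<phi>)"
    if D: "induced_connection M \<phi> D" and p: "p \<in> topspace (mtop M)" for D p
  proof -
    obtain U where U: "p \<in> U" "real_coordinate_system M U (repart \<circ> \<phi>)"
      by (rule real_coordinate_system_F[OF p])
    show ?thesis using real_special_coordinatesI[OF D U(2)] U(1) by blast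
  qed
  then show ?thesis
    using kahler_metric_induced totally_complex_immersion induced_connection_exists
      induced_connection_unique induced_special_kahler induced_form_kahler
      conjugate_pair_around_iff definite_inj conjugate_pair_around_real_symplectic
    by (intro conjI allI impI ballI exI[of _ affine_connection_of_immersion]) simp_all
qed

end
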